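(* Let $V^0=0$ and let $V^k$, $U^k$ ($k\ge1$) solve the time-discrete scheme $$\delta_tV^k-D_k^{1-\alpha}(\Delta V)=F^k,\quad k=1,2,\qquad \bar\delta_tV^k-D_k^{1-\alpha}(\Delta V)=F^k,\quad k\ge3,$$ $$U^k=V^k+u_0+\sum_{\ell=0}^{m-1}I_t^{(\ell+1)\alpha}\Pi_L(\Delta^\ell\tilde f)(\cdot,t_k),\quad k\ge1,$$ with homogeneous Dirichlet boundary conditions for $V^k$. If the time-step ratios satisfy $\rho_k\in[0.5,1.7319]$, then $$\|V^n\|\le Q\Big(\sum_{k=1}^n\tau_k\|F^k\|^2\Big)^{1/2},\quad n\ge1,$$ $$\|U^n\|\le\|u_0\|+Q\Big(\sum_{k=1}^n\tau_k\|F^k\|^2\Big)^{1/2}+\Big\|\sum_{\ell=0}^{m-1}I_t^{(\ell+1)\alpha}\Pi_L(\Delta^\ell\tilde f)(\cdot,t_n)\Big\|,\quad n\ge1.$$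
   Context: Setting: $\Omega\subset\mathbb R^d$ ($1\le d\le3$) is open, bounded, with smooth boundary; $0<\alpha<1$, $T>0$, $m\in\mathbb N^+$, $L\in\mathbb N^+$; $u_0=u_0(x)$, $f=f(x,t)$ are given, $\tilde f:=f+\Delta u_0$, and $\tilde f\in C([0,T];H^{\hat\gamma+2m}(\Omega))$ for some $0<\hat\gamma<1/2$. $\|\cdot\|$ is the $L^2(\Omega)$ norm. $\beta_\nu(t):=t^{\nu-1}/\Gamma(\nu)$ and $I_t^\nu g:=\beta_\nu*g$ (convolution on $(0,t)$). $\{\lambda_q,\phi_q\}$ are the eigenvalues and $L^2$-orthonormal eigenfunctions of the Dirichlet Laplacian $-\Delta$ on $H^2\cap H^1_0$, and $\Pi_Lg:=\sum_{q=1}^L(g,\phi_q)\phi_q$. $F(x,t):=\partial_tI_t^{(m+1)\alpha}\Pi_L(\Delta^m\tilde f)(x,t)$, $F^k:=F(\cdot,t_k)$. Time mesh: $0=t_0<t_1<\dots<t_N=T$, $\tau_k=t_k-t_{k-1}$ ($k\ge1$), $\rho_k=\tau_k/\tau_{k-1}$ ($k\ge2$); $n,k\le N$. L2 approximation of the Caputo derivative of order $\gamma\in(0,1)$: $D_k^\gamma w:=\int_0^{t_k}\beta_{1-\gamma}(t_k-s)\,\partial_s(\Lambda^kw)(s)\,ds$, where $\Lambda^1w$ is the linear Lagrange interpolant at $t_0,t_1$ on $(0,t_1)$, and for $k\ge2$, $\Lambda^kw=\Lambda_{2,j}w$ on $(t_{j-1},t_j)$ for $1\le j<k$ and $\Lambda^kw=\Lambda_{2,k-1}w$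 on $(t_{k-1},t_k)$, with $\Lambda_{2,j}w$ the quadratic Lagrange interpolant of the values $w^{j-1},w^j,w^{j+1}$ at $t_{j-1},t_j,t_{j+1}$. In the scheme $\gamma=1-\alpha$. Difference operators: $\delta_kw:=w^k-w^{k-1}$, $\delta_tw^k:=\delta_kw/\tau_k$; for $k\ge3$ the variable-step BDF3 operator is $\bar\delta_tw^k:=\sum_{j=0}^2\sigma_j^{(k)}\delta_tw^{k-j}$ with $\sigma_j^{(k)}:=\sigma_j(\rho_k,\rho_{k-1})$, where $\sigma_0(y,z)=\frac{2y+1}{y+1}+\frac{yz}{yz+z+1}$, $\sigma_1(y,z)=-\frac{y}{y+1}-\frac{yz}{yz+z+1}-\frac{yz^2}{yz+z+1}\cdot\frac{y+1}{z+1}$, $\sigma_2(y,z)=\frac{yz^2}{yz+z+1}\cdot\frac{y+1}{z+1}$. $Q$ is a generic positive constant, independent of $n$ and of the time steps, possibly different at each occurrence. *)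

theory Defs
  imports "HOL-Analysis.Analysis"
begin

definition dir_deriv :: "'a::euclidean_space \<Rightarrow> ('a \<Rightarrow> real) \<Rightarrow> 'a \<Rightarrow> real" where
  "dir_deriv b g x = deriv (\<lambda>h. g (x + h *\<^sub>R b)) 0"

text \<open>Multi-indices are represented by lists of basis vectors; the order of the derivative is
  the length of the list.\<close>

definition partials :: "'a::euclidean_space list \<Rightarrow> ('a \<Rightarrow> real) \<Rightarrow> 'a \<Rightarrow> real" where
  "partials bs g = foldr dir_deriv bs g"

definition smooth :: "('a::euclidean_space \<Rightarrow> real) \<Rightarrow> bool" where
  "smooth g \<longleftrightarrow> (\<forall>bs. set bs \<subseteq> Basis \<longrightarrow>
     continuous_on UNIV (partials bs g) \<and>
     (\<forall>b\<in>Basis. \<forall>x. (\<lambda>h::real. partials bs g (x + h *\<^sub>R b)) differentiable (at 0)))"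

definition test_functions :: "'a::euclidean_space set \<Rightarrow> ('a \<Rightarrow> real) set" where
  "test_functions \<Omega> =
     {\<psi>. smooth \<psi> \<and> compact (closure {x. \<psi> x \<noteq> 0}) \<and> closure {x. \<psi> x \<noteq> 0} \<subseteq> \<Omega>}"

text \<open>Near each boundary point, \<open>\<Omega>\<close> is the part of a ball lying strictly above the graph of a
  smooth function of the coordinates orthogonal to a unit direction \<open>e\<close>; a function of these
  coordinates is a function on the whole space that is constant along \<open>e\<close>.\<close>

definition smooth_boundary :: "'a::euclidean_space set \<Rightarrow> bool" where
  "smooth_boundary \<Omega> \<longleftrightarrow> (\<forall>p\<in>frontier \<Omega>. \<exists>r>0. \<exists>e h.
     norm e = 1 \<and> smooth h \<and> (\<forall>x c. h (x + c *\<^sub>R e) = h x) \<and>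
     \<Omega> \<inter> ball p r = {x \<in> ball p r. h x < x \<bullet> e})"

text \<open>Elements of the spaces are represented by functions, to be read modulo equality almost
  everywhere on \<open>\<Omega>\<close>.\<close>

definition L2_space :: "'a::euclidean_space set \<Rightarrow> ('a \<Rightarrow> real) set" where
  "L2_space \<Omega> = {g \<in> borel_measurable (lebesgue_on \<Omega>). integrable (lebesgue_on \<Omega>) (\<lambda>x. (g x)\<^sup>2)}"

definition L2_inner :: "'a::euclidean_space set \<Rightarrow> ('a \<Rightarrow> real) \<Rightarrow> ('a \<Rightarrow> real) \<Rightarrow> real" where
  "L2_inner \<Omega> g h = (LINT x|lebesgue_on \<Omega>. g x * h x)"

definition L2_norm :: "'a::euclidean_space set \<Rightarrow> ('a \<Rightarrow> real) \<Rightarrow> real" where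
  "L2_norm \<Omega> g = sqrt (L2_inner \<Omega> g g)"

definition locally_integrable :: "'a::euclidean_space set \<Rightarrow> ('a \<Rightarrow> real) \<Rightarrow> bool" where
  "locally_integrable \<Omega> g \<longleftrightarrow> (\<forall>K. compact K \<and> K \<subseteq> \<Omega> \<longrightarrow> integrable (lebesgue_on K) g)"

definition has_weak_deriv ::
  "'a::euclidean_space set \<Rightarrow> 'a list \<Rightarrow> ('a \<Rightarrow> real) \<Rightarrow> ('a \<Rightarrow> real) \<Rightarrow> bool" where
  "has_weak_deriv \<Omega> bs g h \<longleftrightarrow> locally_integrable \<Omega> g \<and> locally_integrable \<Omega> h \<and>
     (\<forall>\<psi>\<in>test_functions \<Omega>. (LINT x|lebesgue_on \<Omega>. g x * partials bs \<psi> x)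
        = (-1) ^ length bs * (LINT x|lebesgue_on \<Omega>. h x * \<psi> x))"

text \<open>Weak derivatives are unique up to null sets; the operators below pick a representative.\<close>

definition weak_deriv ::
  "'a::euclidean_space set \<Rightarrow> 'a list \<Rightarrow> ('a \<Rightarrow> real) \<Rightarrow> 'a \<Rightarrow> real" where
  "weak_deriv \<Omega> bs g = (SOME h. has_weak_deriv \<Omega> bs g h)"

definition has_weak_laplacian ::
  "'a::euclidean_space set \<Rightarrow> ('a \<Rightarrow> real) \<Rightarrow> ('a \<Rightarrow> real) \<Rightarrow> bool" where
  "has_weak_laplacian \<Omega> g h \<longleftrightarrow> locally_integrable \<Omega> g \<and> locally_integrable \<Omega> h \<and>
     (\<forall>\<psi>\<in>test_functions \<Omega>. (LINT x|lebesgue_on \<Omega>. g x * (\<Sum>b\<in>Basis. partials [b, b] \<psi> x))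
        = (LINT x|lebesgue_on \<Omega>. h x * \<psi> x))"

definition weak_laplacian :: "'a::euclidean_space set \<Rightarrow> ('a \<Rightarrow> real) \<Rightarrow> 'a \<Rightarrow> real" where
  "weak_laplacian \<Omega> g = (SOME h. has_weak_laplacian \<Omega> g h)"

definition sobolev_space :: "'a::euclidean_space set \<Rightarrow> nat \<Rightarrow> ('a \<Rightarrow> real) set" where
  "sobolev_space \<Omega> k = {g \<in> L2_space \<Omega>.
     \<forall>bs. set bs \<subseteq> Basis \<and> length bs \<le> k \<longrightarrow> (\<exists>h\<in>L2_space \<Omega>. has_weak_deriv \<Omega> bs g h)}"

definition sobolev_norm :: "'a::euclidean_space set \<Rightarrow> nat \<Rightarrow> ('a \<Rightarrow> real) \<Rightarrow> real" where
  "sobolev_norm \<Omega> k g =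
     sqrt (\<Sum>bs\<in>{bs. set bs \<subseteq> Basis \<and> length bs \<le> k}. (L2_norm \<Omega> (weak_deriv \<Omega> bs g))\<^sup>2)"

definition sobolev_H10 :: "'a::euclidean_space set \<Rightarrow> ('a \<Rightarrow> real) set" where
  "sobolev_H10 \<Omega> = {g \<in> sobolev_space \<Omega> 1.
     \<forall>\<epsilon>>0. \<exists>\<psi>\<in>test_functions \<Omega>. sobolev_norm \<Omega> 1 (\<lambda>x. g x - \<psi> x) < \<epsilon>}"

text \<open>The space \<open>H\<^bsup>k+\<theta>\<^esup>(\<Omega>)\<close>, \<open>k \<in> \<nat>\<close>, \<open>0 < \<theta> < 1\<close>, with the Sobolev--Slobodeckij norm.\<close>

definition slobodeckij_kernel ::
  "real \<Rightarrow> ('a::euclidean_space \<Rightarrow> real) \<Rightarrow> 'a \<times> 'a \<Rightarrow> real" where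
  "slobodeckij_kernel \<theta> g =
     (\<lambda>(x, y). (g x - g y)\<^sup>2 / norm (x - y) powr (real DIM('a) + 2 * \<theta>))"

definition frac_sobolev_space ::
  "'a::euclidean_space set \<Rightarrow> nat \<Rightarrow> real \<Rightarrow> ('a \<Rightarrow> real) set" where
  "frac_sobolev_space \<Omega> k \<theta> = {g \<in> sobolev_space \<Omega> k.
     \<forall>bs. set bs \<subseteq> Basis \<and> length bs = k \<longrightarrow>
       integrable (lebesgue_on \<Omega> \<Otimes>\<^sub>M lebesgue_on \<Omega>) (slobodeckij_kernel \<theta> (weak_deriv \<Omega> bs g))}"

definition frac_sobolev_norm ::
  "'a::euclidean_space set \<Rightarrow> nat \<Rightarrow> real \<Rightarrow> ('a \<Rightarrow> real) \<Rightarrow> real" where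
  "frac_sobolev_norm \<Omega> k \<theta> g = sqrt ((sobolev_norm \<Omega> k g)\<^sup>2 +
     (\<Sum>bs\<in>{bs. set bs \<subseteq> Basis \<and> length bs = k}.
        integral\<^sup>L (lebesgue_on \<Omega> \<Otimes>\<^sub>M lebesgue_on \<Omega>)
          (slobodeckij_kernel \<theta> (weak_deriv \<Omega> bs g))))"

definition continuous_in_frac_sobolev ::
  "'a::euclidean_space set \<Rightarrow> nat \<Rightarrow> real \<Rightarrow> real \<Rightarrow> (real \<Rightarrow> 'a \<Rightarrow> real) \<Rightarrow> bool" where
  "continuous_in_frac_sobolev \<Omega> k \<theta> T g \<longleftrightarrow> (\<forall>t\<in>{0..T}. g t \<in> frac_sobolev_space \<Omega> k \<theta> \<and>
     ((\<lambda>s. frac_sobolev_norm \<Omega> k \<theta> (\<lambda>x. g s x - g t x)) \<longlongrightarrow> 0) (at t within {0..T}))"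

text \<open>Indices start at 1. Completeness expresses that all eigenvalues, with multiplicity, are
  listed. No ordering of the eigenvalues is imposed.\<close>

definition dirichlet_eigensystem ::
  "'a::euclidean_space set \<Rightarrow> (nat \<Rightarrow> real) \<Rightarrow> (nat \<Rightarrow> 'a \<Rightarrow> real) \<Rightarrow> bool" where
  "dirichlet_eigensystem \<Omega> lam \<phi> \<longleftrightarrow>
     (\<forall>q\<ge>1. \<phi> q \<in> sobolev_space \<Omega> 2 \<inter> sobolev_H10 \<Omega> \<and>
        (AE x in lebesgue_on \<Omega>. - weak_laplacian \<Omega> (\<phi> q) x = lam q * \<phi> q x)) \<and>
     (\<forall>p\<ge>1. \<forall>q\<ge>1. L2_inner \<Omega> (\<phi> p) (\<phi> q) = (if p = q then 1 else 0)) \<and>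
     (\<forall>g\<in>L2_space \<Omega>. (\<forall>q\<ge>1. L2_inner \<Omega> g (\<phi> q) = 0) \<longrightarrow> (AE x in lebesgue_on \<Omega>. g x = 0))"

definition spectral_proj ::
  "'a::euclidean_space set \<Rightarrow> (nat \<Rightarrow> 'a \<Rightarrow> real) \<Rightarrow> nat \<Rightarrow> ('a \<Rightarrow> real) \<Rightarrow> 'a \<Rightarrow> real" where
  "spectral_proj \<Omega> \<phi> L g x = (\<Sum>q=1..L. L2_inner \<Omega> g (\<phi> q) * \<phi> q x)"

definition frac_kernel :: "real \<Rightarrow> real \<Rightarrow> real" where
  "frac_kernel \<nu> t = t powr (\<nu> - 1) / Gamma \<nu>"

definition frac_integral :: "real \<Rightarrow> (real \<Rightarrow> real) \<Rightarrow> real \<Rightarrow> real" where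
  "frac_integral \<nu> g t = (LINT s:{0<..<t}|lborel. frac_kernel \<nu> (t - s) * g s)"

definition f_tilde ::
  "'a::euclidean_space set \<Rightarrow> ('a \<Rightarrow> real) \<Rightarrow> (real \<Rightarrow> 'a \<Rightarrow> real) \<Rightarrow> real \<Rightarrow> 'a \<Rightarrow> real" where
  "f_tilde \<Omega> u0 f t x = f t x + weak_laplacian \<Omega> u0 x"

text \<open>\<open>frac_proj_term \<Omega> \<phi> L \<nu> l g t x\<close> is \<open>I\<^sub>t\<^sup>\<nu> \<Pi>\<^sub>L(\<Delta>\<^sup>l g)(x,t)\<close>; the projection acts in space,
  the fractional integral in time at fixed \<open>x\<close>.\<close>

definition frac_proj_term ::
  "'a::euclidean_space set \<Rightarrow> (nat \<Rightarrow> 'a \<Rightarrow> real) \<Rightarrow> nat \<Rightarrow> real \<Rightarrow> nat \<Rightarrow>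
   (real \<Rightarrow> 'a \<Rightarrow> real) \<Rightarrow> real \<Rightarrow> 'a \<Rightarrow> real" where
  "frac_proj_term \<Omega> \<phi> L \<nu> l g t x =
     frac_integral \<nu> (\<lambda>s. spectral_proj \<Omega> \<phi> L ((weak_laplacian \<Omega> ^^ l) (g s)) x) t"

text \<open>The time derivative is taken within \<open>[0,T]\<close>, since the data are only given there; at
  \<open>t = T\<close> it is one-sided. If \<open>(m+1)\<alpha> < 1\<close> it need not exist for merely continuous data; the
  value is then unspecified.\<close>

definition source_F ::
  "'a::euclidean_space set \<Rightarrow> real \<Rightarrow> (nat \<Rightarrow> 'a \<Rightarrow> real) \<Rightarrow> nat \<Rightarrow> nat \<Rightarrow> real \<Rightarrow>
   (real \<Rightarrow> 'a \<Rightarrow> real) \<Rightarrow> real \<Rightarrow> 'a \<Rightarrow> real" where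
  "source_F \<Omega> T \<phi> L m \<alpha> g t x =
     vector_derivative (\<lambda>s. frac_proj_term \<Omega> \<phi> L (real (m + 1) * \<alpha>) m g s x) (at t within {0..T})"

definition correction_sum ::
  "'a::euclidean_space set \<Rightarrow> (nat \<Rightarrow> 'a \<Rightarrow> real) \<Rightarrow> nat \<Rightarrow> nat \<Rightarrow> real \<Rightarrow>
   (real \<Rightarrow> 'a \<Rightarrow> real) \<Rightarrow> real \<Rightarrow> 'a \<Rightarrow> real" where
  "correction_sum \<Omega> \<phi> L m \<alpha> g t x =
     (\<Sum>l<m. frac_proj_term \<Omega> \<phi> L (real (l + 1) * \<alpha>) l g t x)"

definition time_mesh :: "real \<Rightarrow> nat \<Rightarrow> (nat \<Rightarrow> real) \<Rightarrow> bool" where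
  "time_mesh T N t \<longleftrightarrow> t 0 = 0 \<and> t N = T \<and> (\<forall>k<N. t k < t (Suc k))"

definition step :: "(nat \<Rightarrow> real) \<Rightarrow> nat \<Rightarrow> real" where
  "step t k = t k - t (k - 1)"

definition step_ratio :: "(nat \<Rightarrow> real) \<Rightarrow> nat \<Rightarrow> real" where
  "step_ratio t k = step t k / step t (k - 1)"

definition diff_quot :: "(nat \<Rightarrow> real) \<Rightarrow> (nat \<Rightarrow> real) \<Rightarrow> nat \<Rightarrow> real" where
  "diff_quot t w k = (w k - w (k - 1)) / step t k"

definition bdf3_sigma :: "nat \<Rightarrow> real \<Rightarrow> real \<Rightarrow> real" where
  "bdf3_sigma j y z =
     (if j = 0 then (2*y + 1) / (y + 1) + y*z / (y*z + z + 1)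
      else if j = 1 then - (y / (y + 1)) - y*z / (y*z + z + 1)
                         - y*z\<^sup>2 / (y*z + z + 1) * ((y + 1) / (z + 1))
      else y*z\<^sup>2 / (y*z + z + 1) * ((y + 1) / (z + 1)))"

definition bdf3 :: "(nat \<Rightarrow> real) \<Rightarrow> (nat \<Rightarrow> real) \<Rightarrow> nat \<Rightarrow> real" where
  "bdf3 t w k =
     (\<Sum>j\<le>2. bdf3_sigma j (step_ratio t k) (step_ratio t (k - 1)) * diff_quot t w (k - j))"

definition lagrange1 :: "(nat \<Rightarrow> real) \<Rightarrow> (nat \<Rightarrow> real) \<Rightarrow> real \<Rightarrow> real" where
  "lagrange1 t w s = w 0 * (s - t 1) / (t 0 - t 1) + w 1 * (s - t 0) / (t 1 - t 0)"

definition lagrange2 :: "(nat \<Rightarrow> real) \<Rightarrow> (nat \<Rightarrow> real) \<Rightarrow> nat \<Rightarrow> real \<Rightarrow> real" where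
  "lagrange2 t w j s =
     (\<Sum>i\<in>{j-1..j+1}. w i * (\<Prod>l\<in>{j-1..j+1} - {i}. (s - t l) / (t i - t l)))"

text \<open>For \<open>s\<close> in \<open>(t\<^sub>j\<^sub>-\<^sub>1, t\<^sub>j)\<close>, the least index \<open>i\<close> with \<open>s \<le> t\<^sub>i\<close> is \<open>j\<close>; the minimum with
  \<open>k - 1\<close> makes the last interval \<open>(t\<^sub>k\<^sub>-\<^sub>1, t\<^sub>k)\<close> use the quadratic through
  \<open>t\<^sub>k\<^sub>-\<^sub>2, t\<^sub>k\<^sub>-\<^sub>1, t\<^sub>k\<close>.\<close>

definition interpolant :: "(nat \<Rightarrow> real) \<Rightarrow> nat \<Rightarrow> (nat \<Rightarrow> real) \<Rightarrow> real \<Rightarrow> real" where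
  "interpolant t k w s =
     (if k = 1 then lagrange1 t w s else lagrange2 t w (min (LEAST i. s \<le> t i) (k - 1)) s)"

definition caputo_L2 :: "(nat \<Rightarrow> real) \<Rightarrow> real \<Rightarrow> nat \<Rightarrow> (nat \<Rightarrow> real) \<Rightarrow> real" where
  "caputo_L2 t \<gamma> k w =
     (LINT s:{0<..<t k}|lborel. frac_kernel (1 - \<gamma>) (t k - s) * deriv (interpolant t k w) s)"

text \<open>The equations hold in \<open>L\<^sup>2(\<Omega>)\<close>, i.e. almost everywhere; the Dirichlet condition is
  membership in \<open>H\<^sup>1\<^sub>0(\<Omega>)\<close>.\<close>

definition scheme_solution ::
  "'a::euclidean_space set \<Rightarrow> real \<Rightarrow> nat \<Rightarrow> (nat \<Rightarrow> real) \<Rightarrow>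
   (nat \<Rightarrow> 'a \<Rightarrow> real) \<Rightarrow> (nat \<Rightarrow> 'a \<Rightarrow> real) \<Rightarrow> bool" where
  "scheme_solution \<Omega> \<alpha> N t F V \<longleftrightarrow>
     (AE x in lebesgue_on \<Omega>. V 0 x = 0) \<and>
     (\<forall>k\<in>{1..N}. V k \<in> sobolev_space \<Omega> 2 \<inter> sobolev_H10 \<Omega> \<and>
        (AE x in lebesgue_on \<Omega>.
           (if k \<le> 2 then diff_quot t (\<lambda>j. V j x) k else bdf3 t (\<lambda>j. V j x) k)
             - caputo_L2 t (1 - \<alpha>) k (\<lambda>j. weak_laplacian \<Omega> (V j) x) = F k x))"

end

theory Submission
  imports Defs
begin

text \<open>Test the scheme with \<open>V\<^sup>k - V\<^sup>k\<^sup>-\<^sup>1\<close> and sum over \<open>k\<close>. The BDF3 part is coercive: a quadratic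
  storage function of two consecutive difference quotients turns the sum of
  \<open>\<tau>\<^sub>k \<delta>\<^sub>tV\<^sup>k\<close> times the BDF3 quotient into at least \<open>c \<Sum> \<tau>\<^sub>k (\<delta>\<^sub>tV\<^sup>k)\<^sup>2\<close>, pointwise in space, as
  soon as the identity for the first two steps is added twice more to pay for the initial storage.
  The memory part is dissipative: by Green's identity it is the sum over \<open>k\<close> of
  \<open>D\<^sub>k\<nabla>V\<close> times \<open>\<nabla>V\<^sup>k - \<nabla>V\<^sup>k\<^sup>-\<^sup>1\<close>, and since the kernel is a mixture of decaying
  exponentials, its nonnegativity reduces to an exponential kernel, for which the memory obeys a
  one-step recursion and \<open>1/2 G\<^sup>2\<close> plus a multiple of the squared difference quotient is a storage
  function. Young's inequality then bounds \<open>\<Sum> \<tau>\<^sub>k \<parallel>\<delta>\<^sub>tV\<^sup>k\<parallel>\<^sup>2\<close> by the data, and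
  \<open>\<parallel>V\<^sup>n\<parallel>\<^sup>2 \<le> T \<Sum> \<tau>\<^sub>k \<parallel>\<delta>\<^sub>tV\<^sup>k\<parallel>\<^sup>2\<close>.\<close>

text \<open>Both positivity statements concern real sequences. The BDF3 quotient involves difference
  quotients only, and the L2 formula is a finite combination of nodal values with coefficients that
  do not depend on \<open>x\<close>. The first is therefore applied to the values of
  \<open>V\<close> at almost every \<open>x\<close>, the second to the values of its first
  derivatives; space enters only through Green's identity. Two obstacles shape the scalar part. The
  upper ratio leaves the BDF3 inequality so little room that crude estimates fail, so it is
  certified by exact polynomial arithmetic. For the memory, the quadratic used on the newest
  interval is replaced as soon as the next node enters, so the discrete derivative itself does not
  evolve by a recursion: the state is the memory without the curvature of the newest interval. The
  step estimate for that state must hold with the same constants for all products of exponential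
  rate and step, from very small to very large. The extra copies for the first two steps do not
  spoil the sign of the memory, because nonnegativity holds for every final index. The resulting
  constant depends on \<open>T\<close> alone.\<close>

section \<open>Dissipativity of the variable-step BDF3 operator\<close>

text \<open>The map \<open>u \<mapsto> Y / U\<close> carries \<open>[0, \<infinity>)\<close> onto \<open>[1/2, 407/235)\<close>, an interval slightly longer than
  \<open>[0.5, 1.7319]\<close>, so the coefficients below are, up to positive factors, the Bernstein
  coefficients on that square of the three polynomials of \<open>bdf3_polynomials\<close>.\<close>

lemma bdf3_bernstein1:
  fixes u v :: real
  assumes "0 \<le> u" and "0 \<le> v" and "Y = 235 + 814*u" and "U = 470 + 470*u" and "Z = 235 + 814 * v" and "W = 470 + 470 * v"
    and "E1 = Y + U" and "E2 = Y*Z + Z*U + U*W" and "E3 = Z + W" and "G = 14*W + 141*Z"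
  shows "0 \<le> 47*(Y*E2*E3*U*W + Y*Z*E1*E3*U*W + Y*Z^2*E1^2*W)*G - 28*Y*E1*E2*E3*G*W - 4606*Z^4*Y*E1^2"
proof -
  have "47*(Y*E2*E3*U*W + Y*Z*E1*E3*U*W + Y*Z^2*E1^2*W)*G - 28*Y*E1*E2*E3*G*W - 4606*Z^4*Y*E1^2
    = (18145340338282923750000 * v^0 + 167423090140029726468750 * v^1 + 537917156997119075587500 * v^2 + 670686349831478000385000 * v^3 + 221584695404062084266000 * v^4)*u^0
      + (96645804623903840625000 * v^0 + 921832679512141440862500 * v^1 + 3026333916339121591695000 * v^2 + 3770817392195104371534000 * v^3 + 1140002466159059170596000 * v^4)*u^1
      + (128591327325818695500000 * v^0 + 1321663353735680037630000 * v^1 + 4528807270081460006814000 * v^2 + 5589339546074673883917600 * v^3 + 1290184786381581680734080 * v^4)*u^2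
      + (39960898809951607620000 * v^0 + 475769661705572277648000 * v^1 + 1732242503322042543612000 * v^2 + 1991158648652034526568640 * v^3 + 32359120222767926016 * v^4)*u^3"
    unfolding assms(3-) by algebra
  also have "\<dots> \<ge> 0"
    using assms(1,2) by simp
  finally show ?thesis .
qed

lemma bdf3_bernstein2:
  fixes u v :: real
  assumes "0 \<le> u" and "0 \<le> v" and "Y = 235 + 814*u" and "U = 470 + 470*u" and "Z = 235 + 814 * v" and "W = 470 + 470 * v"
    and "E1 = Y + U" and "E2 = Y*Z + Z*U + U*W" and "E3 = Z + W" and "G = 14*W + 141*Z" and "P = 47*(Y*E2*E3*U*W + Y*Z*E1*E3*U*W + Y*Z^2*E1^2*W)*G - 28*Y*E1*E2*E3*G*W - 4606*Z^4*Y*E1^2"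
  shows "0 \<le> 36058400*G*((2*Y+U)*E2+Y*Z*E1)*E2*E3^2*U^3*W - 49482916*G*E1*E2^2*E3^2*U^3*W - 2965803400*Y^3*Z^5*E1^3*W - 328800*P*E2*E3*U^2"
proof -
  have "36058400*G*((2*Y+U)*E2+Y*Z*E1)*E2*E3^2*U^3*W - 49482916*G*E1*E2^2*E3^2*U^3*W - 2965803400*Y^3*Z^5*E1^3*W - 328800*P*E2*E3*U^2
    = (16433862408943481035949284167785156250000 * v^0 + 435719107822832127320668822701555468750000 * v^1 + 3391695832981166574059264156401176562500000 * v^2 + 12577061318066420803291411338416204250000000 * v^3 + 25457528859617742577222540168702760400000000 * v^4 + 27748833447193265944323352165703356620000000 * v^5 + 12933861393162885398598452740866186120000000 * v^6)*u^0
      + (2779145456005619335199982343955217187500000 * v^0 + 34756080770063583674816858351225451562500000 * v^1 + 178094793529132755712720749269963697375000000 * v^2 + 482667446140128336445928497704427561800000000 * v^3 + 740485862170822933286731411733344852920000000 * v^4 + 622805454424045063419133028603808761208000000 * v^5 + 230211064437112044535262954894655545808000000 * v^6)*u^1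
      + (16356105636640822969421623391880405000000000 * v^0 + 200861669740439223995164711214234584500000000 * v^1 + 1008515452632785958288258480021671949300000000 * v^2 + 2664269148729604770691287515619562215540000000 * v^3 + 3949172905576578708174393658313652501384000000 * v^4 + 3176085607627948691503949204701182701270400000 * v^5 + 1116713544990086279456640898880212247558400000 * v^6)*u^2
      + (38497423862964920864314601580137805375000000 * v^0 + 470297463426076679390905994145521062125000000 * v^1 + 2340782181416376256418072503399652807970000000 * v^2 + 6095710198259531488682919810376556434596000000 * v^3 + 8840020578812572136328206080709377672555200000 * v^4 + 6910331073960952293906500100716017782263040000 * v^5 + 2368293612647594598109373574102462833379840000 * v^6)*u^3
      + (44617731883126103892737292928816405500000000 * v^0 + 541283250621859070950764241098055789500000000 * v^1 + 2658761071552487724122907229482250443360000000 * v^2 + 6769083364904990991826910554408987767648000000 * v^3 + 9481219682073202787077577423774353517625600000 * v^4 + 7091257836834430141036177071806936789560320000 * v^5 + 2352808472084122102376121752726026021386240000 * v^6)*u^4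
      + (25187165719105122674634305246324004000000000 * v^0 + 300596344590956525597336157333577008000000000 * v^1 + 1433943049980403319763372278341677669360000000 * v^2 + 3472053540494260883425159202701607895408000000 * v^3 + 4481243819081584010809683548891003249529600000 * v^4 + 2984965907307865096872150618747047270645760000 * v^5 + 902725930905208529817970938354915278131200000 * v^6)*u^5
      + (5435823543608784583167683766867331200000000 * v^0 + 62379714493942515993127717064100297600000000 * v^1 + 276983805562497472526421394780615026240000000 * v^2 + 584342487551878318859873780717914878144000000 * v^3 + 563164750369682743887975894267413907532800000 * v^4 + 177149106947435676801751590436407073701888000 * v^5 + 6054117623991388094940897986955460608000 * v^6)*u^6"
    unfolding assms(3-) by algebra
  also have "\<dots> \<ge> 0"
    using assms(1,2) by simp
  finally show ?thesis .
qed

lemma bdf3_bernstein3: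
  fixes u v :: real
  assumes "0 \<le> u" and "0 \<le> v" and "Y = 235 + 814*u" and "U = 470 + 470*u" and "Z = 235 + 814 * v" and "W = 470 + 470 * v"
    and "E1 = Y + U" and "E2 = Y*Z + Z*U + U*W" and "E3 = Z + W" and "G = 14*W + 141*Z" and "P = 47*(Y*E2*E3*U*W + Y*Z*E1*E3*U*W + Y*Z^2*E1^2*W)*G - 28*Y*E1*E2*E3*G*W - 4606*Z^4*Y*E1^2"
  shows "0 \<le> 12*((61852*U - 137*(14*U+141*Y))*G*W^2 - 1315748*Z^3*U)*E1*E2*E3*U - 6713*Y*P*W"
proof -
  have "12*((61852*U - 137*(14*U+141*Y))*G*W^2 - 1315748*Z^3*U)*E1*E2*E3*U - 6713*Y*P*W
    = (202493629351629971409510750000000 * v^0 + 1745025815752036788860143551562500 * v^1 + 5623090988769710946366063312187500 * v^2 + 8323182294338182696047138030375000 * v^3 + 5408026441491752319403508650650000 * v^4 + 1052599927912226153345350191660000 * v^5)*u^0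
      + (892559943329159382775109231250000 * v^0 + 7664682894082635001350363311250000 * v^1 + 24530642293264547388940509535500000 * v^2 + 35860465300208716678209567476700000 * v^3 + 22696126837780005155864994368400000 * v^4 + 3957683830483557200461218749616000 * v^5)*u^1
      + (1330890103144273727131280662500000 * v^0 + 11167568196107439462596214945750000 * v^1 + 34654522032225124791580612807650000 * v^2 + 48658165521283263081488779735560000 * v^3 + 28951421465194028648941980703824000 * v^4 + 3802341762148394602517797847606400 * v^5)*u^2
      + (789599586925355066295338757000000 * v^0 + 6133488444756895632818290765200000 * v^1 + 17143859786883400458920653258200000 * v^2 + 21122577172576873606800892368720000 * v^3 + 10700824333996156273221005245555200 * v^4 + 218980910776301263688237872512000 * v^5)*u^3
      + (167281304443813616560816609200000 * v^0 + 1071206787397736522809706874480000 * v^1 + 2126940470641909466668860786960000 * v^2 + 1474463918195507976175601936342400 * v^3 + 626433169245412671647846674709760 * v^4 + 811152079224533180707992437760 * v^5)*u^4"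
    unfolding assms(3-) by algebra
  also have "\<dots> \<ge> 0"
    using assms(1,2) by simp
  finally show ?thesis .
qed

text \<open>Inverse of the Moebius parametrisation of \<open>[l, h)\<close>; the parameter blows up
  at \<open>h\<close>, hence the strict upper bound. The factor \<open>s\<close> clears
  denominators: \<open>s = 470\<close> turns \<open>1/2\<close> and \<open>407/235\<close> into 235
  and 814.\<close>

lemma barycentric_coordinate:
  fixes y l h s :: real
  assumes "l \<le> y" "y < h"
  obtains u where "0 \<le> u" "y * (s + s * u) = s * l + s * h * u"
proof
  show "0 \<le> (y - l) / (h - y)" using assms by simp
  show "y * (s + s * ((y - l) / (h - y))) = s * l + s * h * ((y - l) / (h - y))"
    using assms by (simp add: divide_simps) (simp add: algebra_simps)
qed

lemma nonneg_if_mult_pos_nonneg: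
  fixes a b :: real
  assumes "0 \<le> a * b" "0 < b"
  shows "0 \<le> a"
  using assms by (simp add: zero_le_mult_iff)

text \<open>Eliminating \<open>d2\<close> in \<open>bdf3_dissipation\<close> leaves a quadratic form
  in \<open>d0\<close> and \<open>d1\<close>. Up to positive factors, \<open>P\<close> is its
  negated cross coefficient, and the other two polynomials are its diagonal coefficients reduced by
  fixed multiples of the negated cross coefficient. Homogenising in \<open>Y / U\<close> and
  \<open>Z / W\<close> multiplies each of them by positive powers of \<open>U\<close> and
  \<open>W\<close>, so signs are preserved.\<close>

lemma bdf3_polynomials:
  fixes y z :: real
  assumes "1/2 \<le> y" "y < 407/235" "1/2 \<le> z" "z < 407/235"
    and "D1 = y + 1" and "D2 = y*z + z + 1" and "D3 = z + 1" and "G = 14 + 141*z"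
    and "P = 47*(y*D2*D3 + y*z*D1*D3 + y*z^2*D1^2)*G - 28*y*D1*D2*D3*G - 4606*z^4*y*D1^2"
  shows "0 \<le> P"
    and "0 \<le> 36058400*G*((2*y + 1)*D2 + y*z*D1)*D2*D3^2 - 49482916*G*D1*D2^2*D3^2
      - 2965803400*y^3*z^5*D1^3 - 328800*P*D2*D3" (is "0 \<le> ?Q")
    and "0 \<le> 12*((61852 - 137*(14 + 141*y))*G - 1315748*z^3)*D1*D2*D3 - 6713*y*P" (is "0 \<le> ?R")
proof -
  obtain u where u: "0 \<le> u" "y * (470 + 470 * u) = 235 + 814 * u"
    using barycentric_coordinate[of "1/2" y "407/235" 470] assms by auto
  obtain v where v: "0 \<le> v" "z * (470 + 470 * v) = 235 + 814 * v"
    using barycentric_coordinate[of "1/2" z "407/235" 470] assms by auto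
  define U Y W Z where d: "U = 470 + 470 * u" "Y = 235 + 814 * u" "W = 470 + 470 * v" "Z = 235 + 814 * v"
  have y: "y * U = Y" and z: "z * W = Z" and pos: "U > 0" "W > 0"
    using u v by (auto simp: d)
  define E1 E2 E3 H where E: "E1 = Y + U" "E2 = Y*Z + Z*U + U*W" "E3 = Z + W" "H = 14*W + 141*Z"
  have E': "E1 = D1*U" "E2 = D2*(U*W)" "E3 = D3*W" "H = G*W"
    unfolding E assms(5-8) y[symmetric] z[symmetric] by algebra+
  define S where S: "S = 47*(Y*E2*E3*U*W + Y*Z*E1*E3*U*W + Y*Z^2*E1^2*W)*H - 28*Y*E1*E2*E3*H*W - 4606*Z^4*Y*E1^2"
  have S': "S = P * (U^3 * W^4)"
    unfolding S E' y[symmetric] z[symmetric] assms(9) by algebra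
  have "0 \<le> S" unfolding S by (rule bdf3_bernstein1[OF u(1) v(1) d(2,1,4,3) E])
  then show "0 \<le> P" unfolding S' by (rule nonneg_if_mult_pos_nonneg) (use pos in simp)
  have "?Q * (U^6 * W^6) = 36058400*H*((2*Y+U)*E2+Y*Z*E1)*E2*E3^2*U^3*W - 49482916*H*E1*E2^2*E3^2*U^3*W - 2965803400*Y^3*Z^5*E1^3*W - 328800*S*E2*E3*U^2"
    unfolding E' y[symmetric] z[symmetric] S' by algebra
  also have "\<dots> \<ge> 0" by (rule bdf3_bernstein2[OF u(1) v(1) d(2,1,4,3) E S])
  finally show "0 \<le> ?Q" by (rule nonneg_if_mult_pos_nonneg) (use pos in simp)
  have "?R * (U^4 * W^5) = 12*((61852*U - 137*(14*U+141*Y))*H*W^2 - 1315748*Z^3*U)*E1*E2*E3*U - 6713*Y*S*W"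
    unfolding E' y[symmetric] z[symmetric] S' by algebra
  also have "\<dots> \<ge> 0" by (rule bdf3_bernstein3[OF u(1) v(1) d(2,1,4,3) E S])
  finally show "0 \<le> ?R" by (rule nonneg_if_mult_pos_nonneg) (use pos in simp)
qed

text \<open>The numbers in the storage function come from numerical semidefinite programming. There is
  hardly any freedom: at \<open>y = z = 1.7319\<close> the dissipation inequality is tight up to \<open>2 \<cdot> 10\<^sup>-\<^sup>4\<close>.\<close>

definition bdf3_weight :: "real \<Rightarrow> real" where "bdf3_weight z = (14 + 141 * z) / 329"

definition bdf3_storage :: "real \<Rightarrow> real \<Rightarrow> real \<Rightarrow> real" where
  "bdf3_storage y d0 d1 = 188/137 * d0\<^sup>2 - 28/47 * y * d0 * d1 + bdf3_weight y / y * d1\<^sup>2"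

text \<open>Dividing the old storage by \<open>y\<close>, the ratio of the new step to the old one,
  makes the storages telescope once the inequality is multiplied by the new step. The rate
  \<open>1 / 27400\<close> is small enough to survive at the upper end of the ratio range.\<close>

lemma bdf3_dissipation:
  fixes y z d0 d1 d2 :: real
  assumes yz: "1/2 \<le> y" "y < 407/235" "1/2 \<le> z" "z < 407/235"
  shows "bdf3_storage y d0 d1 - bdf3_storage z d1 d2 / y + d0\<^sup>2 / 27400
    \<le> d0 * (bdf3_sigma 0 y z * d0 + bdf3_sigma 1 y z * d1 + bdf3_sigma 2 y z * d2)"
proof -
  define D1 D2 D3 G where D: "D1 = y + 1" "D2 = y*z + z + 1" "D3 = z + 1" "G = 14 + 141*z"
  define P where P: "P = 47*(y*D2*D3 + y*z*D1*D3 + y*z^2*D1^2)*G - 28*y*D1*D2*D3*G - 4606*z^4*y*D1^2"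
  note pol = bdf3_polynomials[OF yz D P]
  have pos: "y > 0" "z > 0" using yz by auto
  have Dpos: "D1 > 0" "D2 > 0" "D3 > 0" "G > 0" unfolding D using pos by (auto intro!: add_pos_pos)
  define s0 s1 s2 where s: "s0 = bdf3_sigma 0 y z" "s1 = bdf3_sigma 1 y z" "s2 = bdf3_sigma 2 y z"
  have s0: "s0 = ((2*y + 1)*D2 + y*z*D1) / (D1*D2)" and s2: "s2 = y*z^2*D1/(D2*D3)"
    and s1: "s1 = - (y*D2*D3 + y*z*D1*D3 + y*z^2*D1^2) / (D1*D2*D3)"
    unfolding s bdf3_sigma_def D[symmetric] using Dpos
    by (simp_all add: D(1,3)[symmetric] D(2)[symmetric] add_ac divide_simps power2_eq_square) (simp_all add: algebra_simps)
  \<comment> \<open>The square of \<open>d2\<close> has coefficient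
    \<open>G / (329 * y * z)\<close>. Completing this square leaves
    \<open>m11 * d0^2 + m12 * d0 * d1 + m22 * d1^2\<close>; \<open>m12\<close> is the whole cross
    coefficient, not half of it.\<close>
  define m11 m12 m22 where m: "m11 = s0 - 188/137 - 1/27400 - 329*y*z * s2^2/(4*G)"
    "m12 = s1 + 28/47*y + 98*z^2 * s2/G" "m22 = (188/137 - (14 + 141*y)/329 - 1372/47*z^3/G)/y"
  have P': "P = - m12 * (47*D1*D2*D3*G)"
    unfolding m s1 s2 P using Dpos by (simp add: field_simps) (simp add: algebra_simps power2_eq_square power4_eq_xxxx)
  have hs: "s0 * D1 * D2 = (2*y + 1)*D2 + y*z*D1" "s2 * D2 * D3 = y*z^2*D1"
    unfolding s0 s2 using Dpos by simp_all
  have "m11 * G = (s0 - 37601/27400) * G - 329/4*y*z * s2^2"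
    unfolding m using Dpos by (simp add: field_simps)
  then have "m11 * (36058400*G*D1*D2^2*D3^2) = 36058400*G*(s0 * D1 * D2)*D2*D3^2
      - 49482916*G*D1*D2^2*D3^2 - 2965803400*y*z*(s2 * D2 * D3)^2*D1"
    by algebra
  then have "(m11 + 3/7*m12) * (36058400*G*D1*D2^2*D3^2) = 36058400*G*((2*y + 1)*D2 + y*z*D1)*D2*D3^2
      - 49482916*G*D1*D2^2*D3^2 - 2965803400*y^3*z^5*D1^3 - 328800*P*D2*D3"
    unfolding P' hs by algebra
  then have "0 \<le> (m11 + 3/7*m12) * (36058400*G*D1*D2^2*D3^2)"
    using pol(2) by simp
  then have 1: "0 \<le> m11 + 3/7*m12" by (rule nonneg_if_mult_pos_nonneg) (use Dpos in simp)
  have "m22 * (y * G) = (188/137 - (14 + 141*y)/329) * G - 1372/47*z^3"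
    unfolding m using Dpos pos by (simp add: field_simps)
  then have "(m22 + 7/12*m12) * (540876*(y*G)*D1*D2*D3)
      = 12*((61852 - 137*(14 + 141*y))*G - 1315748*z^3)*D1*D2*D3 - 6713*y*P"
    unfolding P' by algebra
  then have "0 \<le> (m22 + 7/12*m12) * (540876*(y*G)*D1*D2*D3)"
    using pol(3) by simp
  then have 2: "0 \<le> m22 + 7/12*m12" by (rule nonneg_if_mult_pos_nonneg) (use Dpos pos in simp)
  have 3: "0 \<le> - m12" using pol(1) unfolding P' by (rule nonneg_if_mult_pos_nonneg) (use Dpos in simp)
  \<comment> \<open>Diagonal dominance with the fixed weight \<open>7/6\<close>: since
    \<open>m12 \<le> 0\<close>, the cross term is carried by a nonnegative multiple of
    \<open>(d0 - 7/6 * d1)^2\<close>, which costs \<open>3/7\<close> and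
    \<open>3/7 * 49/36 = 7/12\<close> of \<open>m12\<close> on the diagonal. This avoids the
    determinant, whose degree would be much higher.\<close>
  have "d0 * (s0 * d0 + s1 * d1 + s2 * d2) - (bdf3_storage y d0 d1 - bdf3_storage z d1 d2 / y + d0\<^sup>2 / 27400)
    = (m11 + 3/7*m12) * d0^2 + (m22 + 7/12*m12) * d1^2 + (- m12) * (3/7) * (d0 - 7/6*d1)^2
     + G/(329*y*z) * (d2 + 329*(y*z * s2*d0 - 28/47*z^2*d1)/(2*G))^2"
    unfolding bdf3_storage_def bdf3_weight_def D(4)[symmetric] m using pos Dpos
    by (simp add: field_simps power2_eq_square) (simp add: algebra_simps power_numeral_reduce)
  also have "\<dots> \<ge> 0"
    by (intro add_nonneg_nonneg mult_nonneg_nonneg 1 2 3) (use pos Dpos in auto)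
  finally show ?thesis unfolding s by simp
qed
text \<open>The discriminant condition compares \<open>y^3\<close> with the affine function
  \<open>bdf3_weight\<close>; bounding \<open>y^2\<close> by its maximum makes both sides affine in
  \<open>y\<close>. Nonnegativity is what permits discarding the final storage in
  \<open>bdf3_energy\<close>.\<close>

lemma bdf3_storage_nonneg:
  assumes y: "1/2 \<le> y" "y < 407/235"
  shows "0 \<le> bdf3_storage y a b"
proof -
  have "y^3 \<le> (407/235)^2 * y"
    using y mult_mono[of "y^2" "(407/235)^2" y y] power_mono[of y "407/235" 2] by (simp add: power3_eq_cube power2_eq_square)
  then have "0 \<le> 188/137 * bdf3_weight y - (14/47)^2 * y^3"
    using y unfolding bdf3_weight_def by (simp add: field_simps) 
  then have "0 \<le> (188/137 * bdf3_weight y - (14/47)^2 * y^3) / y * b^2 + (188/137 * a - 14/47 * y * b)^2"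
    using y by (intro add_nonneg_nonneg mult_nonneg_nonneg divide_nonneg_nonneg) auto
  also have "\<dots> = 188/137 * bdf3_storage y a b"
    using y unfolding bdf3_storage_def by (simp add: field_simps power2_eq_square power3_eq_cube)
  finally show ?thesis by simp
qed

text \<open>The price of the initial storage, divided by the first step: \<open>a\<close> and
  \<open>b\<close> stand for the second and the first quotient. Since the scheme is of first order
  for \<open>k \<le> 2\<close>, the right side is three times the first two terms of the tested sum,
  namely the regular copy and the two extra ones.\<close>

lemma bdf3_storage_le:
  assumes y: "1/2 \<le> y" "y < 407/235"
  shows "y * bdf3_storage y a b + (b\<^sup>2 + y * a\<^sup>2) / 27400 \<le> 3 * (b\<^sup>2 + y * a\<^sup>2)"
proof -
  have w: "bdf3_weight y \<le> 1" using y unfolding bdf3_weight_def by simp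
  have y2: "y^2 \<le> (407/235)^2" by (rule power_mono) (use y in auto)
  have "0 \<le> (b - y*a)^2 * y * (14/47)" "0 \<le> (b + y*a)^2 * y * (14/47)" using y by auto
  then have "- (28/47 * y^2 * a * b) \<le> 14/47 * (b\<^sup>2 + y^2 * a\<^sup>2) * y"
    by (simp add: power2_eq_square algebra_simps)
  also have "\<dots> = 14/47 * y * b\<^sup>2 + 14/47 * y^2 * (y * a\<^sup>2)"
    by (simp add: power2_eq_square algebra_simps)
  also have "\<dots> \<le> 1 * b\<^sup>2 + 1 * (y * a\<^sup>2)"
    using y y2 by (intro add_mono mult_right_mono) (auto simp: power_divide)
  finally have 1: "- (28/47 * y^2 * a * b) \<le> b\<^sup>2 + y * a\<^sup>2" by simp
  have 2: "bdf3_weight y * b\<^sup>2 \<le> b\<^sup>2" using mult_right_mono[OF w, of "b\<^sup>2"] by simp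
  have "y * bdf3_storage y a b = 188/137 * (y * a\<^sup>2) - 28/47 * y^2 * a * b + bdf3_weight y * b\<^sup>2"
    using y unfolding bdf3_storage_def by (simp add: field_simps power2_eq_square)
  then have "y * bdf3_storage y a b \<le> 188/137 * (y * a\<^sup>2) + (b\<^sup>2 + y * a\<^sup>2) + b\<^sup>2"
    using 1 2 by linarith
  moreover have "188/137 * p + (q + p) + q + (q + p) / 27400 \<le> 3 * (q + p)" if "0 \<le> p" "0 \<le> q" for p q :: real
    using that by (simp add: field_simps)
  moreover have "0 \<le> y * a\<^sup>2" using y by simp
  ultimately show ?thesis by (smt (verit) zero_le_power2)
qed

text \<open>The induction keeps the storage on the left and starts at 2, the first index with two
  quotients, where \<open>bdf3_storage_le\<close> pays for it. A BDF3 step uses the two latest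
  ratios, so index 3 is the first at which \<open>bdf3_dissipation\<close> applies.\<close>

lemma bdf3_energy:
  fixes \<tau> d e :: "nat \<Rightarrow> real"
  assumes pos: "\<And>k. k \<in> {1..n} \<Longrightarrow> 0 < \<tau> k"
    and ratio: "\<And>k. k \<in> {2..n} \<Longrightarrow> \<tau> k / \<tau> (k - 1) \<in> {1/2..<407/235}"
    and e: "\<And>k. k \<in> {1..n} \<Longrightarrow> e k = (if k \<le> 2 then d k else
      (\<Sum>j\<le>2. bdf3_sigma j (\<tau> k / \<tau> (k - 1)) (\<tau> (k - 1) / \<tau> (k - 2)) * d (k - j)))"
  shows "(\<Sum>k=1..n. \<tau> k * (d k)\<^sup>2) / 27400
    \<le> (\<Sum>k=1..n. \<tau> k * d k * e k) + 2 * (\<Sum>k=1..min n 2. \<tau> k * d k * e k)"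
proof -
  have big: "(\<Sum>k=1..m. \<tau> k * (d k)\<^sup>2) / 27400 + \<tau> m * bdf3_storage (\<tau> m / \<tau> (m - 1)) (d m) (d (m - 1))
    \<le> (\<Sum>k=1..m. \<tau> k * d k * e k) + 2 * (\<Sum>k=1..2. \<tau> k * d k * e k)" if "2 \<le> m" "m \<le> n" for m
    using that
  proof (induction m rule: dec_induct)
    case base
    define y where "y = \<tau> 2 / \<tau> 1"
    have y: "1/2 \<le> y" "y < 407/235" and t: "\<tau> 2 = y * \<tau> 1" and t1: "0 < \<tau> 1"
      using base ratio[of 2] pos[of 1] by (auto simp: y_def)
    have 2: "{1..2::nat} = {1, 2}" by auto
    have "\<tau> 1 * (y * bdf3_storage y (d 2) (d 1) + ((d 1)\<^sup>2 + y * (d 2)\<^sup>2) / 27400) \<le> \<tau> 1 * (3 * ((d 1)\<^sup>2 + y * (d 2)\<^sup>2))"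
      using t1 bdf3_storage_le[OF y] by (intro mult_left_mono) auto
    then show ?case
      unfolding 2 using e[of 1] e[of 2] base by (simp add: y_def[symmetric] t algebra_simps power2_eq_square)
  next
    case (step m)
    define y z where "y = \<tau> (Suc m) / \<tau> m" and "z = \<tau> m / \<tau> (m - 1)"
    have y: "1/2 \<le> y" "y < 407/235" and z: "1/2 \<le> z" "z < 407/235"
      and t: "\<tau> (Suc m) = y * \<tau> m" and tm: "0 < \<tau> m"
      using step.hyps step.prems ratio[of "Suc m"] ratio[of m] pos[of m] by (auto simp: y_def z_def)
    have em: "e (Suc m) = bdf3_sigma 0 y z * d (Suc m) + bdf3_sigma 1 y z * d m + bdf3_sigma 2 y z * d (m - 1)"
      using e[of "Suc m"] step.hyps step.prems by (simp add: y_def z_def numeral_2_eq_2 Suc_diff_Suc)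
    have "y * \<tau> m * (bdf3_storage y (d (Suc m)) (d m) - bdf3_storage z (d m) (d (m-1)) / y + (d (Suc m))\<^sup>2 / 27400)
      \<le> y * \<tau> m * (d (Suc m) * e (Suc m))"
      unfolding em using y tm by (intro mult_left_mono bdf3_dissipation y z) auto
    then have "y * \<tau> m * bdf3_storage y (d (Suc m)) (d m) + y * \<tau> m * (d (Suc m))\<^sup>2 / 27400
       \<le> y * \<tau> m * d (Suc m) * e (Suc m) + \<tau> m * bdf3_storage z (d m) (d (m-1))"
      using y by (simp add: algebra_simps)
    moreover have "(\<Sum>k=1..m. \<tau> k * (d k)\<^sup>2) / 27400 + \<tau> m * bdf3_storage z (d m) (d (m - 1))
    \<le> (\<Sum>k=1..m. \<tau> k * d k * e k) + 2 * (\<Sum>k=1..2. \<tau> k * d k * e k)"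
      using step unfolding z_def by simp
    ultimately show ?case
      using tm by (simp add: t add_divide_distrib)
  qed
  consider "n = 0" | "n = 1" | "2 \<le> n" by linarith
  then show ?thesis
  proof cases
    case 2
    then show ?thesis using pos[of 1] e[of 1] by (simp add: power2_eq_square mult.assoc)
  next
    case 3
    have "0 \<le> \<tau> n * bdf3_storage (\<tau> n / \<tau> (n - 1)) (d n) (d (n - 1))"
      using 3 pos[of n] ratio[of n] by (intro mult_nonneg_nonneg bdf3_storage_nonneg) auto
    then show ?thesis using big[of n] 3 by (simp add: min_absorb2)
  qed simp
qed

section \<open>Exponential memory kernels\<close>

text \<open>\<open>exp_moment a\<close> is the integral of \<open>(a - 2 x) exp (- x)\<close> over \<open>(0, a)\<close>.\<close>

definition exp_moment :: "real \<Rightarrow> real" where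
  "exp_moment a = (a + 2) * exp (- a) + a - 2"

section \<open>One-variable inequalities for \<open>exp_moment\<close> and the exponential\<close>

lemma DERIV_nonneg_imp_nonneg:
  fixes f f' :: "real \<Rightarrow> real"
  assumes "\<And>x. 0 \<le> x \<Longrightarrow> (f has_real_derivative f' x) (at x)" "\<And>x. 0 \<le> x \<Longrightarrow> 0 \<le> f' x"
    and "0 \<le> f 0" "0 \<le> a"
  shows "0 \<le> f a"
  using DERIV_nonneg_imp_nondecreasing[of 0 a f] assms by (meson order_trans)

lemma one_minus_exp_nonneg:
  fixes a :: real assumes "0 \<le> a" shows "0 \<le> 1 - (1 + a) * exp (- a)"
  by (rule DERIV_nonneg_imp_nonneg[where f' = "\<lambda>a. a * exp (- a)"])
    (use assms in \<open>auto intro!: derivative_eq_intros simp: algebra_simps\<close>)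

text \<open>With \<open>M = exp_moment\<close> these are \<open>a * M' - M\<close> and
  \<open>3 * M - a * M'\<close>, the numerators of the derivatives of \<open>M / a\<close> and, up
  to sign, of \<open>M / a^3\<close>.\<close>

lemma exp_moment_mono_aux:
  fixes a :: real assumes "0 \<le> a"
  shows "0 \<le> a * (1 - (1 + a) * exp (- a)) - exp_moment a"
    and "0 \<le> 3 * exp_moment a - a * (1 - (1 + a) * exp (- a))"
proof -
  show "0 \<le> a * (1 - (1 + a) * exp (- a)) - exp_moment a" unfolding exp_moment_def
    by (rule DERIV_nonneg_imp_nonneg[where f' = "\<lambda>a. a^2 * exp (- a)"])
      (use assms in \<open>auto intro!: derivative_eq_intros simp: algebra_simps power2_eq_square\<close>)
  have 1: "0 \<le> 2 - (a\<^sup>2 + 2*a + 2) * exp (- a)" if "0 \<le> a" for a :: real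
    by (rule DERIV_nonneg_imp_nonneg[where f' = "\<lambda>a. a^2 * exp (- a)"])
      (use that in \<open>auto intro!: derivative_eq_intros simp: algebra_simps power2_eq_square\<close>)
  show "0 \<le> 3 * exp_moment a - a * (1 - (1 + a) * exp (- a))" unfolding exp_moment_def
    by (rule DERIV_nonneg_imp_nonneg[where f' = "\<lambda>a. 2 - (a\<^sup>2 + 2*a + 2) * exp (- a)"])
      (use assms 1 in \<open>auto intro!: derivative_eq_intros simp: algebra_simps power2_eq_square\<close>)
qed

lemma exp_moment_has_derivative:
  "(exp_moment has_real_derivative 1 - (1 + a) * exp (- a)) (at a)"
  unfolding exp_moment_def[abs_def] by (auto intro!: derivative_eq_intros simp: algebra_simps)

lemma exp_moment_nonneg: "0 \<le> a \<Longrightarrow> 0 \<le> exp_moment a"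
  by (rule DERIV_nonneg_imp_nonneg[OF exp_moment_has_derivative one_minus_exp_nonneg]) (auto simp: exp_moment_def)

lemma exp_moment_pos:
  assumes "0 < a" shows "0 < exp_moment a"
proof -
  have "exp_moment 0 < exp_moment a"
  proof (rule DERIV_pos_imp_increasing_open[OF assms])
    fix x :: real assume "0 < x"
    then have "1 + x < exp x" using exp_minus_greater[of "- x"] by simp
    then have "0 < 1 - (1 + x) * exp (- x)" by (simp add: exp_minus field_simps)
    then show "\<exists>y. (exp_moment has_real_derivative y) (at x) \<and> 0 < y"
      using exp_moment_has_derivative by blast
  qed (auto simp: exp_moment_def[abs_def] intro!: continuous_intros)
  then show ?thesis by (simp add: exp_moment_def)
qed

lemma exp_moment_le_cube:
  assumes "0 \<le> a" shows "exp_moment a \<le> a^3 / 6"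
proof -
  have 2: "0 \<le> a^2/2 - (1 - (1 + a) * exp (- a))" if "0 \<le> a" for a :: real
    by (rule DERIV_nonneg_imp_nonneg[where f = "\<lambda>a. a^2/2 - (1 - (1 + a) * exp (- a))" and f' = "\<lambda>a. a * (1 - exp (- a))"])
     (use that in \<open>auto intro!: derivative_eq_intros simp: algebra_simps mult_left_le\<close>)
  have "0 \<le> a^3 / 6 - exp_moment a"
    by (rule DERIV_nonneg_imp_nonneg[where f = "\<lambda>a. a^3 / 6 - exp_moment a" and f' = "\<lambda>a. a^2/2 - (1 - (1 + a) * exp (- a))"])
     (use assms 2 in \<open>auto intro!: derivative_eq_intros exp_moment_has_derivative simp: exp_moment_def algebra_simps\<close>)
  then show ?thesis by simp
qed

text \<open>\<open>exp_moment\<close> is cubic near 0 and linear at infinity. Together with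
  \<open>exp_moment_div_cube_antimono\<close> this traps the quotient of two moments between
  \<open>b / a\<close> and \<open>(b / a)^3\<close>, whatever the size of the steps.\<close>

lemma exp_moment_div_mono:
  assumes "0 < b" "b \<le> a"
  shows "exp_moment b / b \<le> exp_moment a / a"
proof (rule DERIV_nonneg_imp_nondecreasing[OF assms(2)])
  fix x assume x: "b \<le> x" "x \<le> a"
  show "\<exists>y. ((\<lambda>a. exp_moment a / a) has_real_derivative y) (at x) \<and> 0 \<le> y"
    using x assms exp_moment_mono_aux(1)[of x]
    by (intro exI[of _ "(x * (1 - (1 + x) * exp (- x)) - exp_moment x) / x^2"])
      (auto intro!: derivative_eq_intros exp_moment_has_derivative simp: field_simps power2_eq_square)
qed

lemma exp_moment_div_cube_antimono:
  assumes "0 < b" "b \<le> a"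
  shows "exp_moment a / a^3 \<le> exp_moment b / b^3"
proof (rule DERIV_nonpos_imp_nonincreasing[OF assms(2)])
  fix x assume x: "b \<le> x" "x \<le> a"
  show "\<exists>y. ((\<lambda>a. exp_moment a / a^3) has_real_derivative y) (at x) \<and> y \<le> 0"
    using x assms exp_moment_mono_aux(2)[of x]
    by (intro exI[of _ "- (3 * exp_moment x - x * (1 - (1 + x) * exp (- x))) / x^4"])
      (auto intro!: derivative_eq_intros exp_moment_has_derivative simp: field_simps power_numeral_reduce)
qed

lemma exp_minus_exp_ge:
  fixes a :: real assumes "0 \<le> a" shows "2 * a \<le> exp a - exp (- a)"
proof -
  have 2: "0 \<le> exp x + exp (- x) - 2" for x :: real
    using cosh_real_ge_1[of x] by (simp add: cosh_def)
  have "0 \<le> exp a - exp (- a) - 2 * a"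
    by (rule DERIV_nonneg_imp_nonneg[where f = "\<lambda>a. exp a - exp (- a) - 2 * a" and f' = "\<lambda>x. exp x + exp (- x) - 2"])
     (use assms 2 in \<open>auto intro!: derivative_eq_intros\<close>)
  then show ?thesis by simp
qed

lemma exp_sq_ge:
  fixes a :: real assumes "0 \<le> a" shows "4 * a * exp a \<le> 2 * ((exp a)\<^sup>2 - 1)"
proof -
  have "2 * a * (2 * exp a) \<le> (exp a - exp (- a)) * (2 * exp a)"
    by (intro mult_right_mono exp_minus_exp_ge assms) auto
  also have "\<dots> = 2 * ((exp a)\<^sup>2 - 1)" by (simp add: exp_minus field_simps power2_eq_square)
  finally show ?thesis by (simp add: mult_ac)
qed

text \<open>The expression is the integral of \<open>x * exp x\<close> over \<open>(0, a)\<close>;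
  the upper bound replaces \<open>exp x\<close> by \<open>exp a\<close>.\<close>

lemma exp_first_moment:
  fixes a :: real assumes "0 \<le> a"
  shows "0 \<le> a * exp a - exp a + 1" "a * exp a - exp a + 1 \<le> a\<^sup>2 / 2 * exp a"
proof -
  show "0 \<le> a * exp a - exp a + 1"
    by (rule DERIV_nonneg_imp_nonneg[where f' = "\<lambda>a. a * exp a"])
     (use assms in \<open>auto intro!: derivative_eq_intros\<close>)
  have "0 \<le> a\<^sup>2 / 2 * exp a - (a * exp a - exp a + 1)"
    by (rule DERIV_nonneg_imp_nonneg[where f = "\<lambda>a. a\<^sup>2 / 2 * exp a - (a * exp a - exp a + 1)" and f' = "\<lambda>a. a\<^sup>2 / 2 * exp a"])
     (use assms in \<open>auto intro!: derivative_eq_intros simp: field_simps\<close>)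
  then show "a * exp a - exp a + 1 \<le> a\<^sup>2 / 2 * exp a" by simp
qed

text \<open>Divided by \<open>2 * (e^2 - 1)\<close>, the right side is the coefficient of
  \<open>x^2\<close> that remains in \<open>exp_storage_step\<close> when the memory is minimised
  out and both quotients equal \<open>x\<close>. So a step with constant quotient dissipates at
  least \<open>exp_moment a * x^2\<close>. Multiplication by \<open>e\<close> yields an exponential
  polynomial that vanishes at 0 with its first two derivatives; the third is handled by
  \<open>1 + a \<le> exp a\<close>.\<close>

lemma exp_moment_le_dissipation:
  fixes a :: real assumes "0 \<le> a"
  defines "e \<equiv> exp a"
  shows "exp_moment a * (2 * (e\<^sup>2 - 1)) \<le> 2 * a * e * (e - 1) - (e - 1)\<^sup>2 - a\<^sup>2"
proof -
  have ee: "exp (3 * a) = (exp a)^3" "exp (2 * a) = (exp a)^2" for a :: real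
    by (simp_all add: exp_of_nat_mult[symmetric])
  have 3: "0 \<le> 81 * exp (3*a) - (32*a + 64) * exp (2*a) - (a\<^sup>2 + 4*a + 5) * exp a" if "0 \<le> a" for a :: real
  proof -
    have e: "1 + a \<le> exp a" by simp
    \<comment> \<open>\<open>17 + 49 * a\<close> is the surplus of \<open>81 * (1 + a)\<close> over
      \<open>32 * a + 64\<close>.\<close>
    have "a\<^sup>2 + 4*a + 5 \<le> (17 + 49*a) * (1 + a)" using that by (simp add: algebra_simps power2_eq_square add_increasing)
    also have "\<dots> \<le> (17 + 49*a) * exp a" using that e by (intro mult_left_mono) auto
    finally have "0 \<le> exp a * ((17 + 49*a) * exp a - (a\<^sup>2 + 4*a + 5))" by simp
    moreover have "0 \<le> (exp a)\<^sup>2 * (81 * (exp a - (1 + a)))" using e by (intro mult_nonneg_nonneg) auto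
    ultimately show ?thesis unfolding ee by (simp add: algebra_simps power2_eq_square power3_eq_cube)
  qed
  have 2: "0 \<le> 27 * exp (3*a) - (16*a + 24) * exp (2*a) - (a\<^sup>2 + 2*a + 3) * exp a" if "0 \<le> a" for a :: real
    by (rule DERIV_nonneg_imp_nonneg[OF _ 3])
     (use that in \<open>auto intro!: derivative_eq_intros simp: algebra_simps\<close>)
  have 1: "0 \<le> 9 * exp (3*a) - (8*a + 8) * exp (2*a) - (a\<^sup>2 + 3) * exp a + 2" if "0 \<le> a" for a :: real
    by (rule DERIV_nonneg_imp_nonneg[OF _ 2])
     (use that in \<open>auto intro!: derivative_eq_intros simp: algebra_simps\<close>)
  have 0: "0 \<le> 3 * exp (3*a) - (4*a + 2) * exp (2*a) - (a\<^sup>2 - 2*a + 5) * exp a + (2*a + 4)"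
    by (rule DERIV_nonneg_imp_nonneg[OF _ 1])
     (use assms in \<open>auto intro!: derivative_eq_intros simp: algebra_simps\<close>)
  have "e * (2 * a * e * (e - 1) - (e - 1)\<^sup>2 - a\<^sup>2 - exp_moment a * (2 * (e\<^sup>2 - 1)))
    = 3 * e^3 - (4*a + 2) * e^2 - (a\<^sup>2 - 2*a + 5) * e + (2*a + 4)"
  proof -
    have q: "exp (- a) = 1 / e" "e > 0" unfolding e_def by (simp_all add: exp_minus field_simps)
    show ?thesis unfolding exp_moment_def q(1) using q(2)
      by (simp add: field_simps power2_eq_square power3_eq_cube)
  qed
  with 0 have "0 \<le> e * (2 * a * e * (e - 1) - (e - 1)\<^sup>2 - a\<^sup>2 - exp_moment a * (2 * (e\<^sup>2 - 1)))"
    unfolding ee e_def by simp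
  then show ?thesis unfolding e_def by (simp add: zero_le_mult_iff)
qed

section \<open>One step of the memory recursion\<close>

lemma quadratic_form_nonneg:
  fixes a b c x y :: real
  assumes "0 < a" "b\<^sup>2 \<le> 4 * a * c"
  shows "0 \<le> a * x\<^sup>2 - b * x * y + c * y\<^sup>2"
proof -
  have "0 \<le> (2 * a * x - b * y)\<^sup>2 + (4 * a * c - b\<^sup>2) * y\<^sup>2" using assms by simp
  also have "\<dots> = 4 * a * (a * x\<^sup>2 - b * x * y + c * y\<^sup>2)" by (simp add: power2_eq_square algebra_simps)
  finally show ?thesis using assms(1) by (simp add: zero_le_mult_iff)
qed

text \<open>\<open>\<beta>\<close> is the old step over the new one, \<open>m\<close> the quotient
  of their moments, and \<open>1/5\<close> the share of the dissipation that is not spent on the new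
  storage. The terms with \<open>k\<close> and \<open>l\<close> are perturbations: the first costs
  at most \<open>p / 16\<close> of \<open>y^2\<close>, the second is bounded through
  \<open>(x - y)^2 \<le> 3/2 * x^2 + 3 * y^2\<close>.\<close>

lemma quadratic_form_bound:
  fixes \<beta> m k l x y :: real
  assumes \<beta>: "235/407 \<le> \<beta>" "\<beta> \<le> 2"
    and m: "min \<beta> (\<beta>^3) \<le> m" "m \<le> max \<beta> (\<beta>^3)"
    and k: "0 \<le> k" "k \<le> 1 / (4 * (1 + \<beta>))"
    and l: "0 \<le> l" "l \<le> \<beta>^3 / (24 * (1 + \<beta>)\<^sup>2)"
  shows "0 \<le> (1/5 + 1 / (1 + \<beta>)) * x\<^sup>2 - 1 / (1 + \<beta>) * x * y
    + m * (4/5 * y\<^sup>2 + k * (x\<^sup>2 - x * y) - l * (x - y)\<^sup>2)"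
proof -
  define p where "p = 1 / (1 + \<beta>)"
  have p: "1/3 \<le> p" "p \<le> 407/642" "\<beta> = (1 - p) / p" using \<beta> by (auto simp: p_def field_simps)
  have "0 \<le> min \<beta> (\<beta>^3)" using \<beta> by simp
  then have m0: "0 \<le> m" using m(1) by (rule order_trans)
  have "k * (x\<^sup>2 - x * y) + k / 4 * y\<^sup>2 = k * (x - y / 2)\<^sup>2"
    by (simp add: power2_eq_square algebra_simps)
  moreover have "0 \<le> k * (x - y / 2)\<^sup>2" using k by simp
  moreover have "k * (y\<^sup>2 / 4) \<le> p / 4 * (y\<^sup>2 / 4)" using k by (intro mult_right_mono) (auto simp: p_def algebra_simps)
  ultimately have 1: "- (p / 16 * y\<^sup>2) \<le> k * (x\<^sup>2 - x * y)" by simp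
  have "3/2 * x\<^sup>2 + 3 * y\<^sup>2 - (x - y)\<^sup>2 = 1/2 * (x + 2 * y)\<^sup>2"
    by (simp add: power2_eq_square algebra_simps)
  moreover have "0 \<le> 1/2 * (x + 2 * y)\<^sup>2" by simp
  ultimately have 2: "(x - y)\<^sup>2 \<le> 3/2 * x\<^sup>2 + 3 * y\<^sup>2" by linarith
  have 3: "l * (x - y)\<^sup>2 \<le> l * (3/2 * x\<^sup>2 + 3 * y\<^sup>2)" by (intro mult_left_mono 2 l)
  have "0 \<le> (1/5 + p - 3/2 * (m * l)) * x\<^sup>2 - p * x * y + m * (4/5 - p/16 - 3 * l) * y\<^sup>2"
  \<comment> \<open>The cases differ in which of \<open>\<beta>\<close> and \<open>\<beta>^3\<close>
    bounds \<open>m\<close> from below. Each ends in a discriminant inequality in \<open>p\<close>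
    alone.\<close>
  proof (cases "1 \<le> \<beta>")
    case True
    have p2: "p \<le> 1/2" using True by (simp add: p_def field_simps)
    have \<beta>3: "\<beta> \<le> \<beta>^3" "\<beta>^3 \<le> 8" using True \<beta> power_increasing[of 1 3 \<beta>] power_mono[of \<beta> 2 3] by auto
    have "\<beta>^3 \<le> 2 * \<beta>\<^sup>2" using \<beta> by (simp add: power3_eq_cube power2_eq_square mult_right_mono)
    also have "\<beta>\<^sup>2 \<le> (2/3 * (1 + \<beta>))\<^sup>2" using \<beta> by (intro power_mono) auto
    also have "(2/3 * (1 + \<beta>))\<^sup>2 = 4/9 * (1 + \<beta>)\<^sup>2"
      unfolding power_mult_distrib by (simp add: power_divide)
    finally have "\<beta>^3 / (24 * (1 + \<beta>)\<^sup>2) \<le> 1/27" using \<beta> by (simp add: divide_simps)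
    with l have l27: "l \<le> 1/27" by simp
    have m8: "1 \<le> m" "m \<le> 8" using m \<beta>3 True by auto
    have ml: "m * l \<le> 8 * (1/27)" using m8 l l27 by (intro mult_mono) auto
    have "0 \<le> (p - 1/3) * (1/2 - p)" using p p2 by (intro mult_nonneg_nonneg) auto
    then have "p\<^sup>2 \<le> 4 * (p - 11/45) * (65/100)" using p by (simp add: power2_eq_square algebra_simps)
    then have "0 \<le> (p - 11/45) * x\<^sup>2 - p * x * y + 65/100 * y\<^sup>2" using p by (intro quadratic_form_nonneg) auto
    also have "1 * (65/100) \<le> m * (4/5 - p/16 - 3 * l)" using m8 p2 l27 by (intro mult_mono) auto
    then have "(p - 11/45) * x\<^sup>2 - p * x * y + 65/100 * y\<^sup>2
      \<le> (1/5 + p - 3/2 * (m * l)) * x\<^sup>2 - p * x * y + m * (4/5 - p/16 - 3 * l) * y\<^sup>2"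
      using ml by (intro add_mono diff_right_mono mult_right_mono) auto
    finally show ?thesis .
  next
    case False
    have \<beta>3: "\<beta>^3 \<le> \<beta>" "(235/407)^3 \<le> \<beta>^3" using False \<beta> power_decreasing[of 1 3 \<beta>] power_mono[of "235/407" \<beta> 3] by auto
    have "\<beta>^3 \<le> \<beta>\<^sup>2" using False \<beta> power_decreasing[of 2 3 \<beta>] by simp
    also have "\<beta>\<^sup>2 \<le> (1/2 * (1 + \<beta>))\<^sup>2" using False \<beta> by (intro power_mono) auto
    also have "(1/2 * (1 + \<beta>))\<^sup>2 = 1/4 * (1 + \<beta>)\<^sup>2"
      unfolding power_mult_distrib by (simp add: power_divide)
    finally have "\<beta>^3 / (24 * (1 + \<beta>)\<^sup>2) \<le> 1/96" using \<beta> by (simp add: divide_simps)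
    with l have l96: "l \<le> 1/96" by simp
    have m1: "1924/10000 \<le> m" "m \<le> 1" using m \<beta>3 False by (auto simp: power_divide)
    have ml: "m * l \<le> 1 * (1/96)" using m1 l l96 by (intro mult_mono) auto
    have "p * p \<le> 407/642 * p" using p by (intro mult_right_mono) auto
    then have "p\<^sup>2 \<le> 4 * (p + 184/1000) * (14/100)" unfolding power2_eq_square using p(2) by simp
    then have "0 \<le> (p + 184/1000) * x\<^sup>2 - p * x * y + 14/100 * y\<^sup>2" using p by (intro quadratic_form_nonneg) auto
    also have "1924/10000 * (729/1000) \<le> m * (4/5 - p/16 - 3 * l)" using m1 p l96 by (intro mult_mono) auto
    then have "(p + 184/1000) * x\<^sup>2 - p * x * y + 14/100 * y\<^sup>2
      \<le> (1/5 + p - 3/2 * (m * l)) * x\<^sup>2 - p * x * y + m * (4/5 - p/16 - 3 * l) * y\<^sup>2"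
      using ml by (intro add_mono diff_right_mono mult_right_mono) auto
    finally show ?thesis .
  qed
  also have "\<dots> = (1/5 + p) * x\<^sup>2 - p * x * y
    + m * (4/5 * y\<^sup>2 + (- (p / 16 * y\<^sup>2)) - l * (3/2 * x\<^sup>2 + 3 * y\<^sup>2))" by (simp add: algebra_simps)
  also have "\<dots> \<le> (1/5 + p) * x\<^sup>2 - p * x * y + m * (4/5 * y\<^sup>2 + k * (x\<^sup>2 - x * y) - l * (x - y)\<^sup>2)"
    using 1 3 m0 by (intro add_left_mono mult_left_mono) auto
  finally show ?thesis unfolding p_def .
qed

text \<open>Here \<open>x\<close> and \<open>y\<close> are consecutive difference quotients, \<open>a\<close> and \<open>b\<close> the corresponding steps
  and \<open>g\<close> and \<open>G\<close> the memory before and after the step. Minimising over \<open>g\<close> leaves a quadratic form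
  in \<open>x\<close> and \<open>y\<close>.\<close>

lemma exp_storage_step:
  fixes a b x y g :: real
  assumes a: "0 < a" and b: "0 < b" and ratio: "235/407 \<le> b / a" "b / a \<le> 2"
  defines "G \<equiv> exp (- a) * (g + exp_moment b / (a + b) * (x - y)) + (1 - exp (- a)) * x"
  shows "1/2 * G\<^sup>2 + 4/5 * exp_moment a * x\<^sup>2 \<le> a * x * (G + exp_moment a / (a + b) * (x - y))
    + 1/2 * g\<^sup>2 + 4/5 * exp_moment b * y\<^sup>2"
proof -
  define e E B where "e = exp a" and E: "E = exp_moment a" and B: "B = exp_moment b"
  define F z where "F = B / (a + b)" and "z = x - y"
  define D where "D = 2 * (e\<^sup>2 - 1)"
  define \<beta> where "\<beta> = b / a"
  have e1: "1 < e" using a by (simp add: e_def)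
  have D0: "4 * a * e \<le> D" "0 < D" using exp_sq_ge[of a] a e1 by (auto simp: e_def D_def power2_eq_square intro: less_1_mult)
  have E0: "0 \<le> E" "0 \<le> B" using a b by (auto simp: E B intro: exp_moment_nonneg)
  have Epos: "0 < E" using exp_moment_pos[OF a] by (simp add: E)
  have b\<beta>: "b = \<beta> * a" using a by (simp add: \<beta>_def)
  have \<beta>: "235/407 \<le> \<beta>" "\<beta> \<le> 2" using ratio by (auto simp: \<beta>_def)
  define Z where "Z = F * z + (e - 1) * x"
  have G: "e * G = g + Z"
    unfolding G_def Z_def F_def z_def e_def B by (simp add: exp_minus field_simps)
  \<comment> \<open>Since \<open>g = e * G - Z\<close>, minimising over the old memory is minimising
    over the new one; the last term is the negated minimum, and after multiplication by
    \<open>D\<close> a perfect square remains.\<close>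
  have "0 \<le> 1/2 * (e * G - Z)\<^sup>2 + a * x * G - 1/2 * G\<^sup>2 + (Z\<^sup>2 - 2 * a * e * x * Z + a\<^sup>2 * x\<^sup>2) / D"
    (is "0 \<le> ?P + ?N / D")
  proof (rule nonneg_if_mult_pos_nonneg)
    have "(?P + ?N / D) * D = D * ?P + ?N" using D0 by (simp add: field_simps)
    also have "\<dots> = 1 / 4 * (D * G - 2 * (e * Z - a * x))\<^sup>2"
      unfolding D_def by algebra
    also have "\<dots> \<ge> 0" by simp
    finally show "0 \<le> (?P + ?N / D) * D" .
  qed (rule D0)
  then have 1: "- ((Z\<^sup>2 - 2 * a * e * x * Z + a\<^sup>2 * x\<^sup>2) / D) \<le> 1/2 * g\<^sup>2 + a * x * G - 1/2 * G\<^sup>2"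
    unfolding G by simp
  have "- (Z\<^sup>2 - 2 * a * e * x * Z + a\<^sup>2 * x\<^sup>2)
    = (2 * a * e * (e - 1) - (e - 1)\<^sup>2 - a\<^sup>2) * x\<^sup>2 + 2 * F * (a * e - e + 1) * x * z - F\<^sup>2 * z\<^sup>2"
    unfolding Z_def by (simp add: power2_eq_square algebra_simps)
  also have "\<dots> \<ge> E * D * x\<^sup>2 + 2 * F * (a * e - e + 1) * x * z - F\<^sup>2 * z\<^sup>2"
    using exp_moment_le_dissipation[of a] a unfolding D_def E e_def
    by (intro diff_right_mono add_right_mono mult_right_mono) auto
  finally have 2: "E * D * x\<^sup>2 + 2 * F * (a * e - e + 1) * x * z - F\<^sup>2 * z\<^sup>2
     \<le> - (Z\<^sup>2 - 2 * a * e * x * Z + a\<^sup>2 * x\<^sup>2)" .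
  have 3: "E * x\<^sup>2 + 2 * F * (a * e - e + 1) / D * x * z - F\<^sup>2 / D * z\<^sup>2
     \<le> - ((Z\<^sup>2 - 2 * a * e * x * Z + a\<^sup>2 * x\<^sup>2) / D)"
    using divide_right_mono[OF 2, of D] D0 by (simp add: add_divide_distrib diff_divide_distrib)
  \<comment> \<open>\<open>B * k\<close> and \<open>B * l\<close> are the coefficients of
    \<open>x * z\<close> and \<open>- z^2\<close>. With \<open>B\<close> taken out, division by
    \<open>E\<close> leaves only the quotient \<open>m\<close> of the moments.\<close>
  define k where "k = 2 * (a * e - e + 1) / ((a + b) * D)"
  define l where "l = B / ((a + b)\<^sup>2 * D)"
  have k: "0 \<le> k" "k \<le> 1 / (4 * (1 + \<beta>))"
  proof -
    show "0 \<le> k" using exp_first_moment[of a] a b D0 by (simp add: k_def e_def)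
    have "k \<le> 2 * (a\<^sup>2 / 2 * e) / ((a + b) * (4 * a * e))"
      unfolding k_def using exp_first_moment[of a] a b D0 e1
      by (intro frac_le mult_left_mono mult_nonneg_nonneg) (auto simp: e_def)
    also have "\<dots> = 1 / (4 * (1 + \<beta>))"
    proof -
      define s where "s = 1 + \<beta>"
      have "s > 0" "a + b = a * s" using \<beta> by (simp_all add: s_def b\<beta> algebra_simps)
      then show ?thesis unfolding s_def[symmetric] using a e1 by (simp add: field_simps power2_eq_square)
    qed
    finally show "k \<le> 1 / (4 * (1 + \<beta>))" .
  qed
  have l: "0 \<le> l" "l \<le> \<beta>^3 / (24 * (1 + \<beta>)\<^sup>2)"
  proof -
    show "0 \<le> l" using E0 D0 by (simp add: l_def)
    have "4 * a * 1 \<le> 4 * a * e" using a e1 by (intro mult_left_mono) auto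
    then have "4 * a \<le> D" using D0 by simp
    then have "l \<le> (b^3 / 6) / ((a + b)\<^sup>2 * (4 * a))"
      unfolding l_def using exp_moment_le_cube[of b] a b D0 E0
      by (intro frac_le mult_left_mono) (auto simp: B)
    also have "\<dots> = \<beta>^3 / (24 * (1 + \<beta>)\<^sup>2)"
    proof -
      define s where "s = 1 + \<beta>"
      have "s > 0" "a + b = a * s" using \<beta> by (simp_all add: s_def b\<beta> algebra_simps)
      then show ?thesis unfolding s_def[symmetric] b\<beta> using a by (simp add: field_simps power2_eq_square power3_eq_cube)
    qed
    finally show "l \<le> \<beta>^3 / (24 * (1 + \<beta>)\<^sup>2)" .
  qed
  define m where "m = B / E"
  have m: "min \<beta> (\<beta>^3) \<le> m" "m \<le> max \<beta> (\<beta>^3)"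
  proof -
    have "(b \<le> a \<longrightarrow> \<beta>^3 \<le> m \<and> m \<le> \<beta>) \<and> (a \<le> b \<longrightarrow> \<beta> \<le> m \<and> m \<le> \<beta>^3)"
      using exp_moment_div_mono[of a b] exp_moment_div_mono[of b a]
        exp_moment_div_cube_antimono[of a b] exp_moment_div_cube_antimono[of b a] a b Epos
      unfolding m_def E[symmetric] B[symmetric] \<beta>_def
      by (auto simp: field_simps power_divide)
    then show "min \<beta> (\<beta>^3) \<le> m" "m \<le> max \<beta> (\<beta>^3)" by linarith+
  qed
  have "0 \<le> E * ((1/5 + 1 / (1 + \<beta>)) * x\<^sup>2 - 1 / (1 + \<beta>) * x * y
    + m * (4/5 * y\<^sup>2 + k * (x\<^sup>2 - x * y) - l * (x - y)\<^sup>2))"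
    using Epos by (intro mult_nonneg_nonneg quadratic_form_bound[OF \<beta> m k l]) auto
  also have "\<dots> = 1/5 * E * x\<^sup>2 + E / (1 + \<beta>) * x * (x - y) + B * (4/5 * y\<^sup>2 + k * (x\<^sup>2 - x * y) - l * (x - y)\<^sup>2)"
  proof -
    have "B = m * E" using Epos by (simp add: m_def)
    then show ?thesis by (simp add: algebra_simps power2_eq_square diff_divide_distrib)
  qed
  also have "E / (1 + \<beta>) = a * (E / (a + b))" using a b by (simp add: \<beta>_def field_simps)
  also have "B * (4/5 * y\<^sup>2 + k * (x\<^sup>2 - x * y) - l * (x - y)\<^sup>2)
    = 4/5 * B * y\<^sup>2 + 2 * F * (a * e - e + 1) / D * x * z - F\<^sup>2 / D * z\<^sup>2"
    unfolding k_def l_def F_def z_def using D0 a b by (simp add: field_simps power2_eq_square)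
  finally have 4: "0 \<le> 1/5 * E * x\<^sup>2 + a * (E / (a + b)) * x * (x - y)
    + (4/5 * B * y\<^sup>2 + 2 * F * (a * e - e + 1) / D * x * z - F\<^sup>2 / D * z\<^sup>2)" .
  have "a * x * (G + E / (a + b) * (x - y)) = a * x * G + a * (E / (a + b)) * x * (x - y)"
    by (simp only: distrib_left mult_ac)
  then show ?thesis
    using 1 3 4 unfolding E[symmetric] B[symmetric] by linarith
qed

text \<open>In the first step the memory starts from 0 and the interpolant is linear, so no
  curvature term occurs. The estimate is proved with the full \<open>exp_moment a\<close>, of which
  \<open>4/5\<close> is kept.\<close>

lemma exp_storage_initial:
  fixes a x :: real
  assumes "0 < a"
  shows "1/2 * ((1 - exp (- a)) * x)\<^sup>2 + 4/5 * exp_moment a * x\<^sup>2 \<le> a * x * ((1 - exp (- a)) * x)"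
proof -
  have "0 \<le> exp (- x) * (2 * x - 1 + exp (- x))" if "0 \<le> x" for x :: real
    using exp_ge_add_one_self[of "- x"] that by (intro mult_nonneg_nonneg) auto
  then have "0 \<le> a * (1 - exp (- a)) - 1/2 * (1 - exp (- a))\<^sup>2 - exp_moment a"
    using assms
    by (intro DERIV_nonneg_imp_nonneg[where f = "\<lambda>a. a * (1 - exp (- a)) - 1/2 * (1 - exp (- a))\<^sup>2 - exp_moment a"
          and f' = "\<lambda>x. exp (- x) * (2 * x - 1 + exp (- x))" and a = a])
      (auto intro!: derivative_eq_intros exp_moment_has_derivative simp: exp_moment_def field_simps)
  then have "1/2 * (1 - exp (- a))\<^sup>2 + 4/5 * exp_moment a \<le> a * (1 - exp (- a))"
    using exp_moment_pos[OF assms] by simp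
  from mult_right_mono[OF this, of "x\<^sup>2"] show ?thesis
    by (simp add: power_mult_distrib algebra_simps) (simp add: power2_eq_square algebra_simps)
qed

text \<open>\<open>G k\<close> omits the curvature of interval \<open>k\<close>. At stage
  \<open>k\<close> that curvature is the provisional one added in the sum; at stage
  \<open>k + 1\<close> it is recomputed from the quadratic through the new node. This is why the
  recursion adds a curvature term of interval \<open>k - 1\<close> before the decay factor
  acts.\<close>

lemma exp_kernel_nonneg:
  fixes a d G :: "nat \<Rightarrow> real"
  assumes pos: "\<And>k. k \<in> {1..n} \<Longrightarrow> 0 < a k"
    and ratio: "\<And>k. k \<in> {2..n} \<Longrightarrow> a k / a (k - 1) \<in> {1/2..407/235}"
    and G1: "G 1 = (1 - exp (- a 1)) * d 1"
    and G: "\<And>k. k \<in> {2..n} \<Longrightarrow> G k = exp (- a k) *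
        (G (k - 1) + exp_moment (a (k - 1)) / (a k + a (k - 1)) * (d k - d (k - 1))) + (1 - exp (- a k)) * d k"
  shows "0 \<le> (\<Sum>k=1..n. a k * d k * (G k + (if k = 1 then 0 else exp_moment (a k) / (a k + a (k - 1)) * (d k - d (k - 1)))))"
proof (cases "1 \<le> n")
  case True
  have "1/2 * (G m)\<^sup>2 + 4/5 * exp_moment (a m) * (d m)\<^sup>2
    \<le> (\<Sum>k=1..m. a k * d k * (G k + (if k = 1 then 0 else exp_moment (a k) / (a k + a (k - 1)) * (d k - d (k - 1)))))"
    if "1 \<le> m" "m \<le> n" for m
    using that
  proof (induction m rule: dec_induct)
    case base
    show ?case using exp_storage_initial[of "a 1" "d 1"] pos[of 1] base G1 by simp
  next
    case (step m)
    have p: "0 < a (Suc m)" "0 < a m" and r: "1/2 \<le> a (Suc m) / a m" "a (Suc m) / a m \<le> 407/235"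
      using step pos[of m] pos[of "Suc m"] ratio[of "Suc m"] by auto
    \<comment> \<open>\<open>exp_storage_step\<close> measures the old step against the new one, so
      the ratio interval is inverted.\<close>
    have r': "235/407 \<le> a m / a (Suc m)" "a m / a (Suc m) \<le> 2"
      using p r by (auto simp: field_simps)
    show ?case
      using exp_storage_step[OF p r', of "G m" "d (Suc m)" "d m"] G[of "Suc m"] step
      by simp
  qed
  moreover have "0 \<le> 1/2 * (G n)\<^sup>2 + 4/5 * exp_moment (a n) * (d n)\<^sup>2"
    using True exp_moment_nonneg[of "a n"] pos[of n] by simp
  ultimately show ?thesis using True by (meson order_refl order_trans)
qed simp

section \<open>The L2 formula for the Caputo derivative\<close>

text \<open>Half the second derivative of the interpolant on \<open>(t\<^sub>j\<^sub>-\<^sub>1, t\<^sub>j)\<close>.\<close>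

definition interpolant_slope :: "(nat \<Rightarrow> real) \<Rightarrow> nat \<Rightarrow> (nat \<Rightarrow> real) \<Rightarrow> nat \<Rightarrow> real" where
  "interpolant_slope t k w j = (if k = 1 then 0 else
     (let i = min j (k - 1) in (diff_quot t w (i + 1) - diff_quot t w i) / (step t i + step t (i + 1))))"

section \<open>Derivative of the piecewise interpolant\<close>

lemma DERIV_lagrange1:
  assumes "t 0 < t 1"
  shows "(lagrange1 t w has_real_derivative diff_quot t w 1) (at s)"
  unfolding lagrange1_def[abs_def] diff_quot_def step_def using assms
  by (auto intro!: derivative_eq_intros simp: divide_simps) (simp add: algebra_simps)

lemma lagrange2_Suc:
  "lagrange2 t w (Suc m) s =
     w m * ((s - t (Suc m)) / (t m - t (Suc m)) * ((s - t (Suc (Suc m))) / (t m - t (Suc (Suc m)))))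
   + w (Suc m) * ((s - t m) / (t (Suc m) - t m) * ((s - t (Suc (Suc m))) / (t (Suc m) - t (Suc (Suc m)))))
   + w (Suc (Suc m)) * ((s - t m) / (t (Suc (Suc m)) - t m) * ((s - t (Suc m)) / (t (Suc (Suc m)) - t (Suc m))))"
proof -
  have "{Suc m - 1..Suc m + 1} = {m, Suc m, Suc (Suc m)}" by auto
  moreover have "{m, Suc m, Suc (Suc m)} - {m} = {Suc m, Suc (Suc m)}"
    "{m, Suc m, Suc (Suc m)} - {Suc m} = {m, Suc (Suc m)}"
    "{m, Suc m, Suc (Suc m)} - {Suc (Suc m)} = {m, Suc m}" by auto
  ultimately show ?thesis unfolding lagrange2_def by (simp add: add.assoc)
qed

text \<open>The Lagrange basis is rewritten in Newton form about \<open>t m\<close>, with the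
  divided difference \<open>c\<close> as leading coefficient. The derivative is then centred at the
  midpoint of the left or of the right subinterval. The second form serves the newest interval,
  which shares the quadratic of its predecessor.\<close>

lemma DERIV_lagrange2:
  fixes t w :: "nat \<Rightarrow> real"
  assumes "t m < t (Suc m)" "t (Suc m) < t (Suc (Suc m))"
    and c: "c = (diff_quot t w (Suc (Suc m)) - diff_quot t w (Suc m)) / (step t (Suc m) + step t (Suc (Suc m)))"
  shows "(lagrange2 t w (Suc m) has_real_derivative diff_quot t w (Suc m) + (2 * s - t m - t (Suc m)) * c) (at s)"
    and "(lagrange2 t w (Suc m) has_real_derivative
      diff_quot t w (Suc (Suc m)) + (2 * s - t (Suc m) - t (Suc (Suc m))) * c) (at s)"
proof -
  define p a b where "p = t m" and "a = t (Suc m) - t m" and "b = t (Suc (Suc m)) - t (Suc m)"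
  have t: "t (Suc m) = p + a" "t (Suc (Suc m)) = p + a + b" "t m = p" and pos: "0 < a" "0 < b"
    using assms by (auto simp: p_def a_def b_def)
  define d1 d2 where "d1 = diff_quot t w (Suc m)" and "d2 = diff_quot t w (Suc (Suc m))"
  have w: "w (Suc m) = w m + a * d1" "w (Suc (Suc m)) = w m + a * d1 + b * d2"
    using pos by (auto simp: d1_def d2_def diff_quot_def step_def t)
  have c': "d2 = d1 + (a + b) * c"
    unfolding c d1_def[symmetric] d2_def[symmetric] step_def using pos by (simp add: t)
  have eq: "lagrange2 t w (Suc m) = (\<lambda>s. w m + d1 * (s - p) + c * (s - p) * (s - p - a))"
  proof
    fix s
    define r where "r = s - p"
    have "a * b * (a + b) * lagrange2 t w (Suc m) s
      = a * b * (a + b) * (w m + d1 * r + c * r * (r - a))"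
    proof -
      have "lagrange2 t w (Suc m) s = w m * ((r - a) * (r - a - b) / (a * (a + b)))
        + w (Suc m) * (- (r * (r - a - b)) / (a * b)) + w (Suc (Suc m)) * (r * (r - a) / ((a + b) * b))"
        proof -
        have "s - p = r" "s - (p + a) = r - a" "s - (p + a + b) = r - a - b" "p - (p + a) = - a"
          "p - (p + a + b) = - (a + b)" "p + a - p = a" "p + a - (p + a + b) = - b" "p + a + b - p = a + b"
          "p + a + b - (p + a) = b" by (simp_all add: r_def)
        then show ?thesis unfolding lagrange2_Suc t by (simp only:) (simp del: minus_add_distrib)
      qed
      also have "a * b * (a + b) * \<dots> = w m * (b * (r - a) * (r - a - b))
        - w (Suc m) * ((a + b) * r * (r - a - b)) + w (Suc (Suc m)) * (a * r * (r - a))"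
        using pos by (simp add: divide_simps)
      also have "\<dots> = a * b * (a + b) * (w m + d1 * r + c * r * (r - a))"
        unfolding w c' by algebra
      finally show ?thesis .
    qed
    then show "lagrange2 t w (Suc m) s = w m + d1 * (s - p) + c * (s - p) * (s - p - a)"
      using pos by (simp add: r_def)
  qed
  show "(lagrange2 t w (Suc m) has_real_derivative diff_quot t w (Suc m) + (2 * s - t m - t (Suc m)) * c) (at s)"
    unfolding eq d1_def[symmetric] t by (auto intro!: derivative_eq_intros simp: algebra_simps)
  then show "(lagrange2 t w (Suc m) has_real_derivative
      diff_quot t w (Suc (Suc m)) + (2 * s - t (Suc m) - t (Suc (Suc m))) * c) (at s)"
    unfolding d1_def[symmetric] d2_def[symmetric] c' t by (simp add: algebra_simps)
qed

text \<open>Inside an open mesh interval the \<open>LEAST\<close> index is constant near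
  \<open>s\<close>, so the derivative is that of a single polynomial.\<close>

lemma deriv_interpolant:
  assumes mono: "strict_mono_on {0..k} t" and j: "j \<in> {1..k}" and s: "s \<in> {t (j - 1)<..<t j}"
  shows "deriv (interpolant t k w) s = diff_quot t w j + (2 * s - t (j - 1) - t j) * interpolant_slope t k w j"
proof -
  have tless: "t i < t l" if "i < l" "l \<le> k" for i l
    using mono that by (auto simp: strict_mono_on_def)
  have tle: "t i \<le> t l" if "i \<le> l" "l \<le> k" for i l
    using tless[of i l] that by (cases "i = l") auto
  have least: "(LEAST i. r \<le> t i) = j" if "r \<in> {t (j - 1)<..<t j}" for r
  proof (rule Least_equality)
    fix i assume "r \<le> t i"
    show "j \<le> i"
    proof (rule ccontr)
      assume "\<not> j \<le> i"
      then have "t i \<le> t (j - 1)" using tle[of i "j - 1"] j \<open>\<not> j \<le> i\<close> by simp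
      then show False using that \<open>r \<le> t i\<close> by simp
    qed
  qed (use that in auto)
  have ev: "\<forall>\<^sub>F r in nhds s. r \<in> {t (j - 1)<..<t j}"
    using s by (intro eventually_nhds_in_open) auto
  show ?thesis
  proof (cases "k = 1")
    case True
    then have "j = 1" using j by auto
    have "deriv (interpolant t k w) s = deriv (lagrange1 t w) s"
      using True by (intro deriv_cong_ev) (auto simp: interpolant_def)
    also have "\<dots> = diff_quot t w 1" using tless[of 0 1] True by (intro DERIV_imp_deriv DERIV_lagrange1) auto
    finally show ?thesis using True \<open>j = 1\<close> by (simp add: interpolant_slope_def)
  next
    case False
    define i where "i = min j (k - 1)"
    obtain m where m: "i = Suc m" using j False by (cases i) (auto simp: i_def)
    have mk: "Suc (Suc m) \<le> k" using m j False by (auto simp: i_def)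
    have "deriv (interpolant t k w) s = deriv (lagrange2 t w i) s"
      using False by (intro deriv_cong_ev eventually_mono[OF ev]) (auto simp: interpolant_def i_def least)
    also have "\<dots> = diff_quot t w j + (2 * s - t (j - 1) - t j) * interpolant_slope t k w j"
    \<comment> \<open>For \<open>j = k\<close> the minimum with \<open>k - 1\<close> is active and
      the interval is the right half of its quadratic; otherwise it is the left half.\<close>
    proof (cases "j = k")
      case True
      then have jj: "j = Suc (Suc m)" using m False by (auto simp: i_def)
      show ?thesis unfolding m
        by (rule DERIV_imp_deriv, rule DERIV_lagrange2(2)[THEN DERIV_cong])
          (use tless mk in \<open>auto simp: jj interpolant_slope_def Let_def True[symmetric]\<close>)
    next
      case neq: False
      then have jj: "j = Suc m" using m j by (auto simp: i_def)
      show ?thesis unfolding m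
        by (rule DERIV_imp_deriv, rule DERIV_lagrange2(1)[THEN DERIV_cong])
          (use tless mk False j in \<open>auto simp: jj interpolant_slope_def Let_def\<close>)
    qed
    finally show ?thesis .
  qed
qed

text \<open>\<open>frac_kernel \<nu>\<close> is the Laplace transform of this weight, i.e. a positive mixture of
  exponential kernels.\<close>

definition laplace_weight :: "real \<Rightarrow> real \<Rightarrow> real" where
  "laplace_weight \<nu> \<theta> = indicator {0..} \<theta> * \<theta> powr (- \<nu>) / (Gamma \<nu> * Gamma (1 - \<nu>))"

lemma laplace_weight_nonneg: "0 < \<nu> \<Longrightarrow> \<nu> < 1 \<Longrightarrow> 0 \<le> laplace_weight \<nu> \<theta>"
  using Gamma_real_pos[of \<nu>] Gamma_real_pos[of "1 - \<nu>"] by (simp add: laplace_weight_def)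

lemma laplace_weight_eq_0: "\<theta> \<le> 0 \<Longrightarrow> laplace_weight \<nu> \<theta> = 0"
  by (cases "\<theta> = 0") (auto simp: laplace_weight_def)

lemma laplace_weight_measurable [measurable]: "laplace_weight \<nu> \<in> borel_measurable borel"
  unfolding laplace_weight_def[abs_def] by measurable

lemma frac_kernel_measurable [measurable]: "frac_kernel \<nu> \<in> borel_measurable borel"
  unfolding frac_kernel_def[abs_def] by measurable

text \<open>Euler's integral for \<open>Gamma (1 - \<nu>)\<close> under the substitution
  \<open>t = r * \<theta>\<close>.\<close>

lemma frac_kernel_laplace:
  assumes \<nu>: "0 < \<nu>" "\<nu> < 1" and r: "0 < r"
  shows "has_bochner_integral lborel (\<lambda>\<theta>. laplace_weight \<nu> \<theta> * exp (- (\<theta> * r))) (frac_kernel \<nu> r)"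
proof -
  define f where "f t = indicator {0..} t * t powr (1 - \<nu> - 1) / exp t" for t :: real
  have G: "0 < Gamma \<nu>" "0 < Gamma (1 - \<nu>)" using \<nu> by (auto intro: Gamma_real_pos)
  have "has_bochner_integral lborel f (Gamma (1 - \<nu>))"
  proof (rule has_bochner_integral_nn_integral)
    show "(\<integral>\<^sup>+ x. ennreal (f x) \<partial>lborel) = ennreal (Gamma (1 - \<nu>))"
      unfolding f_def using \<nu> by (subst Gamma_conv_nn_integral_real) auto
  qed (use G in \<open>auto simp: f_def[abs_def]\<close>)
  then have "has_bochner_integral lborel (\<lambda>\<theta>. f (0 + r * \<theta>)) (Gamma (1 - \<nu>) /\<^sub>R \<bar>r\<bar>)"
    using r by (subst (asm) lborel_has_bochner_integral_real_affine_iff[of r _ _ 0]) auto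
  then have "has_bochner_integral lborel (\<lambda>\<theta>. r powr \<nu> / (Gamma \<nu> * Gamma (1 - \<nu>)) * f (0 + r * \<theta>))
     (r powr \<nu> / (Gamma \<nu> * Gamma (1 - \<nu>)) * (Gamma (1 - \<nu>) /\<^sub>R \<bar>r\<bar>))"
    by (rule has_bochner_integral_mult_right)
  moreover have "r powr \<nu> / (Gamma \<nu> * Gamma (1 - \<nu>)) * f (0 + r * \<theta>) = laplace_weight \<nu> \<theta> * exp (- (\<theta> * r))" for \<theta>
    using r G by (cases "0 \<le> \<theta>")
      (auto simp: f_def laplace_weight_def exp_minus field_simps powr_mult powr_minus indicator_def zero_le_mult_iff)
  moreover have "r powr \<nu> / (Gamma \<nu> * Gamma (1 - \<nu>)) * (Gamma (1 - \<nu>) /\<^sub>R \<bar>r\<bar>) = frac_kernel \<nu> r"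
    using r G by (simp add: frac_kernel_def powr_diff field_simps)
  ultimately show ?thesis by simp
qed

lemma frac_kernel_nonneg: "0 < \<nu> \<Longrightarrow> 0 \<le> frac_kernel \<nu> r"
  using Gamma_real_pos[of \<nu>] by (simp add: frac_kernel_def)

lemma frac_kernel_integrable:
  assumes \<nu>: "0 < \<nu>"
  shows "set_integrable lborel {a<..<c} (\<lambda>s. frac_kernel \<nu> (c - s))"
proof (cases "a < c")
  case True
  have "(\<lambda>u. u powr (\<nu> - 1)) absolutely_integrable_on {0..c - a}"
    using \<nu> True by (intro nonnegative_absolutely_integrable_1 integrable_on_powr_from_0) auto
  then have "integrable lborel (\<lambda>u. indicator {0..c - a} u *\<^sub>R u powr (\<nu> - 1))"
    unfolding set_integrable_def by (subst (asm) integrable_completion) auto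
  then have "integrable lborel (\<lambda>u. indicator {0..c - a} u *\<^sub>R u powr (\<nu> - 1) / Gamma \<nu>)"
    by simp
  then have "integrable lborel (\<lambda>s. indicator {0..c - a} (c + (-1) * s) *\<^sub>R (c + (-1) * s) powr (\<nu> - 1) / Gamma \<nu>)"
    by (subst lborel_integrable_real_affine_iff) auto
  then show ?thesis unfolding set_integrable_def
    by (rule Bochner_Integration.integrable_bound) (auto simp: frac_kernel_def indicator_def)
next
  case False
  then show ?thesis by (simp add: set_integrable_def)
qed

text \<open>Fubini in \<open>s\<close> and \<open>\<theta>\<close>. Absolute integrability comes
  from signs: weight and exponential are nonnegative, so integrating the absolute value over
  \<open>\<theta>\<close> returns \<open>frac_kernel\<close> times \<open>\<bar>p s\<bar>\<close>,
  which is integrable even for \<open>b = c\<close>, where the kernel is singular at the end of the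
  interval.\<close>

lemma frac_kernel_mixture:
  fixes p :: "real \<Rightarrow> real" and a b c :: real
  assumes \<nu>: "0 < \<nu>" "\<nu> < 1" and abc: "b \<le> c" and p: "continuous_on UNIV p"
  defines "I \<equiv> {a<..<b}"
  shows "set_integrable lborel I (\<lambda>s. frac_kernel \<nu> (c - s) * p s)"
    and "integrable lborel (\<lambda>\<theta>. laplace_weight \<nu> \<theta> * (LINT s:I|lborel. exp (- (\<theta> * (c - s))) * p s))"
    and "(LINT s:I|lborel. frac_kernel \<nu> (c - s) * p s)
      = (LINT \<theta>|lborel. laplace_weight \<nu> \<theta> * (LINT s:I|lborel. exp (- (\<theta> * (c - s))) * p s))"
proof -
  have pm [measurable]: "p \<in> borel_measurable borel" using p by (rule borel_measurable_continuous_onI)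
  have "bounded (p ` {a..b})" using p by (intro compact_imp_bounded compact_continuous_image) (auto intro: continuous_on_subset)
  then obtain B where B: "\<And>s. s \<in> {a..b} \<Longrightarrow> \<bar>p s\<bar> \<le> B" "0 \<le> B"
    unfolding bounded_iff by (metis image_eqI real_norm_def abs_ge_zero order_trans linear)
  define K where "K s = indicator I s * (frac_kernel \<nu> (c - s) * p s)" for s
  define h where "h = (\<lambda>(s, \<theta>). indicator I s * (laplace_weight \<nu> \<theta> * (exp (- (\<theta> * (c - s))) * p s)))"
  have hm [measurable]: "h \<in> borel_measurable (lborel \<Otimes>\<^sub>M lborel)"
    unfolding h_def I_def by measurable
  have inner: "has_bochner_integral lborel (\<lambda>\<theta>. h (s, \<theta>)) (K s)" for s
  proof (cases "s \<in> I")
    case True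
    then have "has_bochner_integral lborel (\<lambda>\<theta>. laplace_weight \<nu> \<theta> * exp (- (\<theta> * (c - s))) * p s) (frac_kernel \<nu> (c - s) * p s)"
      using abc by (intro has_bochner_integral_mult_left frac_kernel_laplace \<nu>) (auto simp: I_def)
    then show ?thesis using True by (simp add: h_def K_def mult_ac)
  qed (simp add: h_def K_def has_bochner_integral_zero)
  have innern: "has_bochner_integral lborel (\<lambda>\<theta>. norm (h (s, \<theta>))) \<bar>K s\<bar>" for s
  proof (cases "s \<in> I")
    case True
    then have "has_bochner_integral lborel (\<lambda>\<theta>. laplace_weight \<nu> \<theta> * exp (- (\<theta> * (c - s))) * \<bar>p s\<bar>) (frac_kernel \<nu> (c - s) * \<bar>p s\<bar>)"
      using abc by (intro has_bochner_integral_mult_left frac_kernel_laplace \<nu>) (auto simp: I_def)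
    then show ?thesis using True \<nu> by (simp add: h_def K_def mult_ac abs_mult laplace_weight_nonneg frac_kernel_nonneg)
  qed (simp add: h_def K_def has_bochner_integral_zero)
  have K: "integrable lborel K"
  proof (rule Bochner_Integration.integrable_bound)
    show "integrable lborel (\<lambda>s. B * (indicator {a<..<c} s *\<^sub>R frac_kernel \<nu> (c - s)))"
      using frac_kernel_integrable[OF \<nu>(1), of a c] unfolding set_integrable_def by simp
    show "K \<in> borel_measurable lborel" unfolding K_def[abs_def] I_def by measurable
    show "AE s in lborel. norm (K s) \<le> norm (B * (indicator {a<..<c} s *\<^sub>R frac_kernel \<nu> (c - s)))"
    proof (rule AE_I2)
      fix s show "norm (K s) \<le> norm (B * (indicator {a<..<c} s *\<^sub>R frac_kernel \<nu> (c - s)))"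
        using mult_left_mono[OF B(1)[of s] frac_kernel_nonneg[OF \<nu>(1), of "c - s"]] B(2) abc
          frac_kernel_nonneg[OF \<nu>(1), of "c - s"]
        by (auto simp: K_def I_def indicator_def abs_mult mult_ac)
    qed
  qed
  then show "set_integrable lborel I (\<lambda>s. frac_kernel \<nu> (c - s) * p s)"
    unfolding set_integrable_def K_def[abs_def] by simp
  have h: "integrable (lborel \<Otimes>\<^sub>M lborel) h"
  proof (rule lborel_pair.Fubini_integrable[OF hm])
    show "integrable lborel (\<lambda>s. \<integral>\<theta>. norm (h (s, \<theta>)) \<partial>lborel)"
      unfolding has_bochner_integral_integral_eq[OF innern] using K by simp
    show "AE s in lborel. integrable lborel (\<lambda>\<theta>. h (s, \<theta>))"
      using inner by (auto simp: has_bochner_integral_iff)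
  qed
  have eq: "(\<integral>s. h (s, \<theta>) \<partial>lborel) = laplace_weight \<nu> \<theta> * (LINT s:I|lborel. exp (- (\<theta> * (c - s))) * p s)" for \<theta>
  proof -
    have "(\<integral>s. h (s, \<theta>) \<partial>lborel) = (\<integral>s. laplace_weight \<nu> \<theta> * (indicator I s * (exp (- (\<theta> * (c - s))) * p s)) \<partial>lborel)"
      by (intro Bochner_Integration.integral_cong) (auto simp: h_def mult_ac)
    then show ?thesis by (simp add: set_lebesgue_integral_def)
  qed
  show "integrable lborel (\<lambda>\<theta>. laplace_weight \<nu> \<theta> * (LINT s:I|lborel. exp (- (\<theta> * (c - s))) * p s))"
    using lborel_pair.integrable_snd[of "curry h"] h unfolding eq[symmetric] by (simp add: curry_def)
  have "(\<integral>\<theta>. \<integral>s. h (s, \<theta>) \<partial>lborel \<partial>lborel) = (\<integral>s. \<integral>\<theta>. h (s, \<theta>) \<partial>lborel \<partial>lborel)"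
    using h by (intro lborel_pair.Fubini_integral) simp
  then show "(LINT s:I|lborel. frac_kernel \<nu> (c - s) * p s)
      = (LINT \<theta>|lborel. laplace_weight \<nu> \<theta> * (LINT s:I|lborel. exp (- (\<theta> * (c - s))) * p s))"
    unfolding eq by (simp add: has_bochner_integral_integral_eq[OF inner] K_def set_lebesgue_integral_def)
qed

section \<open>Nonnegativity of the discrete memory\<close>

lemma caputo_L2_decomposition:
  assumes \<gamma>: "0 < \<gamma>" "\<gamma> < 1" and mono: "strict_mono_on {0..k} t" and t0: "t 0 = 0"
  shows "caputo_L2 t \<gamma> k w = (\<Sum>j=1..k. LINT s:{t (j - 1)<..<t j}|lborel.
    frac_kernel (1 - \<gamma>) (t k - s) * (diff_quot t w j + (2 * s - t (j - 1) - t j) * interpolant_slope t k w j))"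
    (is "_ = (\<Sum>j=1..k. LINT s:?I j|lborel. ?f j s)")
proof -
  have tless: "t i < t l" if "i < l" "l \<le> k" for i l
    using mono that by (auto simp: strict_mono_on_def)
  have tle: "t i \<le> t l" if "i \<le> l" "l \<le> k" for i l
    using tless[of i l] that by (cases "i = l") auto
  \<comment> \<open>The nodes, where the interpolant switches polynomials, are excluded; being
    finitely many they do not affect the integral.\<close>
  have eq: "indicator {0<..<t k} s * (frac_kernel (1 - \<gamma>) (t k - s) * deriv (interpolant t k w) s)
    = (\<Sum>j=1..k. indicator (?I j) s * ?f j s)" if s: "s \<notin> t ` {0..k}" for s
  proof (cases "s \<in> {0<..<t k}")
    case True
    define j where "j = (LEAST i. s \<le> t i)"
    have sj: "s \<le> t j" unfolding j_def by (rule LeastI[of _ k]) (use True in simp)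
    have jk: "j \<le> k" unfolding j_def by (rule Least_le) (use True in simp)
    have j0: "j \<noteq> 0" using sj True t0 by (auto intro: gr0I)
    have "\<not> s \<le> t (j - 1)" using not_less_Least[of "j - 1" "\<lambda>i. s \<le> t i"] j0 by (simp add: j_def)
    then have sI: "s \<in> ?I j" using sj s jk by force
    have other: "s \<notin> ?I i" if "i \<in> {1..k}" "i \<noteq> j" for i
    proof (cases "i < j")
      case True
      then have "i \<le> j - 1" "j - 1 \<le> k" using jk by linarith+
      then show ?thesis using tle[of i "j - 1"] sI by auto
    next
      case False
      then have "j \<le> i - 1" "i - 1 \<le> k" using that by auto
      then show ?thesis using tle[of j "i - 1"] sI by auto
    qed
    have "(\<Sum>i=1..k. indicator (?I i) s * ?f i s) = (\<Sum>i=1..k. if i = j then ?f j s else 0)"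
      using other sI by (intro sum.cong) (auto simp: indicator_def)
    also have "\<dots> = ?f j s" using jk j0 by simp
    also have "\<dots> = frac_kernel (1 - \<gamma>) (t k - s) * deriv (interpolant t k w) s"
      using deriv_interpolant[OF mono _ sI] jk j0 by simp
    finally show ?thesis using True by simp
  next
    case False
    have "s \<notin> ?I j" if "j \<in> {1..k}" for j
    proof -
      have "j - 1 \<le> k" "j \<le> k" using that by auto
      then show ?thesis using False tle[of 0 "j - 1"] tle[of j k] t0 by auto
    qed
    then have "(\<Sum>j=1..k. indicator (?I j) s * ?f j s) = 0" by (intro sum.neutral) simp
    then show ?thesis using False by simp
  qed
  have int: "set_integrable lborel (?I j) (?f j)" if "j \<in> {1..k}" for j
    using \<gamma> that by (intro frac_kernel_mixture(1) tle continuous_intros) auto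
  have "caputo_L2 t \<gamma> k w = (\<integral>s. (\<Sum>j=1..k. indicator (?I j) s *\<^sub>R ?f j s) \<partial>lborel)"
  proof -
    show ?thesis unfolding caputo_L2_def set_lebesgue_integral_def
      by (rule integral_discrete_difference[of "t ` {0..k}"]) (use eq in \<open>auto intro: countable_finite\<close>)
  qed
  also have "\<dots> = (\<Sum>j=1..k. LINT s:?I j|lborel. ?f j s)"
    unfolding set_lebesgue_integral_def using int unfolding set_integrable_def
    by (intro Bochner_Integration.integral_sum) auto
  finally show ?thesis .
qed

text \<open>Origin of \<open>exp_moment\<close>: the slope \<open>2 * s - a - b\<close> has mean
  zero on the interval, and the growing exponential weighs its positive half more.\<close>

lemma exp_integral:
  fixes a b c d e \<theta> :: real
  assumes "a \<le> b" "0 < \<theta>"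
  shows "(LINT s:{a<..<b}|lborel. exp (- (\<theta> * (c - s))) * (d + (2 * s - a - b) * e))
    = exp (- (\<theta> * (c - b))) * ((1 - exp (- (\<theta> * (b - a)))) * d + exp_moment (\<theta> * (b - a)) / \<theta> * e) / \<theta>"
proof -
  define f where "f s = exp (- (\<theta> * (c - s))) * (d + (2 * s - a - b) * e)" for s
  define P where "P s = exp (- (\<theta> * (c - s))) * (d / \<theta> + e * ((2 * s - a - b) / \<theta> - 2 / \<theta>\<^sup>2))" for s
  have "(LINT s:{a<..<b}|lborel. f s) = (\<integral>s. f s * indicator {a..b} s \<partial>lborel)"
    unfolding set_lebesgue_integral_def
    by (intro integral_cong_AE)
      (use AE_lborel_singleton[of a] AE_lborel_singleton[of b] in
        \<open>auto simp: f_def[abs_def] indicator_def elim!: eventually_elim2\<close>)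
  also have "\<dots> = P b - P a"
    unfolding P_def[abs_def] f_def using assms
    by (intro integral_FTC_Icc_real)
      (auto intro!: derivative_eq_intros continuous_intros simp: field_simps power2_eq_square)
  also have "\<dots> = exp (- (\<theta> * (c - b))) * ((1 - exp (- (\<theta> * (b - a)))) * d + exp_moment (\<theta> * (b - a)) / \<theta> * e) / \<theta>"
  proof -
    have "exp (- (\<theta> * (c - a))) = exp (- (\<theta> * (c - b))) * exp (- (\<theta> * (b - a)))"
      by (simp add: exp_add[symmetric] algebra_simps)
    then show ?thesis unfolding P_def exp_moment_def using assms(2)
      by (simp add: field_simps power2_eq_square)
  qed
  finally show ?thesis by (simp add: f_def)
qed

text \<open>Rescaling time by \<open>\<theta>\<close> reduces the rate to 1 and the steps to
  \<open>a k = \<theta> * step t k\<close>. The step ratios are invariant, so one scalar estimate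
  covers all rates.\<close>

lemma memory_exp_nonneg:
  fixes t w :: "nat \<Rightarrow> real"
  assumes mono: "strict_mono_on {0..n} t" and \<theta>: "0 < \<theta>"
    and ratio: "\<And>k. k \<in> {2..n} \<Longrightarrow> step_ratio t k \<in> {1/2..407/235}"
  shows "0 \<le> (\<Sum>k=1..n. (w k - w (k - 1)) * (\<Sum>j=1..k. LINT s:{t (j - 1)<..<t j}|lborel.
    exp (- (\<theta> * (t k - s))) * (diff_quot t w j + (2 * s - t (j - 1) - t j) * interpolant_slope t k w j)))"
proof -
  have tless: "t i < t l" if "i < l" "l \<le> n" for i l
    using mono that by (auto simp: strict_mono_on_def)
  define a where "a k = \<theta> * step t k" for k
  define d where "d = diff_quot t w"
  have apos: "0 < a k" if "k \<in> {1..n}" for k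
    using that \<theta> tless[of "k - 1" k] by (simp add: a_def step_def)
  have aratio: "a k / a (k - 1) \<in> {1/2..407/235}" if "k \<in> {2..n}" for k
    using ratio[OF that] \<theta> by (simp add: a_def step_ratio_def)
  \<comment> \<open>The first sum collects the mean slopes, the second the curvatures. The strict
    bound \<open>j < k\<close> leaves out the provisional curvature of interval \<open>k\<close>,
    and \<open>a (Suc j) + a j\<close> reflects the quadratic that also uses the next node.\<close>
  define G where "G k = (\<Sum>j=1..k. exp (- (\<theta> * (t k - t j))) * ((1 - exp (- a j)) * d j))
    + (\<Sum>j\<in>{1..<k}. exp (- (\<theta> * (t k - t j))) * (exp_moment (a j) / (a (Suc j) + a j) * (d (Suc j) - d j)))" for k
  have G1: "G 1 = (1 - exp (- a 1)) * d 1" by (simp add: G_def)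
  have GS: "G (Suc m) = exp (- a (Suc m)) * (G m + exp_moment (a m) / (a (Suc m) + a m) * (d (Suc m) - d m))
     + (1 - exp (- a (Suc m))) * d (Suc m)" if "1 \<le> m" for m
  proof -
    have e: "exp (- (\<theta> * (t (Suc m) - t j))) = exp (- a (Suc m)) * exp (- (\<theta> * (t m - t j)))" for j
      by (simp add: a_def step_def exp_add[symmetric] algebra_simps)
    have 1: "(\<Sum>j=1..m. exp (- (\<theta> * (t (Suc m) - t j))) * X j) = exp (- a (Suc m)) * (\<Sum>j=1..m. exp (- (\<theta> * (t m - t j))) * X j)"
      and 2: "(\<Sum>j\<in>{1..<m}. exp (- (\<theta> * (t (Suc m) - t j))) * X j) = exp (- a (Suc m)) * (\<Sum>j\<in>{1..<m}. exp (- (\<theta> * (t m - t j))) * X j)"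
      and 3: "exp (- (\<theta> * (t (Suc m) - t m))) = exp (- a (Suc m))" for X
      unfolding sum_distrib_left by (simp_all add: e[of m] mult.assoc e[abs_def] cong: sum.cong del: minus_mult_right)
    have A: "(\<Sum>j=1..Suc m. exp (- (\<theta> * (t (Suc m) - t j))) * X j)
        = exp (- a (Suc m)) * (\<Sum>j=1..m. exp (- (\<theta> * (t m - t j))) * X j) + X (Suc m)" for X
      using 1[of X] by simp
    have B: "(\<Sum>j\<in>{1..<Suc m}. exp (- (\<theta> * (t (Suc m) - t j))) * X j)
        = exp (- a (Suc m)) * ((\<Sum>j\<in>{1..<m}. exp (- (\<theta> * (t m - t j))) * X j) + X m)" for X
      using 2[of X] 3 that by (simp add: distrib_left)
    show ?thesis unfolding G_def A B by (simp only: distrib_left add_ac)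
  qed
  have D: "(\<Sum>j=1..k. LINT s:{t (j - 1)<..<t j}|lborel.
    exp (- (\<theta> * (t k - s))) * (diff_quot t w j + (2 * s - t (j - 1) - t j) * interpolant_slope t k w j))
    = (G k + (if k = 1 then 0 else exp_moment (a k) / (a k + a (k - 1)) * (d k - d (k - 1)))) / \<theta>"
    if k: "k \<in> {1..n}" for k
  proof -
    have "(\<Sum>j=1..k. LINT s:{t (j - 1)<..<t j}|lborel.
      exp (- (\<theta> * (t k - s))) * (diff_quot t w j + (2 * s - t (j - 1) - t j) * interpolant_slope t k w j))
     = (\<Sum>j=1..k. exp (- (\<theta> * (t k - t j))) * ((1 - exp (- a j)) * d j + exp_moment (a j) / \<theta> * interpolant_slope t k w j) / \<theta>)"
    proof (intro sum.cong refl)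
      fix j assume j: "j \<in> {1..k}"
      have "t (j - 1) \<le> t j" using tless[of "j - 1" j] j k by auto
      from exp_integral[OF this \<theta>] show "(LINT s:{t (j - 1)<..<t j}|lborel.
      exp (- (\<theta> * (t k - s))) * (diff_quot t w j + (2 * s - t (j - 1) - t j) * interpolant_slope t k w j))
     = exp (- (\<theta> * (t k - t j))) * ((1 - exp (- a j)) * d j + exp_moment (a j) / \<theta> * interpolant_slope t k w j) / \<theta>"
        by (simp add: a_def d_def step_def)
    qed
    also have "\<dots> = ((\<Sum>j=1..k. exp (- (\<theta> * (t k - t j))) * ((1 - exp (- a j)) * d j))
      + (\<Sum>j=1..k. exp (- (\<theta> * (t k - t j))) * (exp_moment (a j) / \<theta> * interpolant_slope t k w j))) / \<theta>"
      by (simp add: sum_divide_distrib sum.distrib[symmetric] add_divide_distrib distrib_left)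
    also have "(\<Sum>j=1..k. exp (- (\<theta> * (t k - t j))) * (exp_moment (a j) / \<theta> * interpolant_slope t k w j))
     = (\<Sum>j\<in>{1..<k}. exp (- (\<theta> * (t k - t j))) * (exp_moment (a j) / (a (Suc j) + a j) * (d (Suc j) - d j)))
      + (if k = 1 then 0 else exp_moment (a k) / (a k + a (k - 1)) * (d k - d (k - 1)))"
    proof (cases "k = 1")
      case True
      then show ?thesis by (simp add: interpolant_slope_def)
    next
      case False
      have ins: "{1..k} = insert k {1..<k}" using k by auto
      have m1: "exp_moment (a j) / \<theta> * interpolant_slope t k w j = exp_moment (a j) / (a (Suc j) + a j) * (d (Suc j) - d j)"
        if "j \<in> {1..<k}" for j
      proof -
        have "min j (k - Suc 0) = j" using that by auto
        then show ?thesis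
          using False \<theta> by (simp add: interpolant_slope_def Let_def a_def d_def distrib_left[symmetric] add.commute)
      qed
      have m2: "exp_moment (a k) / \<theta> * interpolant_slope t k w k = exp_moment (a k) / (a k + a (k - 1)) * (d k - d (k - 1))"
        using k False \<theta> by (simp add: interpolant_slope_def Let_def a_def d_def distrib_left[symmetric] min_absorb2 add.commute)
      have "(\<Sum>j\<in>{1..<k}. exp (- (\<theta> * (t k - t j))) * (exp_moment (a j) / \<theta> * interpolant_slope t k w j))
        = (\<Sum>j\<in>{1..<k}. exp (- (\<theta> * (t k - t j))) * (exp_moment (a j) / (a (Suc j) + a j) * (d (Suc j) - d j)))"
        by (intro sum.cong refl) (simp only: m1)
      then show ?thesis unfolding ins using False m2 by (simp del: times_divide_eq_left times_divide_eq_right)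
    qed
    finally show ?thesis by (simp add: G_def add.assoc)
  qed
  have "0 \<le> (\<Sum>k=1..n. a k * d k * (G k + (if k = 1 then 0 else exp_moment (a k) / (a k + a (k - 1)) * (d k - d (k - 1)))))"
  proof (rule exp_kernel_nonneg[where a = a and d = d and G = G, OF apos aratio G1])
    fix k assume "k \<in> {2..n}"
    then obtain m where m: "k = Suc m" "1 \<le> m" by (cases k) auto
    then show "G k = exp (- a k) * (G (k - 1) + exp_moment (a (k - 1)) / (a k + a (k - 1)) * (d k - d (k - 1))) + (1 - exp (- a k)) * d k"
      using GS[of m] by simp
  qed
  \<comment> \<open>One factor \<open>\<theta>\<close> comes from
    \<open>a k * d k = \<theta> * (w k - w (k - 1))\<close>, the other from the division by
    \<open>\<theta>\<close> in \<open>exp_integral\<close>.\<close>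
  also have "\<dots> = \<theta>\<^sup>2 * (\<Sum>k=1..n. (w k - w (k - 1)) * ((G k + (if k = 1 then 0 else exp_moment (a k) / (a k + a (k - 1)) * (d k - d (k - 1)))) / \<theta>))"
    unfolding sum_distrib_left
  proof (intro sum.cong refl)
    fix k assume "k \<in> {1..n}"
    then have "w k - w (k - 1) = step t k * d k" using apos[of k] \<theta> by (simp add: d_def diff_quot_def a_def zero_less_mult_iff)
    then show "a k * d k * (G k + (if k = 1 then 0 else exp_moment (a k) / (a k + a (k - 1)) * (d k - d (k - 1))))
      = \<theta>\<^sup>2 * ((w k - w (k - 1)) * ((G k + (if k = 1 then 0 else exp_moment (a k) / (a k + a (k - 1)) * (d k - d (k - 1)))) / \<theta>))"
      using \<theta> by (simp only: a_def[of k]) (simp add: power2_eq_square)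
  qed
  also have "(\<Sum>k=1..n. (w k - w (k - 1)) * ((G k + (if k = 1 then 0 else exp_moment (a k) / (a k + a (k - 1)) * (d k - d (k - 1)))) / \<theta>))
    = (\<Sum>k=1..n. (w k - w (k - 1)) * (\<Sum>j=1..k. LINT s:{t (j - 1)<..<t j}|lborel.
    exp (- (\<theta> * (t k - s))) * (diff_quot t w j + (2 * s - t (j - 1) - t j) * interpolant_slope t k w j)))"
    using D by (intro sum.cong) auto
  finally show ?thesis using \<theta> by (simp add: zero_le_mult_iff)
qed

lemma caputo_L2_nonneg:
  fixes t w :: "nat \<Rightarrow> real"
  assumes \<gamma>: "0 < \<gamma>" "\<gamma> < 1" and mono: "strict_mono_on {0..n} t" and t0: "t 0 = 0"
    and ratio: "\<And>k. k \<in> {2..n} \<Longrightarrow> step_ratio t k \<in> {1/2..407/235}"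
  shows "0 \<le> (\<Sum>k=1..n. (w k - w (k - 1)) * caputo_L2 t \<gamma> k w)"
proof -
  define \<nu> where "\<nu> = 1 - \<gamma>"
  have \<nu>: "0 < \<nu>" "\<nu> < 1" using \<gamma> by (auto simp: \<nu>_def)
  have tle: "t i \<le> t l" if "i \<le> l" "l \<le> n" for i l
    using mono that by (cases "i = l") (auto simp: strict_mono_on_def intro: less_imp_le)
  define p where "p k j s = diff_quot t w j + (2 * s - t (j - 1) - t j) * interpolant_slope t k w j" for k j and s :: real
  define L where "L \<theta> k j = (LINT s:{t (j - 1)<..<t j}|lborel. exp (- (\<theta> * (t k - s))) * p k j s)" for \<theta> k j
  have int: "integrable lborel (\<lambda>\<theta>. laplace_weight \<nu> \<theta> * L \<theta> k j)"
    and eq: "(LINT s:{t (j - 1)<..<t j}|lborel. frac_kernel \<nu> (t k - s) * p k j s) = (LINT \<theta>|lborel. laplace_weight \<nu> \<theta> * L \<theta> k j)"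
    if "k \<in> {1..n}" "j \<in> {1..k}" for k j
    unfolding L_def
    by (rule frac_kernel_mixture; use that \<nu> in \<open>auto simp: p_def[abs_def] intro!: tle continuous_intros\<close>)+
  have "(\<Sum>k=1..n. (w k - w (k - 1)) * caputo_L2 t \<gamma> k w)
    = (\<Sum>k=1..n. (w k - w (k - 1)) * (\<Sum>j=1..k. LINT \<theta>|lborel. laplace_weight \<nu> \<theta> * L \<theta> k j))"
  proof (intro sum.cong refl arg_cong2[where f = "(*)"])
    fix k assume k: "k \<in> {1..n}"
    have "caputo_L2 t \<gamma> k w = (\<Sum>j=1..k. LINT s:{t (j - 1)<..<t j}|lborel. frac_kernel \<nu> (t k - s) * p k j s)"
      unfolding p_def \<nu>_def using k
      by (intro caputo_L2_decomposition \<gamma> t0 monotone_on_subset[OF mono]) auto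
    also have "\<dots> = (\<Sum>j=1..k. LINT \<theta>|lborel. laplace_weight \<nu> \<theta> * L \<theta> k j)"
      using k by (intro sum.cong eq) auto
    finally show "caputo_L2 t \<gamma> k w = (\<Sum>j=1..k. LINT \<theta>|lborel. laplace_weight \<nu> \<theta> * L \<theta> k j)" .
  qed
  also have "\<dots> = (LINT \<theta>|lborel. (\<Sum>k=1..n. (w k - w (k - 1)) * (\<Sum>j=1..k. laplace_weight \<nu> \<theta> * L \<theta> k j)))"
    by (intro has_bochner_integral_integral_eq[symmetric] has_bochner_integral_sum has_bochner_integral_mult_right
        has_bochner_integral_integrable int) auto
  also have "\<dots> = (LINT \<theta>|lborel. laplace_weight \<nu> \<theta> * (\<Sum>k=1..n. (w k - w (k - 1)) * (\<Sum>j=1..k. L \<theta> k j)))"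
    by (simp add: sum_distrib_left mult_ac)
  also have "\<dots> \<ge> 0"
  proof (rule Bochner_Integration.integral_nonneg)
    fix \<theta> :: real
    show "0 \<le> laplace_weight \<nu> \<theta> * (\<Sum>k=1..n. (w k - w (k - 1)) * (\<Sum>j=1..k. L \<theta> k j))"
      using laplace_weight_nonneg[OF \<nu>, of \<theta>] memory_exp_nonneg[OF mono _ ratio, of \<theta> w]
      by (cases "\<theta> \<le> 0") (auto simp: laplace_weight_eq_0 L_def p_def)
  qed
  finally show ?thesis .
qed

section \<open>Linearity of the L2 formula in the nodal values\<close>

definition linear_in_values :: "nat \<Rightarrow> ((nat \<Rightarrow> real) \<Rightarrow> real) \<Rightarrow> bool" where
  "linear_in_values k f \<longleftrightarrow> (\<exists>M. \<forall>w. f w = (\<Sum>i\<le>k. M i * w i))"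

lemma linear_in_values_apply: "i \<le> k \<Longrightarrow> linear_in_values k (\<lambda>w. w i)"
  unfolding linear_in_values_def
  by (intro exI[of _ "\<lambda>j. if j = i then 1 else 0"]) (auto simp: if_distrib[of "\<lambda>x. x * _"] cong: if_cong)

lemma linear_in_values_add:
  "linear_in_values k f \<Longrightarrow> linear_in_values k g \<Longrightarrow> linear_in_values k (\<lambda>w. f w + g w)"
  unfolding linear_in_values_def
proof (elim exE)
  fix M N assume "\<forall>w. f w = (\<Sum>i\<le>k. M i * w i)" "\<forall>w. g w = (\<Sum>i\<le>k. N i * w i)"
  then show "\<exists>M. \<forall>w. f w + g w = (\<Sum>i\<le>k. M i * w i)"
    by (intro exI[of _ "\<lambda>i. M i + N i"]) (simp add: distrib_right sum.distrib)
qed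

lemma linear_in_values_mult: "linear_in_values k f \<Longrightarrow> linear_in_values k (\<lambda>w. c * f w)"
  unfolding linear_in_values_def
proof (elim exE)
  fix M assume "\<forall>w. f w = (\<Sum>i\<le>k. M i * w i)"
  then show "\<exists>M. \<forall>w. c * f w = (\<Sum>i\<le>k. M i * w i)"
    by (intro exI[of _ "\<lambda>i. c * M i"]) (simp add: sum_distrib_left mult.assoc)
qed

lemma linear_in_values_0: "linear_in_values k (\<lambda>w. 0)"
  unfolding linear_in_values_def by (intro exI[of _ "\<lambda>_. 0"]) simp

lemma linear_in_values_sum:
  "finite A \<Longrightarrow> (\<And>j. j \<in> A \<Longrightarrow> linear_in_values k (f j)) \<Longrightarrow> linear_in_values k (\<lambda>w. \<Sum>j\<in>A. f j w)"
  by (induction A rule: finite_induct) (auto intro!: linear_in_values_add linear_in_values_0)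

lemma linear_in_values_diff_quot: "j \<le> k \<Longrightarrow> linear_in_values k (\<lambda>w. diff_quot t w j)"
  using linear_in_values_mult[OF linear_in_values_add[OF linear_in_values_apply[of j k]
    linear_in_values_mult[OF linear_in_values_apply[of "j - 1" k], of "-1"]], of "1 / step t j"]
  by (simp add: diff_quot_def)

lemma linear_in_values_interpolant_slope:
  assumes "j \<le> k" "1 \<le> k"
  shows "linear_in_values k (\<lambda>w. interpolant_slope t k w j)"
proof (cases "k = 1")
  case True
  then show ?thesis
    by (simp add: interpolant_slope_def linear_in_values_0)
next
  case False
  define i where "i = min j (k - 1)"
  have i: "i \<le> k" "i + 1 \<le> k" using assms False by (auto simp: i_def)
  have "linear_in_values k (\<lambda>w. 1 / (step t i + step t (i + 1)) * (diff_quot t w (i + 1) + (-1) * diff_quot t w i))"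
    by (intro linear_in_values_mult linear_in_values_add linear_in_values_diff_quot i)
  then show ?thesis using False by (simp add: interpolant_slope_def Let_def i_def)
qed

text \<open>\<open>deriv\<close> and the integral hide the linearity; after the decomposition only
  quotients and slopes depend on \<open>w\<close>. As the coefficients are the same for all
  \<open>w\<close>, the operator applied at each \<open>x\<close> to a family of functions is a
  finite combination of these functions: it stays in \<open>L2_space\<close> and passes through
  inner products.\<close>

lemma linear_in_values_caputo_L2:
  assumes \<gamma>: "0 < \<gamma>" "\<gamma> < 1" and mono: "strict_mono_on {0..k} t" and t0: "t 0 = 0" and "1 \<le> k"
  shows "linear_in_values k (\<lambda>w. caputo_L2 t \<gamma> k w)"
proof -
  have tle: "t i \<le> t l" if "i \<le> l" "l \<le> k" for i l
    using mono that by (cases "i = l") (auto simp: strict_mono_on_def intro: less_imp_le)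
  define A where "A j = (LINT s:{t (j - 1)<..<t j}|lborel. frac_kernel (1 - \<gamma>) (t k - s) * 1)" for j
  define E where "E j = (LINT s:{t (j - 1)<..<t j}|lborel. frac_kernel (1 - \<gamma>) (t k - s) * (2 * s - t (j - 1) - t j))" for j
  have "caputo_L2 t \<gamma> k w = (\<Sum>j=1..k. A j * diff_quot t w j + E j * interpolant_slope t k w j)" for w
    unfolding caputo_L2_decomposition[OF \<gamma> mono t0]
  proof (intro sum.cong refl)
    fix j assume j: "j \<in> {1..k}"
    have 1: "set_integrable lborel {t (j - 1)<..<t j} (\<lambda>s. frac_kernel (1 - \<gamma>) (t k - s) * 1)"
      "set_integrable lborel {t (j - 1)<..<t j} (\<lambda>s. frac_kernel (1 - \<gamma>) (t k - s) * (2 * s - t (j - 1) - t j))"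
      using \<gamma> j by (intro frac_kernel_mixture(1) tle continuous_intros; simp)+
    have "(LINT s:{t (j - 1)<..<t j}|lborel. frac_kernel (1 - \<gamma>) (t k - s) * (diff_quot t w j + (2 * s - t (j - 1) - t j) * interpolant_slope t k w j))
      = (LINT s:{t (j - 1)<..<t j}|lborel. diff_quot t w j * (frac_kernel (1 - \<gamma>) (t k - s) * 1)
         + interpolant_slope t k w j * (frac_kernel (1 - \<gamma>) (t k - s) * (2 * s - t (j - 1) - t j)))"
      by (intro set_lebesgue_integral_cong) (auto simp: algebra_simps)
    also have "\<dots> = A j * diff_quot t w j + E j * interpolant_slope t k w j"
      unfolding A_def E_def using 1 by (subst set_integral_add) (auto simp: mult.commute)
    finally show "(LINT s:{t (j - 1)<..<t j}|lborel. frac_kernel (1 - \<gamma>) (t k - s) * (diff_quot t w j + (2 * s - t (j - 1) - t j) * interpolant_slope t k w j))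
      = A j * diff_quot t w j + E j * interpolant_slope t k w j" .
  qed
  moreover have "linear_in_values k (\<lambda>w. \<Sum>j=1..k. A j * diff_quot t w j + E j * interpolant_slope t k w j)"
    using assms by (intro linear_in_values_sum linear_in_values_add linear_in_values_mult
      linear_in_values_diff_quot linear_in_values_interpolant_slope) auto
  ultimately show ?thesis by simp
qed

section \<open>Smooth bump functions\<close>

text \<open>The classical flat function \<open>exp (- 1 / s)\<close>; the extra powers of
  \<open>1 / s\<close> make the family closed under differentiation up to linear
  combinations.\<close>

definition flat_exp :: "nat \<Rightarrow> real \<Rightarrow> real" where
  "flat_exp k s = (if s \<le> 0 then 0 else exp (- inverse s) * inverse s ^ k)"

lemma flat_exp_at_right: "(flat_exp k \<longlongrightarrow> 0) (at_right 0)"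
proof -
  have "((\<lambda>s. inverse s ^ k / exp (inverse s)) \<longlongrightarrow> (0::real)) (at_right 0)"
    by (rule filterlim_compose[OF tendsto_power_div_exp_0 filterlim_inverse_at_top_right])
  moreover have "\<forall>\<^sub>F s in at_right 0. inverse s ^ k / exp (inverse s) = flat_exp k s"
    by (rule eventually_at_rightI[of 0 1]) (auto simp: flat_exp_def exp_minus field_simps)
  ultimately show ?thesis by (rule Lim_transform_eventually)
qed

lemma DERIV_flat_exp:
  "(flat_exp k has_real_derivative flat_exp (k + 2) s - real k * flat_exp (k + 1) s) (at s)"
proof -
  consider "s < 0" | "s = 0" | "0 < s" by linarith
  then show ?thesis
  proof cases
    case 1
    then have "(flat_exp k has_real_derivative 0) (at s)"
      by (intro has_field_derivative_transform_within_open[OF DERIV_const[of 0], of "{..<0}"])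
        (auto simp: flat_exp_def)
    then show ?thesis using 1 by (simp add: flat_exp_def)
  next
    case 2
    have "((\<lambda>h. flat_exp k h / h) \<longlongrightarrow> 0) (at 0)"
    proof (rule filterlim_split_at)
      have "\<forall>\<^sub>F h in at_right 0. flat_exp (Suc k) h = flat_exp k h / h"
        by (rule eventually_at_rightI[of 0 1]) (auto simp: flat_exp_def field_simps)
      then show "((\<lambda>h. flat_exp k h / h) \<longlongrightarrow> 0) (at_right 0)"
        by (rule Lim_transform_eventually[OF flat_exp_at_right])
      have "\<forall>\<^sub>F h in at_left 0. 0 = flat_exp k h / h"
        by (rule eventually_at_leftI[of "-1"]) (auto simp: flat_exp_def)
      then show "((\<lambda>h. flat_exp k h / h) \<longlongrightarrow> 0) (at_left 0)"
        by (rule Lim_transform_eventually[OF tendsto_const])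
    qed
    then show ?thesis unfolding 2 DERIV_def by (simp add: flat_exp_def)
  next
    case 3
    have "((\<lambda>s. exp (- inverse s) * inverse s ^ k) has_real_derivative flat_exp (k + 2) s - real k * flat_exp (k + 1) s) (at s)"
    proof -
      have d: "(inverse has_real_derivative - (inverse s ^ 2)) (at s)"
        using 3 by (auto intro!: derivative_eq_intros simp: power2_eq_square)
      have e: "((\<lambda>s. exp (- inverse s)) has_real_derivative exp (- inverse s) * inverse s ^ 2) (at s)"
        by (rule DERIV_cong[OF DERIV_fun_exp[OF DERIV_minus[OF d]]]) simp
      have "((\<lambda>s. inverse s ^ k) has_real_derivative - real k * inverse s ^ (k + 1)) (at s)"
      proof (induction k)
        case (Suc k)
        show ?case
          using DERIV_cong[OF DERIV_mult[OF d Suc], of "- real (Suc k) * inverse s ^ (Suc k + 1)"]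
          by (simp add: algebra_simps power2_eq_square)
      qed simp
      from DERIV_cong[OF DERIV_mult[OF e this]] show ?thesis
        using 3 by (simp add: flat_exp_def algebra_simps power2_eq_square)
    qed
    then show ?thesis
      using 3 by (elim has_field_derivative_transform_within_open[of _ _ _ "{0<..}"]) (auto simp: flat_exp_def)
  qed
qed

text \<open>A syntactic class closed under directional derivatives. Smoothness, which speaks of all
  iterated partials, then follows by induction on the list of directions, without formulas for
  higher derivatives.\<close>

inductive_set smooth_algebra :: "('a::euclidean_space \<Rightarrow> real) set" where
  const: "(\<lambda>x. c) \<in> smooth_algebra"
| flat: "(\<lambda>x. flat_exp k (c + x \<bullet> v)) \<in> smooth_algebra"
| add: "f \<in> smooth_algebra \<Longrightarrow> g \<in> smooth_algebra \<Longrightarrow> (\<lambda>x. f x + g x) \<in> smooth_algebra"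
| mult: "f \<in> smooth_algebra \<Longrightarrow> g \<in> smooth_algebra \<Longrightarrow> (\<lambda>x. f x * g x) \<in> smooth_algebra"

lemma smooth_algebra_continuous: "f \<in> smooth_algebra \<Longrightarrow> continuous_on UNIV f"
proof (induction rule: smooth_algebra.induct)
  case (flat k c v)
  have "continuous_on UNIV (flat_exp k)"
    by (intro DERIV_continuous_on[of _ _ "\<lambda>s. flat_exp (k + 2) s - real k * flat_exp (k + 1) s"]
      has_field_derivative_at_within[OF DERIV_flat_exp])
  moreover have "continuous_on UNIV (\<lambda>x. c + x \<bullet> v)" by (intro continuous_intros)
  ultimately show ?case by (rule continuous_on_compose2) simp
qed (auto intro: continuous_intros)

lemma smooth_algebra_derivative:
  assumes "f \<in> smooth_algebra"
  shows "\<exists>f'\<in>smooth_algebra. \<forall>x. ((\<lambda>h. f (x + h *\<^sub>R b)) has_real_derivative f' x) (at 0)"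
  using assms
proof (induction rule: smooth_algebra.induct)
  case (const c)
  show ?case by (intro bexI[of _ "\<lambda>x. 0"]) (auto intro: smooth_algebra.const)
next
  case (flat k c v)
  let ?f' = "\<lambda>x. (b \<bullet> v) * (flat_exp (k + 2) (c + x \<bullet> v) + (- real k) * flat_exp (k + 1) (c + x \<bullet> v))"
  show ?case
  proof (intro bexI[of _ ?f'] allI)
    fix x
    have "((\<lambda>h. flat_exp k (c + (x + h *\<^sub>R b) \<bullet> v)) has_real_derivative
      (flat_exp (k + 2) (c + (x + 0 *\<^sub>R b) \<bullet> v) - real k * flat_exp (k + 1) (c + (x + 0 *\<^sub>R b) \<bullet> v)) * (b \<bullet> v)) (at 0)"
      by (rule DERIV_chain2[OF DERIV_flat_exp]) (auto intro!: derivative_eq_intros simp: inner_add_left)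
    then show "((\<lambda>h. flat_exp k (c + (x + h *\<^sub>R b) \<bullet> v)) has_real_derivative ?f' x) (at 0)"
      by (simp add: mult.commute)
  qed (intro smooth_algebra.intros)
next
  case (add f g)
  then obtain f' g' where "f' \<in> smooth_algebra" "g' \<in> smooth_algebra"
    "\<And>x. ((\<lambda>h. f (x + h *\<^sub>R b)) has_real_derivative f' x) (at 0)"
    "\<And>x. ((\<lambda>h. g (x + h *\<^sub>R b)) has_real_derivative g' x) (at 0)" by blast
  then show ?case
    by (intro bexI[of _ "\<lambda>x. f' x + g' x"] allI DERIV_add smooth_algebra.add) auto
next
  case (mult f g)
  then obtain f' g' where "f' \<in> smooth_algebra" "g' \<in> smooth_algebra"
    "\<And>x. ((\<lambda>h. f (x + h *\<^sub>R b)) has_real_derivative f' x) (at 0)"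
    "\<And>x. ((\<lambda>h. g (x + h *\<^sub>R b)) has_real_derivative g' x) (at 0)" by blast
  with mult show ?case
    by (intro bexI[of _ "\<lambda>x. f' x * g x + g' x * f x"] allI smooth_algebra.add smooth_algebra.mult)
      (auto intro!: derivative_eq_intros)
qed

lemma smooth_algebra_partials: "f \<in> smooth_algebra \<Longrightarrow> partials bs f \<in> smooth_algebra"
proof (induction bs)
  case Nil
  then show ?case by (simp add: partials_def)
next
  case (Cons b bs)
  then obtain f' where f': "f' \<in> smooth_algebra"
    "\<And>x. ((\<lambda>h. partials bs f (x + h *\<^sub>R b)) has_real_derivative f' x) (at 0)"
    using smooth_algebra_derivative by blast
  have "partials (b # bs) f = f'"
    using f'(2) by (auto simp: partials_def dir_deriv_def fun_eq_iff intro!: DERIV_imp_deriv)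
  then show ?case using f'(1) by simp
qed

lemma smooth_algebra_smooth: "f \<in> smooth_algebra \<Longrightarrow> smooth f"
  unfolding smooth_def
  using smooth_algebra_partials smooth_algebra_continuous smooth_algebra_derivative
  by (metis real_differentiable_def)

lemma smooth_algebra_prod:
  "finite A \<Longrightarrow> (\<And>i. i \<in> A \<Longrightarrow> f i \<in> smooth_algebra) \<Longrightarrow> (\<lambda>x. \<Prod>i\<in>A. f i x) \<in> smooth_algebra"
  by (induction A rule: finite_induct) (auto intro: smooth_algebra.const smooth_algebra.mult)

text \<open>Growing \<open>n\<close> steepens the factors without moving the support, so these
  smooth functions approximate the indicator of the open box from below.\<close>

definition box_bump :: "'a::euclidean_space \<Rightarrow> 'a \<Rightarrow> nat \<Rightarrow> 'a \<Rightarrow> real" where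
  "box_bump a b n x = (\<Prod>i\<in>Basis. flat_exp 0 (real n * (x \<bullet> i - a \<bullet> i)) * flat_exp 0 (real n * (b \<bullet> i - x \<bullet> i)))"

lemma flat_exp_0_bounds: "0 \<le> flat_exp 0 s" "flat_exp 0 s \<le> 1"
  by (auto simp: flat_exp_def)

lemma box_bump_bounds: "0 \<le> box_bump a b n x" "box_bump a b n x \<le> 1"
  unfolding box_bump_def by (auto intro!: prod_nonneg prod_le_1 mult_le_one simp: flat_exp_0_bounds)

lemma box_bump_eq_0: "x \<notin> box a b \<Longrightarrow> box_bump a b n x = 0"
  unfolding box_bump_def mem_box by (auto simp: flat_exp_def mult_le_0_iff not_less)

lemma box_bump_test_function:
  assumes "cbox a b \<subseteq> \<Omega>"
  shows "box_bump a b n \<in> test_functions \<Omega>"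
proof -
  have "box_bump a b n = (\<lambda>x. \<Prod>i\<in>Basis. flat_exp 0 (- real n * (a \<bullet> i) + x \<bullet> (real n *\<^sub>R i))
    * flat_exp 0 (real n * (b \<bullet> i) + x \<bullet> (- real n *\<^sub>R i)))"
    by (simp add: box_bump_def fun_eq_iff algebra_simps)
  also have "\<dots> \<in> smooth_algebra"
    by (intro smooth_algebra_prod smooth_algebra.mult smooth_algebra.flat finite_Basis)
  finally have "smooth (box_bump a b n)" by (rule smooth_algebra_smooth)
  moreover have sub: "closure {x. box_bump a b n x \<noteq> 0} \<subseteq> cbox a b"
    using box_bump_eq_0 box_subset_cbox by (intro closure_minimal closed_cbox) blast
  moreover have "compact (closure {x. box_bump a b n x \<noteq> 0})"
    using sub by (meson bounded_cbox bounded_subset closed_closure compact_eq_bounded_closed)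
  ultimately show ?thesis using assms by (auto simp: test_functions_def)
qed

lemma box_bump_limit: "(\<lambda>n. box_bump a b n x) \<longlonglongrightarrow> indicator (box a b) x"
proof (cases "x \<in> box a b")
  case True
  have 1: "(\<lambda>n. flat_exp 0 (real n * s)) \<longlonglongrightarrow> 1" if "0 < s" for s
  proof (rule Lim_transform_eventually)
    have "(\<lambda>n. exp (- inverse (real n) * inverse s)) \<longlonglongrightarrow> exp (- 0 * inverse s)"
      by (intro tendsto_intros lim_inverse_n)
    then show "(\<lambda>n. exp (- inverse (real n) * inverse s)) \<longlonglongrightarrow> 1" by simp
    show "\<forall>\<^sub>F n in sequentially. exp (- inverse (real n) * inverse s) = flat_exp 0 (real n * s)"
      using eventually_gt_at_top[of 0] by eventually_elim (use that in \<open>auto simp: flat_exp_def mult_le_0_iff\<close>)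
  qed
  have "(\<lambda>n. box_bump a b n x) \<longlonglongrightarrow> (\<Prod>i\<in>(Basis::'a set). 1 * 1)"
    unfolding box_bump_def using True by (intro tendsto_prod tendsto_mult 1) (auto simp: mem_box)
  then show ?thesis using True by simp
qed (simp add: box_bump_eq_0)

text \<open>Open boxes are an intersection-stable generator of the Borel sets, so a Dynkin argument
  gives integral 0 over every Borel set. The bounded support supplies the whole space, which is not
  a box. The argument runs on a Borel representative \<open>g\<close> because boxes do not generate
  the Lebesgue sets.\<close>

lemma integral_boxes_zero_imp_AE_zero:
  fixes H :: "'a::euclidean_space \<Rightarrow> real"
  assumes H: "integrable lebesgue H" and supp: "\<And>x. H x \<noteq> 0 \<Longrightarrow> x \<in> box p q"
    and box: "\<And>c d. (LINT x:box c d|lebesgue. H x) = 0"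
  shows "AE x in lebesgue. H x = 0"
proof -
  obtain g where g [measurable]: "g \<in> borel_measurable lborel" and Hg: "AE x in lborel. H x = g x"
    using completion_ex_borel_measurable_real[of H lborel] H by (auto simp: borel_measurable_integrable)
  have Hg': "AE x in lebesgue. H x = g x" using Hg by (rule AE_completion)
  have gm: "g \<in> borel_measurable lebesgue" using g by (rule measurable_completion)
  have gi: "integrable lebesgue g" using Hg' by (rule integrable_cong_AE_imp[OF H gm])
  then have gl: "integrable lborel g" by (simp add: integrable_completion)
  have int: "(LINT x:A|lborel. g x) = (LINT x:A|lebesgue. H x)" if [measurable]: "A \<in> sets borel" for A
  proof -
    have "(LINT x:A|lborel. g x) = (LINT x:A|lebesgue. g x)"
      unfolding set_lebesgue_integral_def by (subst integral_completion) auto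
    also have "\<dots> = (LINT x:A|lebesgue. H x)"
      using Hg' H that by (intro set_lebesgue_integral_cong_AE gm) (auto elim: eventually_mono)
    finally show ?thesis .
  qed
  have all: "(LINT x|lborel. g x) = 0"
  proof -
    have "(LINT x|lborel. g x) = (LINT x:UNIV|lborel. g x)" by (simp add: set_lebesgue_integral_def)
    also have "\<dots> = (LINT x:UNIV|lebesgue. H x)" by (rule int) auto
    also have "\<dots> = (LINT x:box p q|lebesgue. H x)"
      unfolding set_lebesgue_integral_def using supp by (intro Bochner_Integration.integral_cong) (auto simp: indicator_def)
    finally show ?thesis using box by simp
  qed
  have si: "set_integrable lborel A g" if "A \<in> sets borel" for A
    using integrable_mult_indicator[of A lborel g] gl that by (simp add: set_integrable_def)
  have zero: "(LINT x:A|lborel. g x) = 0" if "A \<in> sets borel" for A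
  proof -
    let ?B = "range (\<lambda>(a, b). box a b :: 'a set)"
    have "Int_stable ?B" by (auto simp: Int_stable_def box_Int_box)
    moreover have "?B \<subseteq> Pow UNIV" by auto
    moreover have "A \<in> sigma_sets UNIV ?B" using that unfolding borel_eq_box by simp
    ultimately show ?thesis
    proof (induction rule: sigma_sets_induct_disjoint)
      case (basic A)
      then show ?case using int box by auto
    next
      case empty
      show ?case by (simp add: set_lebesgue_integral_def)
    next
      case (compl A)
      then have A: "A \<in> sets borel" unfolding borel_eq_box by simp
      have "(LINT x:UNIV|lborel. g x) = (LINT x:(UNIV - A) \<union> A|lborel. g x)" by simp
      also have "\<dots> = (LINT x:UNIV - A|lborel. g x) + (LINT x:A|lborel. g x)"
        using A by (intro set_integral_Un si) auto
      finally show ?case using compl all by (simp add: set_lebesgue_integral_def)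
    next
      case (union A)
      then have A: "A i \<in> sets borel" for i unfolding borel_eq_box by auto
      have "(LINT x:(\<Union>i. A i)|lborel. g x) = (\<Sum>i. (LINT x:(A i)|lborel. g x))"
        using A union by (intro lebesgue_integral_countable_add si) (auto simp: disjoint_family_on_def)
      then show ?case using union by simp
    qed
  qed
  have "AE x in lborel. g x = 0"
    by (rule density_unique_real) (use gl zero in \<open>auto simp: set_lebesgue_integral_def\<close>)
  then show ?thesis using Hg by (intro AE_completion) (auto elim: eventually_elim2)
qed

section \<open>Weak derivatives and Green's identity\<close>

lemma borel_measurable_lebesgue_on_AE:
  fixes f g :: "'a::euclidean_space \<Rightarrow> real"
  assumes "\<Omega> \<in> sets lebesgue" "f \<in> borel_measurable (lebesgue_on \<Omega>)" "AE x in lebesgue_on \<Omega>. f x = g x"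
  shows "g \<in> borel_measurable (lebesgue_on \<Omega>)"
proof -
  have "AE x in lebesgue. (if x \<in> \<Omega> then f x else 0) = (if x \<in> \<Omega> then g x else 0)"
    using assms(1,3) by (subst (asm) AE_restrict_space_iff) (auto elim: eventually_mono)
  from borel_measurable_AE[OF _ this] assms show ?thesis
    by (simp add: borel_measurable_if)
qed

lemma L2_inner_commute: "L2_inner \<Omega> f g = L2_inner \<Omega> g f"
  by (simp add: L2_inner_def mult.commute)

lemma L2_mult_integrable:
  assumes "f \<in> L2_space \<Omega>" "g \<in> L2_space \<Omega>"
  shows "integrable (lebesgue_on \<Omega>) (\<lambda>x. f x * g x)"
proof (rule Bochner_Integration.integrable_bound)
  show "integrable (lebesgue_on \<Omega>) (\<lambda>x. (f x)\<^sup>2 + (g x)\<^sup>2)" using assms by (auto simp: L2_space_def)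
  show "(\<lambda>x. f x * g x) \<in> borel_measurable (lebesgue_on \<Omega>)" using assms by (auto simp: L2_space_def)
  have "\<bar>a * b\<bar> \<le> a\<^sup>2 + b\<^sup>2" for a b :: real
    using zero_le_power2[of "a - b"] zero_le_power2[of "a + b"] zero_le_power2[of a] zero_le_power2[of b]
    by (simp add: power2_eq_square algebra_simps abs_le_iff)
  then show "AE x in lebesgue_on \<Omega>. norm (f x * g x) \<le> norm ((f x)\<^sup>2 + (g x)\<^sup>2)" by simp
qed

lemma L2_space_add:
  assumes "f \<in> L2_space \<Omega>" "g \<in> L2_space \<Omega>"
  shows "(\<lambda>x. f x + g x) \<in> L2_space \<Omega>"
proof -
  have "integrable (lebesgue_on \<Omega>) (\<lambda>x. (f x)\<^sup>2 + (g x)\<^sup>2 + 2 * (f x * g x))"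
    using assms L2_mult_integrable[OF assms] by (simp add: L2_space_def)
  moreover have "(\<lambda>x. (f x)\<^sup>2 + (g x)\<^sup>2 + 2 * (f x * g x)) = (\<lambda>x. (f x + g x)\<^sup>2)"
    by (simp add: power2_sum mult.assoc)
  ultimately show ?thesis using assms by (auto simp: L2_space_def)
qed

lemma L2_space_cmult: "f \<in> L2_space \<Omega> \<Longrightarrow> (\<lambda>x. c * f x) \<in> L2_space \<Omega>"
  by (auto simp: L2_space_def power_mult_distrib)

lemma L2_space_0: "(\<lambda>x. 0) \<in> L2_space \<Omega>"
  by (simp add: L2_space_def)

lemma L2_space_diff:
  assumes "f \<in> L2_space \<Omega>" "g \<in> L2_space \<Omega>"
  shows "(\<lambda>x. f x - g x) \<in> L2_space \<Omega>"
  using L2_space_add[OF assms(1) L2_space_cmult[OF assms(2), of "-1"]] by simp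

lemma L2_space_sum: "finite A \<Longrightarrow> (\<And>i. i \<in> A \<Longrightarrow> f i \<in> L2_space \<Omega>) \<Longrightarrow> (\<lambda>x. \<Sum>i\<in>A. f i x) \<in> L2_space \<Omega>"
  by (induction A rule: finite_induct) (simp_all add: L2_space_add L2_space_0)

lemma L2_space_AE:
  assumes "\<Omega> \<in> sets lebesgue" "f \<in> L2_space \<Omega>" "AE x in lebesgue_on \<Omega>. f x = g x"
  shows "g \<in> L2_space \<Omega>"
proof -
  have g: "g \<in> borel_measurable (lebesgue_on \<Omega>)"
    using assms(2) by (intro borel_measurable_lebesgue_on_AE[OF assms(1) _ assms(3)]) (simp add: L2_space_def)
  have "integrable (lebesgue_on \<Omega>) (\<lambda>x. (g x)\<^sup>2)"
  proof (rule integrable_cong_AE_imp)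
    show "integrable (lebesgue_on \<Omega>) (\<lambda>x. (f x)\<^sup>2)" using assms(2) by (simp add: L2_space_def)
    show "(\<lambda>x. (g x)\<^sup>2) \<in> borel_measurable (lebesgue_on \<Omega>)" using g by simp
    show "AE x in lebesgue_on \<Omega>. (f x)\<^sup>2 = (g x)\<^sup>2" using assms(3) by eventually_elim simp
  qed
  with g show ?thesis by (simp add: L2_space_def)
qed

lemma L2_inner_cong_AE:
  assumes "\<Omega> \<in> sets lebesgue" "f \<in> L2_space \<Omega>" "g \<in> L2_space \<Omega>"
    "AE x in lebesgue_on \<Omega>. f x = f' x" "AE x in lebesgue_on \<Omega>. g x = g' x"
  shows "L2_inner \<Omega> f g = L2_inner \<Omega> f' g'"
proof -
  have "f' \<in> L2_space \<Omega>" "g' \<in> L2_space \<Omega>" using L2_space_AE[OF assms(1,2,4)] L2_space_AE[OF assms(1,3,5)] by simp_all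
  moreover have "AE x in lebesgue_on \<Omega>. f x * g x = f' x * g' x" using assms(4,5) by eventually_elim simp
  ultimately show ?thesis unfolding L2_inner_def using assms(2,3)
    by (intro integral_cong_AE) (auto simp: L2_space_def)
qed

lemma L2_inner_diff_right:
  assumes "f \<in> L2_space \<Omega>" "g \<in> L2_space \<Omega>" "h \<in> L2_space \<Omega>"
  shows "L2_inner \<Omega> h (\<lambda>x. f x - g x) = L2_inner \<Omega> h f - L2_inner \<Omega> h g"
  unfolding L2_inner_def using assms by (simp add: right_diff_distrib L2_mult_integrable)

lemma L2_inner_self_nonneg: "0 \<le> L2_inner \<Omega> f f"
  unfolding L2_inner_def by simp

lemma L2_norm_power2: "(L2_norm \<Omega> f)\<^sup>2 = L2_inner \<Omega> f f"
  by (simp add: L2_norm_def L2_inner_self_nonneg)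

lemma L2_norm_nonneg: "0 \<le> L2_norm \<Omega> f"
  by (simp add: L2_norm_def L2_inner_self_nonneg)

lemma L2_Cauchy_Schwarz:
  assumes "f \<in> L2_space \<Omega>" "g \<in> L2_space \<Omega>"
  shows "\<bar>L2_inner \<Omega> f g\<bar> \<le> L2_norm \<Omega> f * L2_norm \<Omega> g"
proof -
  let ?A = "L2_inner \<Omega> f f" and ?B = "L2_inner \<Omega> f g" and ?C = "L2_inner \<Omega> g g"
  have quad: "0 \<le> ?A * s\<^sup>2 + 2 * s * r * ?B + ?C * r\<^sup>2" for s r
  proof -
    have "0 \<le> (LINT x|lebesgue_on \<Omega>. (s * f x + r * g x)\<^sup>2)" by simp
    also have "\<dots> = (LINT x|lebesgue_on \<Omega>. s\<^sup>2 * (f x * f x) + 2 * s * r * (f x * g x) + r\<^sup>2 * (g x * g x))"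
      by (intro Bochner_Integration.integral_cong refl) (simp add: power2_eq_square algebra_simps)
    also have "\<dots> = s\<^sup>2 * ?A + 2 * s * r * ?B + r\<^sup>2 * ?C"
      unfolding L2_inner_def using assms by (simp add: L2_mult_integrable)
    finally show ?thesis by (simp add: mult.commute)
  qed
  have "?B\<^sup>2 \<le> ?A * ?C"
  proof (cases "?A = 0")
    case True
    have "?B = 0"
    proof (rule ccontr)
      assume B: "?B \<noteq> 0"
      have "0 \<le> 2 * (- (?C + 1) / (2 * ?B)) * ?B + ?C" using quad[of "- (?C + 1) / (2 * ?B)" 1] True by simp
      then show False using B by (simp add: field_simps)
    qed
    then show ?thesis using True by simp
  next
    case False
    then have "0 < ?A" using L2_inner_self_nonneg[of \<Omega> f] by simp
    moreover have "0 \<le> ?A * (?A * ?C - ?B\<^sup>2)" using quad[of "- ?B" ?A] by (simp add: power2_eq_square algebra_simps)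
    ultimately show ?thesis by (simp add: zero_le_mult_iff)
  qed
  then have "\<bar>?B\<bar> \<le> sqrt (?A * ?C)" by (metis real_sqrt_abs real_sqrt_le_iff)
  then show ?thesis by (simp add: L2_norm_def real_sqrt_mult)
qed

lemma L2_norm_triangle:
  assumes "f \<in> L2_space \<Omega>" "g \<in> L2_space \<Omega>"
  shows "L2_norm \<Omega> (\<lambda>x. f x + g x) \<le> L2_norm \<Omega> f + L2_norm \<Omega> g"
proof (rule power2_le_imp_le)
  have "(L2_norm \<Omega> (\<lambda>x. f x + g x))\<^sup>2 = L2_inner \<Omega> f f + 2 * L2_inner \<Omega> f g + L2_inner \<Omega> g g"
  proof -
    have "L2_inner \<Omega> (\<lambda>x. f x + g x) (\<lambda>x. f x + g x) = (LINT x|lebesgue_on \<Omega>. f x * f x + 2 * (f x * g x) + g x * g x)"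
      unfolding L2_inner_def by (intro Bochner_Integration.integral_cong refl) (simp add: algebra_simps)
    also have "\<dots> = L2_inner \<Omega> f f + 2 * L2_inner \<Omega> f g + L2_inner \<Omega> g g"
      unfolding L2_inner_def using assms by (simp add: L2_mult_integrable)
    finally show ?thesis by (simp add: L2_norm_power2)
  qed
  also have "\<dots> \<le> (L2_norm \<Omega> f + L2_norm \<Omega> g)\<^sup>2"
    using L2_Cauchy_Schwarz[OF assms] by (simp add: power2_sum L2_norm_power2)
  finally show "(L2_norm \<Omega> (\<lambda>x. f x + g x))\<^sup>2 \<le> (L2_norm \<Omega> f + L2_norm \<Omega> g)\<^sup>2" .
qed (simp add: L2_norm_nonneg)

lemma L2_norm_cong_AE:
  assumes "\<Omega> \<in> sets lebesgue" "f \<in> L2_space \<Omega>" "AE x in lebesgue_on \<Omega>. f x = g x"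
  shows "L2_norm \<Omega> f = L2_norm \<Omega> g"
  unfolding L2_norm_def using L2_inner_cong_AE[OF assms(1,2,2,3,3)] by simp

section \<open>Test functions and uniqueness of weak derivatives\<close>

lemma smoothD:
  assumes "smooth g" "set bs \<subseteq> Basis"
  shows "continuous_on UNIV (partials bs g)"
    and "b \<in> Basis \<Longrightarrow> (\<lambda>h::real. partials bs g (x + h *\<^sub>R b)) differentiable (at 0)"
  using assms by (auto simp: smooth_def)

lemma test_function_partials:
  assumes \<psi>: "\<psi> \<in> test_functions \<Omega>" and b: "b \<in> Basis"
  shows "partials [b] \<psi> \<in> test_functions \<Omega>"
proof -
  have "smooth \<psi>" using \<psi> by (simp add: test_functions_def)
  have "partials bs (partials [b] \<psi>) = partials (bs @ [b]) \<psi>" for bs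
    by (simp add: partials_def)
  then have "smooth (partials [b] \<psi>)"
    using \<open>smooth \<psi>\<close> b unfolding smooth_def by simp
  moreover have sub: "{x. partials [b] \<psi> x \<noteq> 0} \<subseteq> closure {x. \<psi> x \<noteq> 0}"
  proof (rule subsetI, rule ccontr)
    fix x assume x: "x \<in> {x. partials [b] \<psi> x \<noteq> 0}" "x \<notin> closure {x. \<psi> x \<noteq> 0}"
    have o: "open (- closure {x. \<psi> x \<noteq> 0})" by (intro open_Compl closed_closure)
    have c: "((\<lambda>h. x + h *\<^sub>R b) \<longlongrightarrow> x + 0 *\<^sub>R b) (nhds 0)"
      by (intro tendsto_add tendsto_scaleR tendsto_const filterlim_ident)
    have "\<forall>\<^sub>F h in nhds 0. x + h *\<^sub>R b \<in> - closure {x. \<psi> x \<noteq> 0}"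
      by (rule topological_tendstoD[OF c o]) (use x in simp)
    then have "\<forall>\<^sub>F h in nhds 0. \<psi> (x + h *\<^sub>R b) = 0"
    proof eventually_elim
      case (elim h)
      then show ?case using subsetD[OF closure_subset, of "x + h *\<^sub>R b" "{x. \<psi> x \<noteq> 0}"] by auto
    qed
    then have "deriv (\<lambda>h. \<psi> (x + h *\<^sub>R b)) 0 = deriv (\<lambda>h. 0) 0"
      by (intro deriv_cong_ev) auto
    then show False using x by (simp add: partials_def dir_deriv_def)
  qed
  then have sub': "closure {x. partials [b] \<psi> x \<noteq> 0} \<subseteq> closure {x. \<psi> x \<noteq> 0}"
    by (rule closure_minimal) simp
  moreover have "compact (closure {x. partials [b] \<psi> x \<noteq> 0})"
    using compact_Int_closed[OF _ closed_closure, of "closure {x. \<psi> x \<noteq> 0}" "{x. partials [b] \<psi> x \<noteq> 0}"] sub' \<psi>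
    by (simp add: test_functions_def inf_absorb2)
  moreover have "closure {x. partials [b] \<psi> x \<noteq> 0} \<subseteq> \<Omega>"
    using sub' \<psi> unfolding test_functions_def by (blast intro: order_trans)
  ultimately show ?thesis unfolding test_functions_def by simp
qed

lemma test_function_continuous: "\<psi> \<in> test_functions \<Omega> \<Longrightarrow> continuous_on UNIV \<psi>"
  using smoothD(1)[of \<psi> "[]"] by (simp add: test_functions_def partials_def)

lemma test_function_DERIV:
  assumes "\<psi> \<in> test_functions \<Omega>" "b \<in> Basis"
  shows "((\<lambda>h. \<psi> (x + h *\<^sub>R b)) has_real_derivative partials [b] \<psi> (x + s *\<^sub>R b)) (at s)"
proof -
  have "(\<lambda>h. \<psi> ((x + s *\<^sub>R b) + h *\<^sub>R b)) differentiable (at 0)"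
    using smoothD(2)[of \<psi> "[]" b "x + s *\<^sub>R b"] assms by (simp add: test_functions_def partials_def)
  then have "((\<lambda>h. \<psi> ((x + s *\<^sub>R b) + h *\<^sub>R b)) has_real_derivative partials [b] \<psi> (x + s *\<^sub>R b)) (at 0)"
    by (simp add: partials_def dir_deriv_def DERIV_deriv_iff_real_differentiable)
  then have "((\<lambda>h. \<psi> (x + (h + s) *\<^sub>R b)) has_real_derivative partials [b] \<psi> (x + s *\<^sub>R b)) (at 0)"
    by (simp add: algebra_simps)
  then show ?thesis
    using DERIV_shift[of "\<lambda>h. \<psi> (x + h *\<^sub>R b)" "partials [b] \<psi> (x + s *\<^sub>R b)" 0 s] by simp
qed

lemma test_function_bound:
  assumes "\<psi> \<in> test_functions \<Omega>"
  obtains K B where "compact K" "K \<subseteq> \<Omega>" "\<And>x. x \<notin> K \<Longrightarrow> \<psi> x = 0" "\<And>x. \<bar>\<psi> x\<bar> \<le> B" "0 \<le> B"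
proof -
  let ?K = "closure {x. \<psi> x \<noteq> 0}"
  have K: "compact ?K" "?K \<subseteq> \<Omega>" using assms by (auto simp: test_functions_def)
  have "compact (\<psi> ` ?K)"
    by (rule compact_continuous_image[OF continuous_on_subset[OF test_function_continuous[OF assms]] K(1)]) simp
  then have "bounded (\<psi> ` ?K)" by (rule compact_imp_bounded)
  then obtain B where B: "\<And>x. x \<in> ?K \<Longrightarrow> \<bar>\<psi> x\<bar> \<le> B" unfolding bounded_iff by auto
  have z: "\<psi> x = 0" if "x \<notin> ?K" for x
    using that subsetD[OF closure_subset, of x "{x. \<psi> x \<noteq> 0}"] by auto
  have bd: "\<bar>\<psi> x\<bar> \<le> max B 0" for x
    using B[of x] z[of x] by (cases "x \<in> ?K") (simp_all add: le_max_iff_disj)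
  show thesis by (rule that[OF K z bd]) simp_all
qed

lemma locally_integrable_mult_test:
  assumes \<Omega>: "open \<Omega>" and h: "locally_integrable \<Omega> h" and \<psi>: "\<psi> \<in> test_functions \<Omega>"
  shows "integrable (lebesgue_on \<Omega>) (\<lambda>x. h x * \<psi> x)"
proof -
  obtain K B where K: "compact K" "K \<subseteq> \<Omega>" "\<And>x. x \<notin> K \<Longrightarrow> \<psi> x = 0" and B: "\<And>x. \<bar>\<psi> x\<bar> \<le> B" "0 \<le> B"
    using test_function_bound[OF \<psi>] by metis
  have \<Omega>s: "\<Omega> \<in> sets lebesgue" "K \<in> sets lebesgue" using \<Omega> K by (auto simp: compact_imp_closed)
  have "integrable (lebesgue_on K) h" using h K by (simp add: locally_integrable_def)
  then have hK: "integrable lebesgue (\<lambda>x. indicator K x * h x)"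
    using \<Omega>s by (subst (asm) integrable_restrict_space) auto
  have "integrable lebesgue (\<lambda>x. (indicator K x * h x) * \<psi> x)"
  proof (rule Bochner_Integration.integrable_bound)
    show "integrable lebesgue (\<lambda>x. (indicator K x * h x) * B)" using hK by simp
    have "\<psi> \<in> borel_measurable lebesgue"
      using test_function_continuous[OF \<psi>] by (intro measurable_completion) (simp add: borel_measurable_continuous_onI)
    then show "(\<lambda>x. (indicator K x * h x) * \<psi> x) \<in> borel_measurable lebesgue"
      by (rule borel_measurable_times[OF borel_measurable_integrable[OF hK]])
    show "AE x in lebesgue. norm ((indicator K x * h x) * \<psi> x) \<le> norm ((indicator K x * h x) * B)"
      using B by (auto simp: abs_mult intro!: mult_left_mono)
  qed
  also have "(\<lambda>x. (indicator K x * h x) * \<psi> x) = (\<lambda>x. indicator \<Omega> x *\<^sub>R (h x * \<psi> x))"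
    using K by (auto simp: indicator_def fun_eq_iff)
  finally show ?thesis using \<Omega>s by (subst integrable_restrict_space) auto
qed

lemma L2_space_locally_integrable:
  assumes \<Omega>: "open \<Omega>" and g: "g \<in> L2_space \<Omega>"
  shows "locally_integrable \<Omega> g"
  unfolding locally_integrable_def
proof (intro allI impI)
  fix K assume K: "compact K \<and> K \<subseteq> \<Omega>"
  have s: "\<Omega> \<in> sets lebesgue" "K \<in> sets lebesgue" using \<Omega> K by (auto simp: compact_imp_closed)
  have K\<Omega>: "K \<in> sets (lebesgue_on \<Omega>)" using s K by (auto simp: sets_restrict_space image_iff intro!: bexI[of _ K])
  have "integrable (lebesgue_on \<Omega>) (\<lambda>x. indicator K x * g x)"
  proof (rule Bochner_Integration.integrable_bound)
    have "emeasure (lebesgue_on \<Omega>) K < \<infinity>"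
      using K s fmeasurableD2[OF lmeasurable_compact, of K]
      by (subst emeasure_restrict_space) (auto simp: less_top)
    then show "integrable (lebesgue_on \<Omega>) (\<lambda>x. indicator K x + (g x)\<^sup>2)"
      using g K\<Omega> by (auto simp: L2_space_def)
    show "(\<lambda>x. indicator K x * g x) \<in> borel_measurable (lebesgue_on \<Omega>)"
      using g K\<Omega> by (auto simp: L2_space_def)
    have "\<bar>a\<bar> \<le> 1 + a\<^sup>2" for a :: real
      using zero_le_power2[of "a - 1"] zero_le_power2[of "a + 1"] by (simp add: power2_eq_square algebra_simps abs_le_iff)
    then show "AE x in lebesgue_on \<Omega>. norm (indicator K x * g x) \<le> norm (indicator K x + (g x)\<^sup>2)"
      by (auto simp: indicator_def)
  qed
  then have "integrable lebesgue (\<lambda>x. indicator \<Omega> x *\<^sub>R (indicator K x * g x))"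
    using s by (subst (asm) integrable_restrict_space) auto
  also have "(\<lambda>x. indicator \<Omega> x *\<^sub>R (indicator K x * g x)) = (\<lambda>x. indicator K x *\<^sub>R g x)"
    using K by (auto simp: indicator_def fun_eq_iff)
  finally show "integrable (lebesgue_on K) g" using s by (subst integrable_restrict_space) auto
qed

text \<open>The fundamental lemma of the calculus of variations. Testing with
  \<open>box_bump\<close> and dominated convergence give integral 0 over each open box whose closed
  box lies in \<open>\<Omega>\<close>. As \<open>h\<close> is only locally integrable, the
  conclusion is drawn on single closed boxes, countably many of which cover
  \<open>\<Omega>\<close>.\<close>

lemma weakly_zero_imp_AE_zero:
  assumes \<Omega>: "open \<Omega>" and h: "locally_integrable \<Omega> h"
    and zero: "\<And>\<psi>. \<psi> \<in> test_functions \<Omega> \<Longrightarrow> (LINT x|lebesgue_on \<Omega>. h x * \<psi> x) = 0"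
  shows "AE x in lebesgue_on \<Omega>. h x = 0"
proof -
  have \<Omega>s: "\<Omega> \<in> sets lebesgue" using \<Omega> by simp
  have hi: "integrable lebesgue (\<lambda>x. indicator (cbox a b) x * h x)" if "cbox a b \<subseteq> \<Omega>" for a b
  proof -
    have "integrable (lebesgue_on (cbox a b)) h" using h that by (simp add: locally_integrable_def)
    then show ?thesis by (subst (asm) integrable_restrict_space) simp_all
  qed
  have hi': "integrable lebesgue (\<lambda>x. indicator (box a b) x * h x)" if "cbox a b \<subseteq> \<Omega>" for a b
  proof -
    have "integrable lebesgue (\<lambda>x. indicator (box a b) x *\<^sub>R (indicator (cbox a b) x * h x))"
      by (rule integrable_mult_indicator[OF _ hi[OF that]]) simp
    moreover have "(\<lambda>x. indicator (box a b) x *\<^sub>R (indicator (cbox a b) x * h x)) = (\<lambda>x. indicator (box a b) x * h x)"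
      using box_subset_cbox[of a b] by (auto simp: indicator_def fun_eq_iff)
    ultimately show ?thesis by simp
  qed
  have box0: "(\<integral>x. indicator (box a b) x * h x \<partial>lebesgue) = 0" if sub: "cbox a b \<subseteq> \<Omega>" for a b
  proof -
    have "(\<lambda>n. \<integral>x. indicator (cbox a b) x * h x * box_bump a b n x \<partial>lebesgue)
       \<longlonglongrightarrow> (\<integral>x. indicator (cbox a b) x * h x * indicator (box a b) x \<partial>lebesgue)"
    proof (rule integral_dominated_convergence[where w = "\<lambda>x. norm (indicator (cbox a b) x * h x)"])
      have m: "(\<lambda>x. indicator (cbox a b) x * h x) \<in> borel_measurable lebesgue"
        by (rule borel_measurable_integrable[OF hi[OF sub]])
      show "(\<lambda>x. indicator (cbox a b) x * h x * indicator (box a b) x) \<in> borel_measurable lebesgue"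
        by (rule borel_measurable_times[OF m borel_measurable_indicator]) simp
      show "(\<lambda>x. indicator (cbox a b) x * h x * box_bump a b n x) \<in> borel_measurable lebesgue" for n
        by (rule borel_measurable_times[OF m], rule measurable_completion)
          (simp add: borel_measurable_continuous_onI[OF test_function_continuous[OF box_bump_test_function[OF sub]]])
      show "integrable lebesgue (\<lambda>x. norm (indicator (cbox a b) x * h x))" using hi[OF sub] by (rule integrable_norm)
      show "AE x in lebesgue. (\<lambda>n. indicator (cbox a b) x * h x * box_bump a b n x) \<longlonglongrightarrow> indicator (cbox a b) x * h x * indicator (box a b) x"
        by (intro AE_I2 tendsto_mult_left box_bump_limit)
      show "AE x in lebesgue. norm (indicator (cbox a b) x * h x * box_bump a b n x) \<le> norm (indicator (cbox a b) x * h x)" for n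
      proof (rule AE_I2)
        fix x
        let ?X = "indicator (cbox a b) x * h x" and ?y = "box_bump a b n x"
        have "norm (?X * ?y) = norm ?X * ?y"
          unfolding norm_mult[of ?X ?y] using box_bump_bounds(1)[of a b n x] by (simp only: real_norm_def abs_of_nonneg)
        also have "\<dots> \<le> norm ?X" by (rule mult_left_le[OF box_bump_bounds(2) norm_ge_zero])
        finally show "norm (?X * ?y) \<le> norm ?X" .
      qed
    qed
    moreover have "(\<integral>x. indicator (cbox a b) x * h x * box_bump a b n x \<partial>lebesgue) = 0" for n
    proof -
      have "(\<integral>x. indicator (cbox a b) x * h x * box_bump a b n x \<partial>lebesgue)
        = (\<integral>x. indicator \<Omega> x *\<^sub>R (h x * box_bump a b n x) \<partial>lebesgue)"
        using sub box_bump_eq_0[of _ a b n] box_subset_cbox[of a b]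
        by (intro Bochner_Integration.integral_cong refl) (auto simp: indicator_def)
      also have "\<dots> = (LINT x|lebesgue_on \<Omega>. h x * box_bump a b n x)"
        using \<Omega>s by (subst integral_restrict_space) simp_all
      also have "\<dots> = 0" by (rule zero[OF box_bump_test_function[OF sub]])
      finally show ?thesis .
    qed
    ultimately have "(\<integral>x. indicator (cbox a b) x * h x * indicator (box a b) x \<partial>lebesgue) = 0"
      by (simp add: LIMSEQ_const_iff)
    moreover have "(\<lambda>x. indicator (cbox a b) x * h x * indicator (box a b) x) = (\<lambda>x. indicator (box a b) x * h x)"
      using box_subset_cbox[of a b] by (auto simp: indicator_def fun_eq_iff)
    ultimately show ?thesis by simp
  qed
  have AEbox: "AE x in lebesgue. x \<in> cbox a b \<longrightarrow> h x = 0" if sub: "cbox a b \<subseteq> \<Omega>" for a b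
  proof -
    have "AE x in lebesgue. indicator (box a b) x * h x = 0"
    proof (rule integral_boxes_zero_imp_AE_zero[OF hi'[OF sub]])
      show "x \<in> box a b" if "indicator (box a b) x * h x \<noteq> 0" for x using that by (auto simp: indicator_def)
      fix c d
      obtain p q where pq: "box c d \<inter> box a b = box p q" using box_Int_box by blast
      have "(LINT x:box c d|lebesgue. indicator (box a b) x * h x) = (\<integral>x. indicator (box p q) x * h x \<partial>lebesgue)"
        unfolding set_lebesgue_integral_def pq[symmetric]
        by (intro Bochner_Integration.integral_cong refl) (auto simp: indicator_def)
      also have "\<dots> = 0"
      \<comment> \<open>For an empty open box the closed box with the same corners may be nonempty
        and need not lie in \<open>\<Omega>\<close>, but the integral is trivially 0.\<close>
      proof (cases "box p q = {}")
        case False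
        then have "cbox p q = closure (box p q)" by (simp add: closure_box)
        also have "\<dots> \<subseteq> cbox a b" using pq box_subset_cbox[of a b] by (intro closure_minimal closed_cbox) blast
        finally show ?thesis using sub by (intro box0) simp
      qed simp
      finally show "(LINT x:box c d|lebesgue. indicator (box a b) x * h x) = 0" .
    qed
    moreover have "AE x in lebesgue. x \<notin> cbox a b - box a b"
      using negligible_frontier_interval[of a b] by (intro AE_not_in) (simp add: negligible_iff_null_sets)
    ultimately show ?thesis by eventually_elim (auto simp: indicator_def)
  qed
  obtain \<D> where D: "countable \<D>" "\<D> \<subseteq> Pow \<Omega>" "\<And>X. X \<in> \<D> \<Longrightarrow> \<exists>a b. X = cbox a b" "\<Union>\<D> = \<Omega>"
    using open_countable_Union_open_cbox[OF \<Omega>] by metis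
  have "AE x in lebesgue. \<forall>X\<in>\<D>. x \<in> X \<longrightarrow> h x = 0"
    unfolding AE_ball_countable[OF D(1)]
  proof
    fix X assume X: "X \<in> \<D>"
    then obtain a b where "X = cbox a b" using D(3) by blast
    then show "AE x in lebesgue. x \<in> X \<longrightarrow> h x = 0" using AEbox[of a b] X D(2) by blast
  qed
  then have "AE x in lebesgue. x \<in> \<Omega> \<longrightarrow> h x = 0"
    by eventually_elim (use D(4) in blast)
  then show ?thesis using \<Omega>s by (subst AE_restrict_space_iff) simp_all
qed

lemma locally_integrable_diff:
  "locally_integrable \<Omega> f \<Longrightarrow> locally_integrable \<Omega> g \<Longrightarrow> locally_integrable \<Omega> (\<lambda>x. f x - g x)"
  by (simp add: locally_integrable_def)

lemma locally_integrable_sum: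
  "(\<And>i. i \<in> A \<Longrightarrow> locally_integrable \<Omega> (f i)) \<Longrightarrow> locally_integrable \<Omega> (\<lambda>x. \<Sum>i\<in>A. f i x)"
  by (simp add: locally_integrable_def)

lemma weakly_equal_imp_AE_equal:
  assumes \<Omega>: "open \<Omega>" and h: "locally_integrable \<Omega> h" "locally_integrable \<Omega> h'"
    and eq: "\<And>\<psi>. \<psi> \<in> test_functions \<Omega> \<Longrightarrow> (LINT x|lebesgue_on \<Omega>. h x * \<psi> x) = (LINT x|lebesgue_on \<Omega>. h' x * \<psi> x)"
  shows "AE x in lebesgue_on \<Omega>. h x = h' x"
proof -
  have "AE x in lebesgue_on \<Omega>. h x - h' x = 0"
  proof (rule weakly_zero_imp_AE_zero[OF \<Omega> locally_integrable_diff[OF h]])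
    fix \<psi> assume \<psi>: "\<psi> \<in> test_functions \<Omega>"
    show "(LINT x|lebesgue_on \<Omega>. (h x - h' x) * \<psi> x) = 0"
      using eq[OF \<psi>] locally_integrable_mult_test[OF \<Omega> h(1) \<psi>] locally_integrable_mult_test[OF \<Omega> h(2) \<psi>]
      by (simp add: left_diff_distrib)
  qed
  then show ?thesis by simp
qed

lemma weak_deriv_AE:
  assumes "open \<Omega>" "has_weak_deriv \<Omega> bs g h"
  shows "AE x in lebesgue_on \<Omega>. h x = weak_deriv \<Omega> bs g x"
proof -
  have "has_weak_deriv \<Omega> bs g (weak_deriv \<Omega> bs g)"
    unfolding weak_deriv_def by (rule someI[of _ h]) (rule assms)
  with assms(2) show ?thesis
    by (intro weakly_equal_imp_AE_equal[OF assms(1)]) (auto simp: has_weak_deriv_def)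
qed

lemma weak_laplacian_AE:
  assumes "open \<Omega>" "has_weak_laplacian \<Omega> g h"
  shows "AE x in lebesgue_on \<Omega>. h x = weak_laplacian \<Omega> g x"
proof -
  have "has_weak_laplacian \<Omega> g (weak_laplacian \<Omega> g)"
    unfolding weak_laplacian_def by (rule someI[of _ h]) (rule assms)
  with assms(2) show ?thesis
    by (intro weakly_equal_imp_AE_equal[OF assms(1)]) (auto simp: has_weak_laplacian_def)
qed

text \<open>The integral of a difference quotient vanishes by translation invariance.\<close>

lemma integral_directional_derivative_eq_0:
  fixes g D :: "'a::euclidean_space \<Rightarrow> real"
  assumes K: "compact K" and supp: "\<And>x. x \<notin> K \<Longrightarrow> g x = 0"
    and cont: "continuous_on UNIV g" and Dcont: "continuous_on UNIV D" and B: "\<And>x. \<bar>D x\<bar> \<le> B"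
    and deriv: "\<And>x s. ((\<lambda>h. g (x + h *\<^sub>R b)) has_real_derivative D (x + s *\<^sub>R b)) (at s)"
  shows "(\<integral>x. D x \<partial>lborel) = 0"
proof -
  define q where "q n x = real (Suc n) * (g (x + (1 / real (Suc n)) *\<^sub>R b) - g x)" for n x
  \<comment> \<open>A compact set outside of which all difference quotients vanish: the shifts
    \<open>b / (n + 1)\<close> lie on the segment from 0 to \<open>b\<close>. On it the mean value
    theorem gives the bound \<open>B\<close>, which yields the dominating function.\<close>
  define K' where "K' = K \<union> {x - y |x y. x \<in> K \<and> y \<in> closed_segment 0 b}"
  have K': "compact K'"
    unfolding K'_def by (intro compact_Un K compact_differences compact_segment)
  have gm [measurable]: "g \<in> borel_measurable borel" using cont by (rule borel_measurable_continuous_onI)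
  have Dm [measurable]: "D \<in> borel_measurable borel" using Dcont by (rule borel_measurable_continuous_onI)
  have gi: "integrable lborel g"
  proof -
    have "integrable lborel (\<lambda>x. indicator K x *\<^sub>R g x)"
      by (rule borel_integrable_compact[OF K]) (rule continuous_on_subset[OF cont], simp)
    moreover have "(\<lambda>x. indicator K x *\<^sub>R g x) = g" using supp by (auto simp: indicator_def fun_eq_iff)
    ultimately show ?thesis by simp
  qed
  have shift: "integrable lborel (\<lambda>x. g (x + c))" "(\<integral>x. g (x + c) \<partial>lborel) = (\<integral>x. g x \<partial>lborel)" for c
  proof -
    have d: "distr lborel borel ((+) c) = lborel" by (rule lborel_distr_plus)
    show "integrable lborel (\<lambda>x. g (x + c))"
      using gi integrable_distr_eq[of "(+) c" lborel borel g] unfolding d by (simp add: add.commute)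
    show "(\<integral>x. g (x + c) \<partial>lborel) = (\<integral>x. g x \<partial>lborel)"
      using integral_distr[of "(+) c" lborel borel g] unfolding d by (simp add: add.commute)
  qed
  have q0: "(\<integral>x. q n x \<partial>lborel) = 0" for n
    unfolding q_def using shift[of "(1 / real (Suc n)) *\<^sub>R b"] gi by simp
  have B0: "0 \<le> B" using B[of 0] by linarith
  have "(\<lambda>n. \<integral>x. q n x \<partial>lborel) \<longlonglongrightarrow> (\<integral>x. D x \<partial>lborel)"
  proof (rule integral_dominated_convergence[where w = "\<lambda>x. B * indicator K' x"])
    have "emeasure lborel K' < \<infinity>" using K' by (rule emeasure_compact_finite)
    moreover have "K' \<in> sets borel" using K' by (simp add: borel_compact)
    ultimately show "integrable lborel (\<lambda>x. B * indicator K' x)" by (intro integrable_mult_right) simp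
    show "D \<in> borel_measurable lborel" by simp
    show "q n \<in> borel_measurable lborel" for n unfolding q_def by measurable
    show "AE x in lborel. (\<lambda>n. q n x) \<longlonglongrightarrow> D x"
    proof (rule AE_I2)
      fix x
      have "((\<lambda>h. (g (x + h *\<^sub>R b) - g x) / h) \<longlongrightarrow> D x) (at 0)"
        using deriv[of x 0] by (simp add: DERIV_def)
      moreover have "filterlim (\<lambda>n. 1 / real (Suc n)) (at 0) sequentially"
        unfolding filterlim_at using LIMSEQ_Suc[OF lim_1_over_n] by (simp del: of_nat_Suc)
      ultimately have "(\<lambda>n. (g (x + (1 / real (Suc n)) *\<^sub>R b) - g x) / (1 / real (Suc n))) \<longlonglongrightarrow> D x"
        by (rule filterlim_compose)
      then show "(\<lambda>n. q n x) \<longlonglongrightarrow> D x" unfolding q_def by (simp add: mult.commute)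
    qed
    show "AE x in lborel. norm (q n x) \<le> B * indicator K' x" for n
    proof (rule AE_I2)
      fix x
      let ?e = "1 / real (Suc n)"
      have e: "0 < ?e" "?e \<le> 1" by auto
      show "norm (q n x) \<le> B * indicator K' x"
      proof (cases "x \<in> K'")
        case True
        obtain z where z: "g (x + ?e *\<^sub>R b) - g (x + 0 *\<^sub>R b) = (?e - 0) * D (x + z *\<^sub>R b)"
          using MVT2[OF e(1), of "\<lambda>h. g (x + h *\<^sub>R b)" "\<lambda>s. D (x + s *\<^sub>R b)"] deriv by auto
        then have "q n x = D (x + z *\<^sub>R b)" unfolding q_def by simp
        then show ?thesis using True B by simp
      next
        case False
        then have "x \<notin> K" by (simp add: K'_def)
        moreover have "x + ?e *\<^sub>R b \<notin> K"
        proof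
          assume k: "x + ?e *\<^sub>R b \<in> K"
          have "?e *\<^sub>R b \<in> closed_segment 0 b" using e unfolding closed_segment_def by (auto intro!: exI[of _ ?e])
          then have "(x + ?e *\<^sub>R b) - ?e *\<^sub>R b \<in> K'" using k unfolding K'_def by blast
          then show False using False by simp
        qed
        ultimately show ?thesis using supp B0 False by (simp add: q_def)
      qed
    qed
  qed
  then show ?thesis unfolding q0 by (simp add: LIMSEQ_const_iff)
qed

text \<open>Integration by parts for two test functions: \<open>D\<close> is the directional
  derivative of their product, whose integral vanishes.\<close>

lemma test_function_has_weak_deriv:
  assumes \<Omega>: "open \<Omega>" and \<psi>: "\<psi> \<in> test_functions \<Omega>" and b: "b \<in> Basis"
  shows "has_weak_deriv \<Omega> [b] \<psi> (partials [b] \<psi>)"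
proof -
  have \<Omega>s: "\<Omega> \<in> sets lebesgue" using \<Omega> by simp
  note p\<psi> = test_function_partials[OF \<psi> b]
  have loc: "locally_integrable \<Omega> \<eta>" if \<eta>: "\<eta> \<in> test_functions \<Omega>" for \<eta>
    unfolding locally_integrable_def
  proof (intro allI impI)
    fix K assume K: "compact K \<and> K \<subseteq> \<Omega>"
    have "integrable lborel (\<lambda>x. indicator K x *\<^sub>R \<eta> x)"
      using K by (intro borel_integrable_compact continuous_on_subset[OF test_function_continuous[OF \<eta>]]) auto
    then have "integrable lebesgue (\<lambda>x. indicator K x *\<^sub>R \<eta> x)"
      using K by (subst integrable_completion) (auto intro: borel_measurable_integrable)
    then show "integrable (lebesgue_on K) \<eta>" using K by (subst integrable_restrict_space) (auto simp: compact_imp_closed)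
  qed
  have "(LINT x|lebesgue_on \<Omega>. \<psi> x * partials [b] \<eta> x) = - (LINT x|lebesgue_on \<Omega>. partials [b] \<psi> x * \<eta> x)"
    if \<eta>: "\<eta> \<in> test_functions \<Omega>" for \<eta>
  proof -
    note p\<eta> = test_function_partials[OF \<eta> b]
    obtain K B where K: "compact K" "K \<subseteq> \<Omega>" "\<And>x. x \<notin> K \<Longrightarrow> \<psi> x = 0" and B: "\<And>x. \<bar>\<psi> x\<bar> \<le> B" "0 \<le> B"
      using test_function_bound[OF \<psi>] by metis
    obtain K1 B1 where K1: "K1 \<subseteq> \<Omega>" "\<And>x. x \<notin> K1 \<Longrightarrow> partials [b] \<psi> x = 0" and B1: "\<And>x. \<bar>partials [b] \<psi> x\<bar> \<le> B1" "0 \<le> B1"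
      using test_function_bound[OF p\<psi>] by metis
    obtain K2 B2 where B2: "\<And>x. \<bar>\<eta> x\<bar> \<le> B2" "0 \<le> B2"
      using test_function_bound[OF \<eta>] by metis
    obtain K3 B3 where B3: "\<And>x. \<bar>partials [b] \<eta> x\<bar> \<le> B3" "0 \<le> B3"
      using test_function_bound[OF p\<eta>] by metis
    define D where "D x = partials [b] \<psi> x * \<eta> x + \<psi> x * partials [b] \<eta> x" for x
    have Dc: "continuous_on UNIV D"
      unfolding D_def by (intro continuous_on_add continuous_on_mult test_function_continuous[OF \<psi>]
        test_function_continuous[OF \<eta>] test_function_continuous[OF p\<psi>] test_function_continuous[OF p\<eta>])
    have "(\<integral>x. D x \<partial>lborel) = 0"
    proof (rule integral_directional_derivative_eq_0[where g = "\<lambda>x. \<psi> x * \<eta> x" and K = K and b = b and B = "B1 * B2 + B * B3"])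
      show "continuous_on UNIV (\<lambda>x. \<psi> x * \<eta> x)"
        by (intro continuous_on_mult test_function_continuous[OF \<psi>] test_function_continuous[OF \<eta>])
      show "\<bar>D x\<bar> \<le> B1 * B2 + B * B3" for x
      proof -
        have "\<bar>D x\<bar> \<le> \<bar>partials [b] \<psi> x\<bar> * \<bar>\<eta> x\<bar> + \<bar>\<psi> x\<bar> * \<bar>partials [b] \<eta> x\<bar>"
          unfolding D_def abs_mult[symmetric] by (rule abs_triangle_ineq)
        also have "\<dots> \<le> B1 * B2 + B * B3" using B B1 B2 B3 by (intro add_mono mult_mono) auto
        finally show ?thesis .
      qed
      show "((\<lambda>h. \<psi> (x + h *\<^sub>R b) * \<eta> (x + h *\<^sub>R b)) has_real_derivative D (x + s *\<^sub>R b)) (at s)" for x s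
        using DERIV_mult[OF test_function_DERIV[OF \<psi> b, of x s] test_function_DERIV[OF \<eta> b, of x s]]
        by (simp add: D_def mult.commute)
    qed (use K Dc in auto)
    moreover have "(\<integral>x. D x \<partial>lborel) = (LINT x|lebesgue_on \<Omega>. D x)"
    proof -
      have "(LINT x|lebesgue_on \<Omega>. D x) = (\<integral>x. indicator \<Omega> x *\<^sub>R D x \<partial>lebesgue)"
        using \<Omega>s by (subst integral_restrict_space) simp_all
      also have "(\<lambda>x. indicator \<Omega> x *\<^sub>R D x) = D"
      proof
        fix x
        have "D x = 0" if "x \<notin> \<Omega>"
        proof -
          have "x \<notin> K" "x \<notin> K1" using that K(2) K1(1) by auto
          then show ?thesis using K(3) K1(2) by (simp add: D_def)
        qed
        then show "indicator \<Omega> x *\<^sub>R D x = D x" by (auto simp: indicator_def)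
      qed
      also have "(\<integral>x. D x \<partial>lebesgue) = (\<integral>x. D x \<partial>lborel)"
        by (rule integral_completion) (simp add: borel_measurable_continuous_onI[OF Dc])
      finally show ?thesis by simp
    qed
    moreover have "(LINT x|lebesgue_on \<Omega>. D x) = (LINT x|lebesgue_on \<Omega>. partials [b] \<psi> x * \<eta> x) + (LINT x|lebesgue_on \<Omega>. \<psi> x * partials [b] \<eta> x)"
      unfolding D_def by (intro Bochner_Integration.integral_add locally_integrable_mult_test[OF \<Omega>] loc \<psi> \<eta> p\<psi> p\<eta>)
    ultimately show ?thesis by simp
  qed
  then show ?thesis using loc[OF \<psi>] loc[OF p\<psi>] by (simp add: has_weak_deriv_def)
qed

section \<open>Sobolev functions and Green's identity\<close>

lemma has_weak_deriv_diff:
  assumes \<Omega>: "open \<Omega>" and "set bs \<subseteq> Basis" "has_weak_deriv \<Omega> bs f f'" "has_weak_deriv \<Omega> bs g g'"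
  shows "has_weak_deriv \<Omega> bs (\<lambda>x. f x - g x) (\<lambda>x. f' x - g' x)"
proof -
  have tp: "partials bs \<psi> \<in> test_functions \<Omega>" if "\<psi> \<in> test_functions \<Omega>" for \<psi>
    using assms(2)
  proof (induction bs)
    case Nil
    then show ?case using that by (simp add: partials_def)
  next
    case (Cons b bs)
    then show ?case using test_function_partials[of "partials bs \<psi>" \<Omega> b] by (simp add: partials_def)
  qed
  show ?thesis
    using assms locally_integrable_mult_test[OF \<Omega>] tp
    by (simp add: has_weak_deriv_def left_diff_distrib right_diff_distrib locally_integrable_diff)
qed

lemma has_weak_laplacian_sobolev:
  assumes \<Omega>: "open \<Omega>" and l: "\<And>b. b \<in> Basis \<Longrightarrow> has_weak_deriv \<Omega> [b, b] v (l b)"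
  shows "has_weak_laplacian \<Omega> v (\<lambda>x. \<Sum>b\<in>Basis. l b x)"
proof -
  have v: "locally_integrable \<Omega> v" using l[OF SOME_Basis] by (simp add: has_weak_deriv_def)
  have lb: "locally_integrable \<Omega> (l b)" if "b \<in> Basis" for b using l[OF that] by (simp add: has_weak_deriv_def)
  have "(LINT x|lebesgue_on \<Omega>. v x * (\<Sum>b\<in>Basis. partials [b, b] \<psi> x)) = (LINT x|lebesgue_on \<Omega>. (\<Sum>b\<in>Basis. l b x) * \<psi> x)"
    if \<psi>: "\<psi> \<in> test_functions \<Omega>" for \<psi>
  proof -
    have pp: "partials [b, b] \<psi> \<in> test_functions \<Omega>" if "b \<in> Basis" for b
      using test_function_partials[OF test_function_partials[OF \<psi> that] that] by (simp add: partials_def)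
    have "(LINT x|lebesgue_on \<Omega>. v x * (\<Sum>b\<in>Basis. partials [b, b] \<psi> x))
      = (\<Sum>b\<in>Basis. LINT x|lebesgue_on \<Omega>. v x * partials [b, b] \<psi> x)"
      unfolding sum_distrib_left
      by (rule Bochner_Integration.integral_sum) (rule locally_integrable_mult_test[OF \<Omega> v pp])
    also have "\<dots> = (\<Sum>b\<in>Basis. LINT x|lebesgue_on \<Omega>. l b x * \<psi> x)"
      using l \<psi> by (intro sum.cong refl) (simp add: has_weak_deriv_def)
    also have "\<dots> = (LINT x|lebesgue_on \<Omega>. (\<Sum>b\<in>Basis. l b x) * \<psi> x)"
      unfolding sum_distrib_right
      by (rule Bochner_Integration.integral_sum[symmetric]) (rule locally_integrable_mult_test[OF \<Omega> lb \<psi>])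
    finally show ?thesis .
  qed
  then show ?thesis using v lb by (simp add: has_weak_laplacian_def locally_integrable_sum)
qed

definition sobolev_deriv :: "'a::euclidean_space set \<Rightarrow> 'a \<Rightarrow> ('a \<Rightarrow> real) \<Rightarrow> 'a \<Rightarrow> real" where
  "sobolev_deriv \<Omega> b g = (SOME h. h \<in> L2_space \<Omega> \<and> has_weak_deriv \<Omega> [b] g h)"

lemma sobolev_deriv:
  assumes "g \<in> sobolev_space \<Omega> k" "1 \<le> k" "b \<in> Basis"
  shows "sobolev_deriv \<Omega> b g \<in> L2_space \<Omega>" "has_weak_deriv \<Omega> [b] g (sobolev_deriv \<Omega> b g)"
proof -
  have "\<exists>h. h \<in> L2_space \<Omega> \<and> has_weak_deriv \<Omega> [b] g h"
    using assms unfolding sobolev_space_def by (auto dest!: spec[of _ "[b]"])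
  from someI_ex[OF this] show "sobolev_deriv \<Omega> b g \<in> L2_space \<Omega>" "has_weak_deriv \<Omega> [b] g (sobolev_deriv \<Omega> b g)"
    unfolding sobolev_deriv_def by auto
qed

lemma test_function_L2:
  assumes \<Omega>: "open \<Omega>" "bounded \<Omega>" and \<psi>: "\<psi> \<in> test_functions \<Omega>"
  shows "\<psi> \<in> L2_space \<Omega>"
proof -
  obtain K B where B: "\<And>x. \<bar>\<psi> x\<bar> \<le> B" "0 \<le> B"
    using test_function_bound[OF \<psi>] by metis
  have m: "\<psi> \<in> borel_measurable (lebesgue_on \<Omega>)"
    using borel_measurable_continuous_onI[OF test_function_continuous[OF \<psi>]]
    by (intro measurable_restrict_space1 measurable_completion) simp
  have "emeasure lborel \<Omega> < \<infinity>" using \<Omega>(2) by (rule emeasure_bounded_finite)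
  then have "finite_measure (lebesgue_on \<Omega>)"
    using \<Omega>(1) by (intro finite_measureI) (simp add: emeasure_restrict_space less_top)
  then have "integrable (lebesgue_on \<Omega>) (\<lambda>x. B\<^sup>2)" by (rule finite_measure.integrable_const)
  then have "integrable (lebesgue_on \<Omega>) (\<lambda>x. (\<psi> x)\<^sup>2)"
  proof (rule Bochner_Integration.integrable_bound)
    show "AE x in lebesgue_on \<Omega>. norm ((\<psi> x)\<^sup>2) \<le> norm (B\<^sup>2)"
      using power_mono[OF B(1) abs_ge_zero, of _ 2] by simp
  qed (use m in simp)
  then show ?thesis using m by (simp add: L2_space_def)
qed

text \<open>The norm is built from chosen representatives, and uniqueness almost everywhere lets it
  control any other one. Orders 0 and 1 turn approximation in \<open>sobolev_norm\<close> into L2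
  approximation of a function and of its partial derivatives.\<close>

lemma sobolev_norm_ge:
  assumes \<Omega>: "open \<Omega>" and bs: "set bs \<subseteq> Basis" "length bs \<le> k"
    and h: "h \<in> L2_space \<Omega>" "has_weak_deriv \<Omega> bs g h"
  shows "L2_norm \<Omega> h \<le> sobolev_norm \<Omega> k g"
proof -
  let ?S = "{bs. set bs \<subseteq> Basis \<and> length bs \<le> k}"
  have "(L2_norm \<Omega> (weak_deriv \<Omega> bs g))\<^sup>2 \<le> (\<Sum>bs\<in>?S. (L2_norm \<Omega> (weak_deriv \<Omega> bs g))\<^sup>2)"
    using bs by (intro member_le_sum finite_lists_length_le finite_Basis) auto
  moreover have "L2_norm \<Omega> h = L2_norm \<Omega> (weak_deriv \<Omega> bs g)"
    using \<Omega> by (intro L2_norm_cong_AE h weak_deriv_AE) simp_all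
  ultimately show ?thesis
    unfolding sobolev_norm_def by (intro real_le_rsqrt) simp
qed

lemma sobolev_space_deriv2:
  assumes "v \<in> sobolev_space \<Omega> 2" "b \<in> Basis"
  obtains h where "h \<in> L2_space \<Omega>" "has_weak_deriv \<Omega> [b, b] v h"
  using assms unfolding sobolev_space_def by (auto dest!: spec[of _ "[b, b]"])

lemma weak_laplacian_L2:
  assumes \<Omega>: "open \<Omega>" and v: "v \<in> sobolev_space \<Omega> 2"
  shows "weak_laplacian \<Omega> v \<in> L2_space \<Omega>" and "has_weak_laplacian \<Omega> v (weak_laplacian \<Omega> v)"
proof -
  have "\<forall>b\<in>Basis. \<exists>h. h \<in> L2_space \<Omega> \<and> has_weak_deriv \<Omega> [b, b] v h"
    using sobolev_space_deriv2[OF v] by metis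
  then obtain l where l: "\<And>b. b \<in> Basis \<Longrightarrow> l b \<in> L2_space \<Omega>" "\<And>b. b \<in> Basis \<Longrightarrow> has_weak_deriv \<Omega> [b, b] v (l b)"
    by metis
  note lap = has_weak_laplacian_sobolev[OF \<Omega> l(2)]
  show "weak_laplacian \<Omega> v \<in> L2_space \<Omega>"
    by (rule L2_space_AE[OF _ L2_space_sum weak_laplacian_AE[OF \<Omega> lap]]) (use \<Omega> l in auto)
  show "has_weak_laplacian \<Omega> v (weak_laplacian \<Omega> v)"
    unfolding weak_laplacian_def by (rule someI[of "has_weak_laplacian \<Omega> v", OF lap])
qed

text \<open>A first partial of \<open>\<psi>\<close> is again a test function, so the definition of
  the first weak derivative of \<open>v\<close> can be tested with it.\<close>

lemma Green_identity_test:
  assumes \<Omega>: "open \<Omega>" "bounded \<Omega>" and v: "v \<in> sobolev_space \<Omega> 2" and \<psi>: "\<psi> \<in> test_functions \<Omega>"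
  shows "L2_inner \<Omega> (weak_laplacian \<Omega> v) \<psi> = - (\<Sum>b\<in>Basis. L2_inner \<Omega> (sobolev_deriv \<Omega> b v) (partials [b] \<psi>))"
proof -
  have vL: "locally_integrable \<Omega> v" using v \<Omega> by (intro L2_space_locally_integrable) (auto simp: sobolev_space_def)
  have pp: "partials [b, b] \<psi> \<in> test_functions \<Omega>" if "b \<in> Basis" for b
    using test_function_partials[OF test_function_partials[OF \<psi> that] that] by (simp add: partials_def)
  have "L2_inner \<Omega> (weak_laplacian \<Omega> v) \<psi> = (LINT x|lebesgue_on \<Omega>. v x * (\<Sum>b\<in>Basis. partials [b, b] \<psi> x))"
    using weak_laplacian_L2(2)[OF \<Omega>(1) v] \<psi> by (simp add: has_weak_laplacian_def L2_inner_def)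
  also have "\<dots> = (\<Sum>b\<in>Basis. LINT x|lebesgue_on \<Omega>. v x * partials [b, b] \<psi> x)"
    unfolding sum_distrib_left
    by (rule Bochner_Integration.integral_sum) (rule locally_integrable_mult_test[OF \<Omega>(1) vL pp])
  also have "\<dots> = (\<Sum>b\<in>Basis. - L2_inner \<Omega> (sobolev_deriv \<Omega> b v) (partials [b] \<psi>))"
  proof (intro sum.cong refl)
    fix b :: 'a assume b: "b \<in> Basis"
    have "partials [b, b] \<psi> = partials [b] (partials [b] \<psi>)" by (simp add: partials_def)
    then show "(LINT x|lebesgue_on \<Omega>. v x * partials [b, b] \<psi> x) = - L2_inner \<Omega> (sobolev_deriv \<Omega> b v) (partials [b] \<psi>)"
      using sobolev_deriv(2)[OF v _ b] test_function_partials[OF \<psi> b] by (simp add: has_weak_deriv_def L2_inner_def)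
  qed
  finally show ?thesis by (simp add: sum_negf)
qed

text \<open>Density replaces boundary traces: \<open>sobolev_H10\<close> consists of limits of test
  functions, and both sides are continuous in \<open>w\<close> for the first-order norm, with
  modulus \<open>C\<close>.\<close>

lemma Green_identity:
  assumes \<Omega>: "open \<Omega>" "bounded \<Omega>" and v: "v \<in> sobolev_space \<Omega> 2" and w: "w \<in> sobolev_H10 \<Omega>"
  shows "L2_inner \<Omega> (weak_laplacian \<Omega> v) w = - (\<Sum>b\<in>Basis. L2_inner \<Omega> (sobolev_deriv \<Omega> b v) (sobolev_deriv \<Omega> b w))"
    (is "?l = - ?r")
proof -
  have w1: "w \<in> sobolev_space \<Omega> 1" and wL: "w \<in> L2_space \<Omega>" using w by (auto simp: sobolev_H10_def sobolev_space_def)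
  note lv = weak_laplacian_L2(1)[OF \<Omega>(1) v]
  note dv = sobolev_deriv(1)[OF v] and dw = sobolev_deriv[OF w1]
  define C where "C = L2_norm \<Omega> (weak_laplacian \<Omega> v) + (\<Sum>b\<in>Basis. L2_norm \<Omega> (sobolev_deriv \<Omega> b v))"
  have "\<bar>?l + ?r\<bar> \<le> C * \<epsilon>" if \<epsilon>: "0 < \<epsilon>" for \<epsilon>
  proof -
    obtain \<psi> where \<psi>: "\<psi> \<in> test_functions \<Omega>" and small: "sobolev_norm \<Omega> 1 (\<lambda>x. w x - \<psi> x) < \<epsilon>"
      using w \<epsilon> by (auto simp: sobolev_H10_def)
    note \<psi>L = test_function_L2[OF \<Omega> \<psi>]
    have p\<psi>L: "partials [b] \<psi> \<in> L2_space \<Omega>" if "b \<in> Basis" for b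
      by (rule test_function_L2[OF \<Omega> test_function_partials[OF \<psi> that]])
    have d0: "L2_norm \<Omega> (\<lambda>x. w x - \<psi> x) \<le> \<epsilon>"
    proof -
      have "has_weak_deriv \<Omega> [] (\<lambda>x. w x - \<psi> x) (\<lambda>x. w x - \<psi> x)"
        using L2_space_locally_integrable[OF \<Omega>(1) L2_space_diff[OF wL \<psi>L]]
        by (simp add: has_weak_deriv_def partials_def)
      then have "L2_norm \<Omega> (\<lambda>x. w x - \<psi> x) \<le> sobolev_norm \<Omega> 1 (\<lambda>x. w x - \<psi> x)"
        by (intro sobolev_norm_ge[OF \<Omega>(1), of "[]"] L2_space_diff wL \<psi>L) simp_all
      then show ?thesis using small by simp
    qed
    have d1: "L2_norm \<Omega> (\<lambda>x. sobolev_deriv \<Omega> b w x - partials [b] \<psi> x) \<le> \<epsilon>" if b: "b \<in> Basis" for b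
    proof -
      have "L2_norm \<Omega> (\<lambda>x. sobolev_deriv \<Omega> b w x - partials [b] \<psi> x) \<le> sobolev_norm \<Omega> 1 (\<lambda>x. w x - \<psi> x)"
        using b by (intro sobolev_norm_ge[OF \<Omega>(1), of "[b]"] L2_space_diff has_weak_deriv_diff[OF \<Omega>(1)]
          dw p\<psi>L test_function_has_weak_deriv[OF \<Omega>(1) \<psi>]) simp_all
      then show ?thesis using small by simp
    qed
    have "?l + ?r = L2_inner \<Omega> (weak_laplacian \<Omega> v) (\<lambda>x. w x - \<psi> x)
      + (\<Sum>b\<in>Basis. L2_inner \<Omega> (sobolev_deriv \<Omega> b v) (\<lambda>x. sobolev_deriv \<Omega> b w x - partials [b] \<psi> x))"
      using Green_identity_test[OF \<Omega> v \<psi>]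
      by (simp add: L2_inner_diff_right lv wL \<psi>L dv dw p\<psi>L sum_subtractf cong: sum.cong)
    also have "\<bar>\<dots>\<bar> \<le> \<bar>L2_inner \<Omega> (weak_laplacian \<Omega> v) (\<lambda>x. w x - \<psi> x)\<bar>
      + (\<Sum>b\<in>Basis. \<bar>L2_inner \<Omega> (sobolev_deriv \<Omega> b v) (\<lambda>x. sobolev_deriv \<Omega> b w x - partials [b] \<psi> x)\<bar>)"
      by (rule order_trans[OF abs_triangle_ineq]) (intro add_left_mono sum_abs)
    also have "\<dots> \<le> L2_norm \<Omega> (weak_laplacian \<Omega> v) * \<epsilon> + (\<Sum>b\<in>Basis. L2_norm \<Omega> (sobolev_deriv \<Omega> b v) * \<epsilon>)"
    proof (intro add_mono sum_mono)
      show "\<bar>L2_inner \<Omega> (weak_laplacian \<Omega> v) (\<lambda>x. w x - \<psi> x)\<bar> \<le> L2_norm \<Omega> (weak_laplacian \<Omega> v) * \<epsilon>"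
        by (rule order_trans[OF L2_Cauchy_Schwarz[OF lv L2_space_diff[OF wL \<psi>L]] mult_left_mono[OF d0 L2_norm_nonneg]])
      show "\<bar>L2_inner \<Omega> (sobolev_deriv \<Omega> b v) (\<lambda>x. sobolev_deriv \<Omega> b w x - partials [b] \<psi> x)\<bar> \<le> L2_norm \<Omega> (sobolev_deriv \<Omega> b v) * \<epsilon>"
        if b: "b \<in> Basis" for b
        by (rule order_trans[OF L2_Cauchy_Schwarz[OF dv L2_space_diff[OF dw(1) p\<psi>L]] mult_left_mono[OF d1 L2_norm_nonneg]]) (use b in simp_all)
    qed
    finally show ?thesis by (simp add: C_def distrib_right sum_distrib_right)
  qed
  note bound = this
  have C0: "0 \<le> C" unfolding C_def by (intro add_nonneg_nonneg sum_nonneg L2_norm_nonneg)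
  have "\<bar>?l + ?r\<bar> \<le> 0 + e" if "0 < e" for e
  proof -
    have "\<bar>?l + ?r\<bar> \<le> C * (e / (C + 1))" using that C0 by (intro bound) simp
    also have "\<dots> \<le> e" using that C0 by (simp add: field_simps)
    finally show ?thesis by simp
  qed
  then have "\<bar>?l + ?r\<bar> \<le> 0" by (rule field_le_epsilon)
  then show ?thesis by simp
qed

section \<open>Stability of the scheme\<close>

lemma L2_space_if:
  assumes "f \<in> L2_space \<Omega>" "Measurable.pred (lebesgue_on \<Omega>) P"
  shows "(\<lambda>x. if P x then f x else 0) \<in> L2_space \<Omega>"
proof -
  have [measurable]: "f \<in> borel_measurable (lebesgue_on \<Omega>)" "Measurable.pred (lebesgue_on \<Omega>) P"
    using assms by (simp_all add: L2_space_def)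
  have m: "(\<lambda>x. if P x then f x else 0) \<in> borel_measurable (lebesgue_on \<Omega>)" by measurable
  have "integrable (lebesgue_on \<Omega>) (\<lambda>x. (f x)\<^sup>2)" using assms by (simp add: L2_space_def)
  then have "integrable (lebesgue_on \<Omega>) (\<lambda>x. (if P x then f x else 0)\<^sup>2)"
    by (rule Bochner_Integration.integrable_bound) (use m in auto)
  with m show ?thesis by (simp add: L2_space_def)
qed

text \<open>No integrability of the \<open>e q\<close> is assumed: as a function of the coefficient vector, the integral
  is linear on the subspace of those vectors that give an integrable combination, and \<open>0\<close> elsewhere.\<close>

lemma L2_integral_combination:
  fixes e :: "'q \<Rightarrow> 'b \<Rightarrow> real" and \<phi> :: "'q \<Rightarrow> 'a::euclidean_space \<Rightarrow> real"
  assumes "finite I" "\<And>q. q \<in> I \<Longrightarrow> \<phi> q \<in> L2_space \<Omega>"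
  shows "Measurable.pred (lebesgue_on \<Omega>) (\<lambda>x. integrable M (\<lambda>s. \<Sum>q\<in>I. \<phi> q x * e q s))
    \<and> (\<lambda>x. \<integral>s. (\<Sum>q\<in>I. \<phi> q x * e q s) \<partial>M) \<in> L2_space \<Omega>"
  using assms
proof (induction I arbitrary: \<phi> rule: finite_induct)
  case empty
  show ?case by (simp add: L2_space_0)
next
  case (insert r I)
  show ?case
  \<comment> \<open>Either \<open>e r\<close> is integrable modulo the other functions, and the
    shifted coefficients \<open>\<phi>'\<close> absorb the combination that is subtracted, or
    integrability forces \<open>\<phi> r x = 0\<close>, since division by a nonzero
    \<open>\<phi> r x\<close> would produce such a combination.\<close>
  proof (cases "\<exists>a. integrable M (\<lambda>s. e r s - (\<Sum>q\<in>I. a q * e q s))")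
    case True
    then obtain a where a: "integrable M (\<lambda>s. e r s - (\<Sum>q\<in>I. a q * e q s))" by blast
    define \<phi>' where "\<phi>' q x = \<phi> q x + a q * \<phi> r x" for q x
    have "\<phi>' q \<in> L2_space \<Omega>" if "q \<in> I" for q
      unfolding \<phi>'_def using insert.prems that by (intro L2_space_add L2_space_cmult) simp_all
    note IH = insert.IH[OF this]
    define v where "v = (\<integral>s. (e r s - (\<Sum>q\<in>I. a q * e q s)) \<partial>M)"
    have eq: "(\<Sum>q\<in>insert r I. \<phi> q x * e q s)
      = (\<Sum>q\<in>I. \<phi>' q x * e q s) + \<phi> r x * (e r s - (\<Sum>q\<in>I. a q * e q s))" for x s
      using insert.hyps
      by (simp add: \<phi>'_def distrib_left distrib_right sum.distrib right_diff_distrib sum_distrib_left mult_ac)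
    have ar: "integrable M (\<lambda>s. \<phi> r x * (e r s - (\<Sum>q\<in>I. a q * e q s)))" for x
      using a by (rule integrable_mult_right)
    have iff: "integrable M (\<lambda>s. \<Sum>q\<in>insert r I. \<phi> q x * e q s) \<longleftrightarrow> integrable M (\<lambda>s. \<Sum>q\<in>I. \<phi>' q x * e q s)" for x
    proof
      assume "integrable M (\<lambda>s. \<Sum>q\<in>insert r I. \<phi> q x * e q s)"
      from Bochner_Integration.integrable_diff[OF this ar[of x]]
      show "integrable M (\<lambda>s. \<Sum>q\<in>I. \<phi>' q x * e q s)" unfolding eq by simp
    next
      assume "integrable M (\<lambda>s. \<Sum>q\<in>I. \<phi>' q x * e q s)"
      from Bochner_Integration.integrable_add[OF this ar[of x]]
      show "integrable M (\<lambda>s. \<Sum>q\<in>insert r I. \<phi> q x * e q s)" unfolding eq .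
    qed
    have int: "(\<integral>s. (\<Sum>q\<in>insert r I. \<phi> q x * e q s) \<partial>M)
      = (if integrable M (\<lambda>s. \<Sum>q\<in>I. \<phi>' q x * e q s) then (\<integral>s. (\<Sum>q\<in>I. \<phi>' q x * e q s) \<partial>M) + v * \<phi> r x else 0)" for x
    proof (cases "integrable M (\<lambda>s. \<Sum>q\<in>I. \<phi>' q x * e q s)")
      case True
      then show ?thesis unfolding eq v_def using ar[of x] a by simp
    next
      case False
      then show ?thesis using iff[of x] not_integrable_integral_eq by auto
    qed
    show ?thesis
      unfolding iff int using IH insert.prems
      by (intro conjI L2_space_if L2_space_add L2_space_cmult) simp_all
  next
    case False
    have IH: "Measurable.pred (lebesgue_on \<Omega>) (\<lambda>x. integrable M (\<lambda>s. \<Sum>q\<in>I. \<phi> q x * e q s))"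
      "(\<lambda>x. \<integral>s. (\<Sum>q\<in>I. \<phi> q x * e q s) \<partial>M) \<in> L2_space \<Omega>"
      using insert.IH[of \<phi>] insert.prems by simp_all
    have iff: "integrable M (\<lambda>s. \<Sum>q\<in>insert r I. \<phi> q x * e q s)
      \<longleftrightarrow> \<phi> r x = 0 \<and> integrable M (\<lambda>s. \<Sum>q\<in>I. \<phi> q x * e q s)" for x
    proof
      assume i: "integrable M (\<lambda>s. \<Sum>q\<in>insert r I. \<phi> q x * e q s)"
      have "\<phi> r x = 0"
      proof (rule ccontr)
        assume nz: "\<phi> r x \<noteq> 0"
        have "integrable M (\<lambda>s. inverse (\<phi> r x) * (\<Sum>q\<in>insert r I. \<phi> q x * e q s))"
          using i by (rule integrable_mult_right)
        moreover have "inverse (\<phi> r x) * (\<Sum>q\<in>insert r I. \<phi> q x * e q s)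
          = e r s - (\<Sum>q\<in>I. (- inverse (\<phi> r x) * \<phi> q x) * e q s)" for s
          using insert.hyps nz by (simp add: distrib_left sum_distrib_left sum_negf mult.assoc[symmetric])
        ultimately have "integrable M (\<lambda>s. e r s - (\<Sum>q\<in>I. (- inverse (\<phi> r x) * \<phi> q x) * e q s))" by simp
        then show False using False by (metis (no_types))
      qed
      then show "\<phi> r x = 0 \<and> integrable M (\<lambda>s. \<Sum>q\<in>I. \<phi> q x * e q s)"
        using i insert.hyps by simp
    qed (use insert.hyps in simp)
    have int: "(\<integral>s. (\<Sum>q\<in>insert r I. \<phi> q x * e q s) \<partial>M)
      = (if \<phi> r x = 0 then (\<integral>s. (\<Sum>q\<in>I. \<phi> q x * e q s) \<partial>M) else 0)" for x
    proof (cases "\<phi> r x = 0")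
      case True
      then show ?thesis using insert.hyps by simp
    next
      case False
      then show ?thesis using iff[of x] not_integrable_integral_eq by auto
    qed
    have [measurable]: "\<phi> r \<in> borel_measurable (lebesgue_on \<Omega>)" using insert.prems by (simp add: L2_space_def)
    have r: "Measurable.pred (lebesgue_on \<Omega>) (\<lambda>x. \<phi> r x = 0)" by measurable
    show ?thesis
      unfolding iff int by (intro conjI L2_space_if pred_intros_logic IH r)
  qed
qed

text \<open>Needed for the triangle inequality for \<open>U\<close>. At each \<open>x\<close> the
  fractional integral depends on \<open>x\<close> only through the numbers
  \<open>\<phi> q x\<close>, which multiply fixed functions of time.\<close>

lemma correction_sum_L2:
  assumes "\<And>q. q \<in> {1..L} \<Longrightarrow> \<phi> q \<in> L2_space \<Omega>"
  shows "correction_sum \<Omega> \<phi> L m \<alpha> g t \<in> L2_space \<Omega>"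
proof -
  have "frac_proj_term \<Omega> \<phi> L \<nu> l g t \<in> L2_space \<Omega>" for \<nu> l
  proof -
    define e where "e q s = indicator {0<..<t} s * (frac_kernel \<nu> (t - s) * L2_inner \<Omega> ((weak_laplacian \<Omega> ^^ l) (g s)) (\<phi> q))" for q s
    have "frac_proj_term \<Omega> \<phi> L \<nu> l g t = (\<lambda>x. \<integral>s. (\<Sum>q=1..L. \<phi> q x * e q s) \<partial>lborel)"
      unfolding fun_eq_iff frac_proj_term_def frac_integral_def set_lebesgue_integral_def spectral_proj_def e_def
      by (intro allI Bochner_Integration.integral_cong refl) (simp add: sum_distrib_left mult_ac)
    then show ?thesis
      using L2_integral_combination[of "{1..L}" \<phi> \<Omega> lborel e] assms by simp
  qed
  then show ?thesis unfolding correction_sum_def[abs_def] by (intro L2_space_sum) simp_all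
qed

section \<open>Energy estimate for the scheme\<close>

lemma time_mesh_strict_mono:
  assumes "time_mesh T N t"
  shows "strict_mono_on {0..N} t"
proof -
  have "i < j \<longrightarrow> j \<le> N \<longrightarrow> t i < t j" for i j
  proof (induction j)
    case (Suc j)
    have "t j < t (Suc j)" if "Suc j \<le> N" using assms that by (simp add: time_mesh_def)
    with Suc show ?case by (cases "i = j") force+
  qed simp
  then show ?thesis by (auto simp: strict_mono_on_def)
qed

lemma L2_inner_0 [simp]: "L2_inner \<Omega> (\<lambda>x. 0) f = 0" "L2_inner \<Omega> f (\<lambda>x. 0) = 0"
  by (simp_all add: L2_inner_def)

lemma L2_inner_diff_combination:
  assumes "finite A" "f \<in> L2_space \<Omega>" "g \<in> L2_space \<Omega>" "\<And>i. i \<in> A \<Longrightarrow> y i \<in> L2_space \<Omega>"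
  shows "L2_inner \<Omega> (\<lambda>x. f x - g x) (\<lambda>x. \<Sum>i\<in>A. c i * y i x)
    = (\<Sum>i\<in>A. c i * (L2_inner \<Omega> f (y i) - L2_inner \<Omega> g (y i)))"
proof -
  have "L2_inner \<Omega> (\<lambda>x. f x - g x) (\<lambda>x. \<Sum>i\<in>A. c i * y i x)
    = (LINT x|lebesgue_on \<Omega>. (\<Sum>i\<in>A. c i * (f x * y i x - g x * y i x)))"
    unfolding L2_inner_def
    by (intro Bochner_Integration.integral_cong refl) (simp add: sum_distrib_left algebra_simps)
  also have "\<dots> = (\<Sum>i\<in>A. LINT x|lebesgue_on \<Omega>. c i * (f x * y i x - g x * y i x))"
    using assms by (intro Bochner_Integration.integral_sum integrable_mult_right Bochner_Integration.integrable_diff L2_mult_integrable)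
  also have "\<dots> = (\<Sum>i\<in>A. c i * (L2_inner \<Omega> f (y i) - L2_inner \<Omega> g (y i)))"
    unfolding L2_inner_def using assms by (intro sum.cong refl) (simp add: L2_mult_integrable)
  finally show ?thesis .
qed

text \<open>\<open>P b j\<close> plays the role of the partial derivative of \<open>W j\<close> in direction \<open>b\<close> and \<open>l j\<close> that
  of its Laplacian.\<close>

lemma caputo_L2_dissipative:
  fixes W l :: "nat \<Rightarrow> 'a::euclidean_space \<Rightarrow> real" and P :: "'a \<Rightarrow> nat \<Rightarrow> 'a \<Rightarrow> real"
  assumes \<gamma>: "0 < \<gamma>" "\<gamma> < 1" and mono: "strict_mono_on {0..n} t" and t0: "t 0 = 0"
    and ratio: "\<And>k. k \<in> {2..n} \<Longrightarrow> step_ratio t k \<in> {1/2..407/235}"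
    and L2: "\<And>j. j \<le> n \<Longrightarrow> W j \<in> L2_space \<Omega>" "\<And>j. j \<le> n \<Longrightarrow> l j \<in> L2_space \<Omega>"
      "\<And>b j. b \<in> Basis \<Longrightarrow> j \<le> n \<Longrightarrow> P b j \<in> L2_space \<Omega>"
    and Green: "\<And>i j. i \<le> n \<Longrightarrow> j \<le> n \<Longrightarrow> L2_inner \<Omega> (W j) (l i) = - (\<Sum>b\<in>Basis. L2_inner \<Omega> (P b j) (P b i))"
  shows "(\<Sum>k=1..n. L2_inner \<Omega> (\<lambda>x. W k x - W (k - 1) x) (\<lambda>x. caputo_L2 t \<gamma> k (\<lambda>j. l j x))) \<le> 0"
proof -
  have "\<exists>M. \<forall>w. caputo_L2 t \<gamma> k w = (\<Sum>i\<le>k. M i * w i)" if "k \<in> {1..n}" for k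
    using linear_in_values_caputo_L2[OF \<gamma> monotone_on_subset[OF mono] t0, of k] that
    unfolding linear_in_values_def by auto
  then obtain M where M: "\<And>k w. k \<in> {1..n} \<Longrightarrow> caputo_L2 t \<gamma> k w = (\<Sum>i\<le>k. M k i * w i)" by metis
  have PL: "(\<lambda>x. P b k x - P b (k - 1) x) \<in> L2_space \<Omega>" "(\<lambda>x. caputo_L2 t \<gamma> k (\<lambda>j. P b j x)) \<in> L2_space \<Omega>"
    if "b \<in> Basis" "k \<in> {1..n}" for b k
    using that M by (auto intro!: L2_space_diff L2_space_sum L2_space_cmult L2)
  \<comment> \<open>The coefficients \<open>M k i\<close> are constant in space, so Green's identity
    applies term by term and the time operator is reassembled on the partial derivatives.\<close>
  have "(\<Sum>k=1..n. L2_inner \<Omega> (\<lambda>x. W k x - W (k - 1) x) (\<lambda>x. caputo_L2 t \<gamma> k (\<lambda>j. l j x)))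
    = (\<Sum>k=1..n. - (\<Sum>b\<in>Basis. L2_inner \<Omega> (\<lambda>x. P b k x - P b (k - 1) x) (\<lambda>x. caputo_L2 t \<gamma> k (\<lambda>j. P b j x))))"
  proof (intro sum.cong refl)
    fix k assume k: "k \<in> {1..n}"
    then have k': "k \<le> n" "k - 1 \<le> n" "\<And>i. i \<le> k \<Longrightarrow> i \<le> n" by auto
    have "L2_inner \<Omega> (\<lambda>x. W k x - W (k - 1) x) (\<lambda>x. caputo_L2 t \<gamma> k (\<lambda>j. l j x))
      = (\<Sum>i\<le>k. M k i * (L2_inner \<Omega> (W k) (l i) - L2_inner \<Omega> (W (k - 1)) (l i)))"
      unfolding M[OF k] using k' by (intro L2_inner_diff_combination L2) simp_all
    also have "\<dots> = (\<Sum>i\<le>k. - (\<Sum>b\<in>Basis. M k i * (L2_inner \<Omega> (P b k) (P b i) - L2_inner \<Omega> (P b (k - 1)) (P b i))))"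
      using k' by (intro sum.cong refl) (simp add: Green sum_distrib_left[symmetric] sum_subtractf algebra_simps)
    also have "\<dots> = - (\<Sum>b\<in>Basis. \<Sum>i\<le>k. M k i * (L2_inner \<Omega> (P b k) (P b i) - L2_inner \<Omega> (P b (k - 1)) (P b i)))"
      unfolding sum_negf by (subst sum.swap) simp
    also have "\<dots> = - (\<Sum>b\<in>Basis. L2_inner \<Omega> (\<lambda>x. P b k x - P b (k - 1) x) (\<lambda>x. caputo_L2 t \<gamma> k (\<lambda>j. P b j x)))"
      unfolding M[OF k] using k'
      by (intro arg_cong[where f = uminus] sum.cong refl L2_inner_diff_combination[symmetric] L2) simp_all
    finally show "L2_inner \<Omega> (\<lambda>x. W k x - W (k - 1) x) (\<lambda>x. caputo_L2 t \<gamma> k (\<lambda>j. l j x)) = \<dots>" .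
  qed
  also have "\<dots> = - (\<Sum>b\<in>Basis. \<Sum>k=1..n. L2_inner \<Omega> (\<lambda>x. P b k x - P b (k - 1) x) (\<lambda>x. caputo_L2 t \<gamma> k (\<lambda>j. P b j x)))"
    unfolding sum_negf by (subst sum.swap) simp
  also have "\<dots> \<le> 0"
  proof -
    have "0 \<le> (\<Sum>k=1..n. L2_inner \<Omega> (\<lambda>x. P b k x - P b (k - 1) x) (\<lambda>x. caputo_L2 t \<gamma> k (\<lambda>j. P b j x)))"
      if b: "b \<in> Basis" for b
    proof -
      have "(\<Sum>k=1..n. L2_inner \<Omega> (\<lambda>x. P b k x - P b (k - 1) x) (\<lambda>x. caputo_L2 t \<gamma> k (\<lambda>j. P b j x)))
        = (LINT x|lebesgue_on \<Omega>. (\<Sum>k=1..n. (P b k x - P b (k - 1) x) * caputo_L2 t \<gamma> k (\<lambda>j. P b j x)))"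
        unfolding L2_inner_def
        by (rule Bochner_Integration.integral_sum[symmetric]) (intro L2_mult_integrable PL b)
      also have "\<dots> \<ge> 0"
        by (intro Bochner_Integration.integral_nonneg caputo_L2_nonneg[OF \<gamma> mono t0 ratio])
      finally show ?thesis .
    qed
    then show ?thesis by (simp add: sum_nonneg)
  qed
  finally show ?thesis .
qed

text \<open>The estimate stays pointwise in \<open>x\<close> as long as possible and is integrated
  only at the end. The factor 54800 is twice 27400, since Young's inequality gives away half of the
  BDF3 dissipation.\<close>

lemma scheme_stability:
  fixes V F :: "nat \<Rightarrow> 'a::euclidean_space \<Rightarrow> real"
  assumes \<Omega>: "open \<Omega>" "bounded \<Omega>" and \<alpha>: "0 < \<alpha>" "\<alpha> < 1" and mesh: "time_mesh T N t"
    and ratio: "\<And>k. k \<in> {2..N} \<Longrightarrow> step_ratio t k \<in> {1/2..<407/235}"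
    and scheme: "scheme_solution \<Omega> \<alpha> N t F V" and n: "n \<in> {1..N}"
  shows "(L2_norm \<Omega> (V n))\<^sup>2 \<le> 54800 * T * (123300 * (\<Sum>k=1..n. step t k * (L2_norm \<Omega> (F k))\<^sup>2))"
proof -
  have \<Omega>s: "\<Omega> \<in> sets lebesgue" using \<Omega> by simp
  have mono: "strict_mono_on {0..N} t" using mesh by (rule time_mesh_strict_mono)
  have t0: "t 0 = 0" and tN: "t N = T" using mesh by (simp_all add: time_mesh_def)
  have step_pos: "0 < step t k" if "k \<in> {1..N}" for k
    using strict_mono_onD[OF mono, of "k - 1" k] that by (simp add: step_def)
  have tn: "0 < t n" "t n \<le> T"
    using strict_mono_onD[OF mono, of 0 n] strict_mono_onD[OF mono, of n N] n t0 tN by (cases "n = N"; auto)+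
  have V0: "AE x in lebesgue_on \<Omega>. V 0 x = 0" using scheme by (simp add: scheme_solution_def)
  have V: "V k \<in> sobolev_space \<Omega> 2" "V k \<in> sobolev_H10 \<Omega>" if "k \<in> {1..N}" for k
    using scheme that by (auto simp: scheme_solution_def)
  \<comment> \<open>\<open>V 0\<close> vanishes only almost everywhere. With exact zero functions at
    index 0, Green's identity holds trivially there.\<close>
  define W where "W j = (if j = 0 then (\<lambda>x. 0) else V j)" for j
  define l where "l j = (if j = 0 then (\<lambda>x. 0) else weak_laplacian \<Omega> (V j))" for j
  define P where "P b j = (if j = 0 then (\<lambda>x. 0) else sobolev_deriv \<Omega> b (V j))" for b j
  have "V j \<in> L2_space \<Omega>" if "j \<in> {1..N}" for j using V(1)[OF that] by (simp add: sobolev_space_def)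
  then have WL: "W j \<in> L2_space \<Omega>" if "j \<le> N" for j using that by (simp add: W_def L2_space_0)
  have lL: "l j \<in> L2_space \<Omega>" if "j \<le> N" for j
    using that weak_laplacian_L2(1)[OF \<Omega>(1) V(1)] by (simp add: l_def L2_space_0)
  have PL: "P b j \<in> L2_space \<Omega>" if "b \<in> Basis" "j \<le> N" for b j
    using that sobolev_deriv(1)[OF V(1)] by (simp add: P_def L2_space_0)
  have Green: "L2_inner \<Omega> (W j) (l i) = - (\<Sum>b\<in>Basis. L2_inner \<Omega> (P b j) (P b i))" if "i \<le> N" "j \<le> N" for i j
    using that Green_identity[OF \<Omega> V(1) V(2), of i j]
    by (simp add: W_def l_def P_def L2_inner_commute[of \<Omega> "V j"] L2_inner_commute[of \<Omega> "sobolev_deriv \<Omega> _ (V j)"])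
  \<comment> \<open>The zero function is a weak Laplacian of \<open>V 0\<close>; this pins down the
    representative picked by \<open>weak_laplacian\<close> up to a null set.\<close>
  have lap0: "AE x in lebesgue_on \<Omega>. weak_laplacian \<Omega> (V 0) x = 0"
  proof -
    have "V 0 \<in> L2_space \<Omega>" using V0 by (intro L2_space_AE[OF \<Omega>s L2_space_0]) (auto elim: eventually_mono)
    then have loc: "locally_integrable \<Omega> (V 0)" by (rule L2_space_locally_integrable[OF \<Omega>(1)])
    have "(LINT x|lebesgue_on \<Omega>. V 0 x * f x) = 0" for f :: "'a \<Rightarrow> real"
      using V0 by (intro integral_eq_zero_AE) (auto elim: eventually_mono)
    then have "has_weak_laplacian \<Omega> (V 0) (\<lambda>x. 0)"
      using loc L2_space_locally_integrable[OF \<Omega>(1) L2_space_0] by (simp add: has_weak_laplacian_def)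
    from weak_laplacian_AE[OF \<Omega>(1) this] show ?thesis by (auto elim: eventually_mono)
  qed
  define d where "d k x = diff_quot t (\<lambda>j. W j x) k" for k x
  define e where "e k x = (if k \<le> 2 then d k x else bdf3 t (\<lambda>j. W j x) k)" for k x
  define G where "G k x = caputo_L2 t (1 - \<alpha>) k (\<lambda>j. l j x)" for k x
  define \<Delta> where "\<Delta> k x = W k x - W (k - 1) x" for k x
  have eq: "AE x in lebesgue_on \<Omega>. \<forall>k\<in>{1..N}. e k x - G k x = F k x"
  proof -
    have "AE x in lebesgue_on \<Omega>. \<forall>k\<in>{1..N}. (if k \<le> 2 then diff_quot t (\<lambda>j. V j x) k else bdf3 t (\<lambda>j. V j x) k)
             - caputo_L2 t (1 - \<alpha>) k (\<lambda>j. weak_laplacian \<Omega> (V j) x) = F k x"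
      using scheme by (intro AE_finite_allI) (auto simp: scheme_solution_def)
    with V0 lap0 show ?thesis
    proof eventually_elim
      case (elim x)
      have *: "(\<lambda>j. W j x) = (\<lambda>j. V j x)" "(\<lambda>j. l j x) = (\<lambda>j. weak_laplacian \<Omega> (V j) x)"
        using elim(1,2) by (auto simp: W_def l_def fun_eq_iff)
      show ?case unfolding e_def d_def G_def * using elim(3) by simp
    qed
  qed
  have dL: "d k \<in> L2_space \<Omega>" if "k \<le> N" for k
    unfolding d_def[abs_def] diff_quot_def
    using L2_space_cmult[OF L2_space_diff[OF WL WL], of k "k - 1" "1 / step t k"] that by simp
  have eL: "e k \<in> L2_space \<Omega>" if "k \<le> N" for k
    unfolding e_def[abs_def] bdf3_def d_def[symmetric] using that
    by (cases "k \<le> 2") (auto intro!: L2_space_sum L2_space_cmult dL)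
  have GL: "G k \<in> L2_space \<Omega>" if "k \<in> {1..N}" for k
  proof -
    have "linear_in_values k (\<lambda>w. caputo_L2 t (1 - \<alpha>) k w)"
      by (rule linear_in_values_caputo_L2[OF _ _ monotone_on_subset[OF mono] t0]) (use \<alpha> that in auto)
    then obtain M where M: "\<And>w. caputo_L2 t (1 - \<alpha>) k w = (\<Sum>i\<le>k. M i * w i)"
      unfolding linear_in_values_def by blast
    show ?thesis unfolding G_def[abs_def] M using that by (intro L2_space_sum L2_space_cmult lL) simp_all
  qed
  \<comment> \<open>Square integrability of the data is read off the equation, both terms on its
    left being in \<open>L2_space\<close>.\<close>
  have FL: "F k \<in> L2_space \<Omega>" if "k \<in> {1..N}" for k
  proof (rule L2_space_AE[OF \<Omega>s L2_space_diff[OF eL GL]])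
    show "AE x in lebesgue_on \<Omega>. e k x - G k x = F k x" using eq that by (auto elim: eventually_mono)
  qed (use that in auto)
  have \<Delta>L: "\<Delta> k \<in> L2_space \<Omega>" if "k \<in> {1..N}" for k
    unfolding \<Delta>_def[abs_def] using that by (intro L2_space_diff WL) auto
  have dissip: "(\<Sum>k=1..m. L2_inner \<Omega> (\<Delta> k) (G k)) \<le> 0" if "m \<le> N" for m
    unfolding \<Delta>_def[abs_def] G_def[abs_def]
    by (rule caputo_L2_dissipative[where P = P])
      (use \<alpha> that t0 ratio WL lL PL Green in \<open>auto intro: monotone_on_subset[OF mono] less_imp_le\<close>)
  \<comment> \<open>The memory terms of the full sum and of the two extra copies. Their sign is
    known only after integration in space, since it rests on Green's identity, so \<open>R\<close>
    is carried through the pointwise estimate.\<close>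
  define R where "R x = (\<Sum>k=1..n. \<Delta> k x * G k x) + 2 * (\<Sum>k=1..min n 2. \<Delta> k x * G k x)" for x
  define S where "S x = (\<Sum>k=1..n. step t k * (F k x * F k x))" for x
  have pointwise: "W n x * W n x \<le> 54800 * T * (123300 * S x + R x)"
    if eqx: "\<forall>k\<in>{1..N}. e k x - G k x = F k x" for x
  proof -
    let ?D = "\<Sum>k=1..n. step t k * (d k x)\<^sup>2"
    have sd: "step t k * d k x = \<Delta> k x" if "k \<in> {1..N}" for k
      using step_pos[OF that] by (simp add: d_def \<Delta>_def diff_quot_def)
    have energy: "?D / 27400 \<le> (\<Sum>k=1..n. step t k * d k x * e k x) + 2 * (\<Sum>k=1..min n 2. step t k * d k x * e k x)"
    proof (rule bdf3_energy[where e = "\<lambda>k. e k x" and d = "\<lambda>k. d k x" and \<tau> = "step t"])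
      show "step t k / step t (k - 1) \<in> {1/2..<407/235}" if "k \<in> {2..n}" for k
        using ratio[of k] that n by (simp add: step_ratio_def)
      show "e k x = (if k \<le> 2 then d k x else
        (\<Sum>j\<le>2. bdf3_sigma j (step t k / step t (k - 1)) (step t (k - 1) / step t (k - 2)) * d (k - j) x))" for k
        by (simp add: e_def bdf3_def step_ratio_def d_def numeral_2_eq_2)
    qed (use step_pos n in auto)
    have split: "(\<Sum>k=1..m. step t k * d k x * e k x) = (\<Sum>k=1..m. step t k * (d k x * F k x)) + (\<Sum>k=1..m. \<Delta> k x * G k x)"
      if "m \<le> n" for m
      unfolding sum.distrib[symmetric]
    proof (intro sum.cong refl)
      fix k assume "k \<in> {1..m}"
      then have k: "k \<in> {1..N}" using that n by auto
      then have "e k x = F k x + G k x" using eqx by (simp add: algebra_simps)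
      then show "step t k * d k x * e k x = step t k * (d k x * F k x) + \<Delta> k x * G k x"
        unfolding sd[OF k, symmetric] by (simp add: algebra_simps)
    qed
    \<comment> \<open>\<open>164400 = 3 * 54800\<close>, so the three copies use up exactly half of
      the rate \<open>1 / 27400\<close>; \<open>41100 = 164400 / 4\<close> is the dual constant, and
      \<open>123300 = 3 * 41100\<close>.\<close>
    have young: "\<bar>a * b\<bar> \<le> a\<^sup>2 / 164400 + 41100 * (b * b)" for a b :: real
    proof -
      have "0 \<le> (\<bar>a\<bar> - 82200 * \<bar>b\<bar>)\<^sup>2" by simp
      then show ?thesis by (simp add: power2_eq_square algebra_simps abs_mult)
    qed
    have "(\<Sum>k=1..n. step t k * (d k x * F k x)) + 2 * (\<Sum>k=1..min n 2. step t k * (d k x * F k x))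
      \<le> 3 * (\<Sum>k=1..n. step t k * \<bar>d k x * F k x\<bar>)"
    proof -
      have "(\<Sum>k=1..n. step t k * (d k x * F k x)) \<le> (\<Sum>k=1..n. step t k * \<bar>d k x * F k x\<bar>)"
        using step_pos n by (intro sum_mono mult_left_mono) (auto intro: less_imp_le)
      moreover have "(\<Sum>k=1..min n 2. step t k * (d k x * F k x)) \<le> (\<Sum>k=1..min n 2. step t k * \<bar>d k x * F k x\<bar>)"
        using step_pos n by (intro sum_mono mult_left_mono) (auto intro: less_imp_le)
      moreover have "(\<Sum>k=1..min n 2. step t k * \<bar>d k x * F k x\<bar>) \<le> (\<Sum>k=1..n. step t k * \<bar>d k x * F k x\<bar>)"
        using step_pos n by (intro sum_mono2 mult_nonneg_nonneg) (auto intro: less_imp_le)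
      ultimately show ?thesis by linarith
    qed
    also have "\<dots> \<le> 3 * (\<Sum>k=1..n. step t k * ((d k x)\<^sup>2 / 164400 + 41100 * (F k x * F k x)))"
      using step_pos n by (intro mult_left_mono sum_mono young) (auto intro: less_imp_le)
    also have "\<dots> = ?D / 54800 + 123300 * S x"
      by (simp add: S_def sum.distrib sum_distrib_left sum_distrib_right sum_divide_distrib distrib_left mult_ac)
    finally have "?D / 27400 \<le> ?D / 54800 + 123300 * S x + R x"
      using energy split[of n] split[of "min n 2"] by (simp add: R_def)
    then have D: "?D \<le> 54800 * (123300 * S x + R x)" by simp
    have sumstep: "(\<Sum>k=1..n. step t k) = t n"
      using sum_telescope''[of 0 n t] t0 by (simp add: step_def)
    have tele: "W n x = (\<Sum>k=1..n. \<Delta> k x)"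
      using sum_telescope''[of 0 n "\<lambda>k. W k x"] by (simp add: \<Delta>_def W_def)
    also have "\<dots> = (\<Sum>k=1..n. sqrt (step t k) * (sqrt (step t k) * d k x))"
      using step_pos n by (intro sum.cong refl) (simp add: sd[symmetric] mult.assoc[symmetric] less_imp_le)
    finally have "(W n x)\<^sup>2 \<le> (\<Sum>k=1..n. (sqrt (step t k))\<^sup>2) * (\<Sum>k=1..n. (sqrt (step t k) * d k x)\<^sup>2)"
      using Cauchy_Schwarz_ineq_sum[of "\<lambda>k. sqrt (step t k)" "\<lambda>k. sqrt (step t k) * d k x" "{1..n}"] by simp
    also have "\<dots> = t n * ?D"
      unfolding sumstep[symmetric] using step_pos n
      by (intro arg_cong2[where f = "(*)"] sum.cong refl) (auto simp: power_mult_distrib less_imp_le)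
    also have "\<dots> \<le> T * ?D"
      using tn step_pos n by (intro mult_right_mono sum_nonneg mult_nonneg_nonneg) (auto intro: less_imp_le)
    also have "\<dots> \<le> T * (54800 * (123300 * S x + R x))" using D tn by (intro mult_left_mono) auto
    finally show ?thesis by (simp add: power2_eq_square mult_ac)
  qed
  have iW: "integrable (lebesgue_on \<Omega>) (\<lambda>x. W n x * W n x)" using n by (intro L2_mult_integrable WL) simp_all
  have iF: "integrable (lebesgue_on \<Omega>) (\<lambda>x. F k x * F k x)" if "k \<in> {1..n}" for k
    using that n by (intro L2_mult_integrable FL) simp_all
  have i\<Delta>: "integrable (lebesgue_on \<Omega>) (\<lambda>x. \<Delta> k x * G k x)" if "k \<in> {1..n}" for k
    using that n by (intro L2_mult_integrable \<Delta>L GL) simp_all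
  have iS: "has_bochner_integral (lebesgue_on \<Omega>) S (\<Sum>k=1..n. step t k * L2_inner \<Omega> (F k) (F k))"
    unfolding S_def[abs_def] L2_inner_def
    by (intro has_bochner_integral_sum has_bochner_integral_mult_right has_bochner_integral_integrable iF)
  have iR: "has_bochner_integral (lebesgue_on \<Omega>) R
    ((\<Sum>k=1..n. L2_inner \<Omega> (\<Delta> k) (G k)) + 2 * (\<Sum>k=1..min n 2. L2_inner \<Omega> (\<Delta> k) (G k)))"
    unfolding R_def[abs_def] L2_inner_def
    by (intro has_bochner_integral_add has_bochner_integral_sum has_bochner_integral_mult_right
      has_bochner_integral_integrable i\<Delta>) auto
  have iSR: "has_bochner_integral (lebesgue_on \<Omega>) (\<lambda>x. 54800 * T * (123300 * S x + R x))
    (54800 * T * (123300 * (\<Sum>k=1..n. step t k * L2_inner \<Omega> (F k) (F k))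
     + ((\<Sum>k=1..n. L2_inner \<Omega> (\<Delta> k) (G k)) + 2 * (\<Sum>k=1..min n 2. L2_inner \<Omega> (\<Delta> k) (G k)))))"
    by (intro has_bochner_integral_mult_right has_bochner_integral_add iS iR)
  have "L2_inner \<Omega> (W n) (W n) \<le> (LINT x|lebesgue_on \<Omega>. 54800 * T * (123300 * S x + R x))"
    unfolding L2_inner_def
    using iSR by (intro integral_mono_AE iW eventually_mono[OF eq] pointwise) (auto simp: has_bochner_integral_iff)
  also have "\<dots> = 54800 * T * (123300 * (\<Sum>k=1..n. step t k * L2_inner \<Omega> (F k) (F k))
     + ((\<Sum>k=1..n. L2_inner \<Omega> (\<Delta> k) (G k)) + 2 * (\<Sum>k=1..min n 2. L2_inner \<Omega> (\<Delta> k) (G k))))"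
    using iSR by (rule has_bochner_integral_integral_eq)
  also have "\<dots> \<le> 54800 * T * (123300 * (\<Sum>k=1..n. step t k * L2_inner \<Omega> (F k) (F k)))"
  proof -
    have "n \<le> N" "min n 2 \<le> N" using n by auto
    then show ?thesis using dissip[of n] dissip[of "min n 2"] tn by (intro mult_left_mono) auto
  qed
  finally show ?thesis
    using n by (simp add: L2_norm_power2 W_def)
qed

theorem theorem3p3:
  fixes \<Omega> :: "'a::euclidean_space set"
    and \<alpha> T :: real and m L :: nat
    and lam :: "nat \<Rightarrow> real" and \<phi> :: "nat \<Rightarrow> 'a \<Rightarrow> real"
  assumes "DIM('a) \<le> 3"
    and "open \<Omega>" and "bounded \<Omega>" and "smooth_boundary \<Omega>"
    and "0 < \<alpha>" and "\<alpha> < 1" and "0 < T" and "1 \<le> m" and "1 \<le> L"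
    and "dirichlet_eigensystem \<Omega> lam \<phi>"
  shows "\<exists>Q>0. \<forall>(u0 :: 'a \<Rightarrow> real) (f :: real \<Rightarrow> 'a \<Rightarrow> real) (\<gamma>h :: real) (N :: nat)
            (t :: nat \<Rightarrow> real) (V :: nat \<Rightarrow> 'a \<Rightarrow> real) (U :: nat \<Rightarrow> 'a \<Rightarrow> real)
            (F :: nat \<Rightarrow> 'a \<Rightarrow> real).
     u0 \<in> L2_space \<Omega> \<longrightarrow> (\<exists>h. has_weak_laplacian \<Omega> u0 h) \<longrightarrow>
     0 < \<gamma>h \<longrightarrow> \<gamma>h < 1/2 \<longrightarrow>
     continuous_in_frac_sobolev \<Omega> (2 * m) \<gamma>h T (f_tilde \<Omega> u0 f) \<longrightarrow>
     time_mesh T N t \<longrightarrow> (\<forall>k\<in>{2..N}. step_ratio t k \<in> {0.5..1.7319}) \<longrightarrow>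
     (\<forall>k. F k = source_F \<Omega> T \<phi> L m \<alpha> (f_tilde \<Omega> u0 f) (t k)) \<longrightarrow>
     scheme_solution \<Omega> \<alpha> N t F V \<longrightarrow>
     (\<forall>k\<in>{1..N}. AE x in lebesgue_on \<Omega>.
        U k x = V k x + u0 x + correction_sum \<Omega> \<phi> L m \<alpha> (f_tilde \<Omega> u0 f) (t k) x) \<longrightarrow>
     (\<forall>n\<in>{1..N}.
        L2_norm \<Omega> (V n) \<le> Q * sqrt (\<Sum>k=1..n. step t k * (L2_norm \<Omega> (F k))\<^sup>2) \<and>
        L2_norm \<Omega> (U n) \<le> L2_norm \<Omega> u0
          + Q * sqrt (\<Sum>k=1..n. step t k * (L2_norm \<Omega> (F k))\<^sup>2)
          + L2_norm \<Omega> (correction_sum \<Omega> \<phi> L m \<alpha> (f_tilde \<Omega> u0 f) (t n)))"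
proof -
  define Q where "Q = sqrt (54800 * T * 123300)"
  have Q: "0 < Q" using \<open>0 < T\<close> by (simp add: Q_def)
  have \<phi>: "\<phi> q \<in> L2_space \<Omega>" if "q \<in> {1..L}" for q
    using assms(10) that by (auto simp: dirichlet_eigensystem_def sobolev_space_def)
  have main: "L2_norm \<Omega> (V n) \<le> Q * sqrt (\<Sum>k=1..n. step t k * (L2_norm \<Omega> (F k))\<^sup>2) \<and>
        L2_norm \<Omega> (U n) \<le> L2_norm \<Omega> u0
          + Q * sqrt (\<Sum>k=1..n. step t k * (L2_norm \<Omega> (F k))\<^sup>2)
          + L2_norm \<Omega> (correction_sum \<Omega> \<phi> L m \<alpha> (f_tilde \<Omega> u0 f) (t n))"
    if u0: "u0 \<in> L2_space \<Omega>" and mesh: "time_mesh T N t"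
      and ratio: "\<forall>k\<in>{2..N}. step_ratio t k \<in> {0.5..1.7319}"
      and scheme: "scheme_solution \<Omega> \<alpha> N t F V" and n: "n \<in> {1..N}"
      and U: "\<forall>k\<in>{1..N}. AE x in lebesgue_on \<Omega>.
        U k x = V k x + u0 x + correction_sum \<Omega> \<phi> L m \<alpha> (f_tilde \<Omega> u0 f) (t k) x"
    for u0 :: "'a \<Rightarrow> real" and f :: "real \<Rightarrow> 'a \<Rightarrow> real" and N n and t :: "nat \<Rightarrow> real"
      and V U F :: "nat \<Rightarrow> 'a \<Rightarrow> real"
  proof -
    let ?S = "\<Sum>k=1..n. step t k * (L2_norm \<Omega> (F k))\<^sup>2"
    let ?c = "correction_sum \<Omega> \<phi> L m \<alpha> (f_tilde \<Omega> u0 f) (t n)"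
    \<comment> \<open>\<open>407 / 235 = 1.731914...\<close> just exceeds 1.7319, so the closed
      range lies inside the half-open one.\<close>
    have ratio': "step_ratio t k \<in> {1/2..<407/235}" if "k \<in> {2..N}" for k
      using ratio that by force
    have "(L2_norm \<Omega> (V n))\<^sup>2 \<le> 54800 * T * (123300 * ?S)"
      using assms by (intro scheme_stability[OF _ _ _ _ mesh ratio' scheme n]) simp_all
    also have "\<dots> = 54800 * T * 123300 * ?S" by simp
    finally have "L2_norm \<Omega> (V n) \<le> sqrt (54800 * T * 123300 * ?S)" by (rule real_le_rsqrt)
    then have V: "L2_norm \<Omega> (V n) \<le> Q * sqrt ?S" by (simp add: Q_def real_sqrt_mult)
    have VL: "V n \<in> L2_space \<Omega>" using scheme n by (auto simp: scheme_solution_def sobolev_space_def)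
    have cL: "?c \<in> L2_space \<Omega>" by (rule correction_sum_L2[OF \<phi>])
    have "L2_norm \<Omega> (U n) = L2_norm \<Omega> (\<lambda>x. V n x + u0 x + ?c x)"
    proof (rule L2_norm_cong_AE[symmetric])
      show "AE x in lebesgue_on \<Omega>. V n x + u0 x + ?c x = U n x"
        using bspec[OF U n] by eventually_elim simp
    qed (use assms VL u0 cL in \<open>auto intro!: L2_space_add\<close>)
    also have "\<dots> \<le> L2_norm \<Omega> (\<lambda>x. V n x + u0 x) + L2_norm \<Omega> ?c"
      by (intro L2_norm_triangle L2_space_add VL u0 cL)
    also have "\<dots> \<le> L2_norm \<Omega> (V n) + L2_norm \<Omega> u0 + L2_norm \<Omega> ?c"
      by (intro add_right_mono L2_norm_triangle VL u0)
    finally show ?thesis using V by simp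
  qed
  show ?thesis
    by (intro exI[of _ Q] conjI[OF Q] allI impI ballI) (rule main)
qed

end
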